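(* There is a constant $c$ such that for all sufficiently large $k$ there exists a string $x$ of length $4k$ with $|C(x)-3k|\le c\log k$ that is $(c\log k,c\log k)$-normal and such that: 1) the profile $P_x$ is $c\log k$-close to the set $G_k=\{(a,b)\in\mathbb{N}^2: a+b\ge 4k\ \text{or}\ (a\ge k\text{ and } a+b\ge 3k)\}$; 2) there is a finite set $A\ni x$ with $CT(A\mid x)\le c\log k$, $|C(A)-k|\le c\log k$ and $\log_2|A|=2k$; 3) for all natural $m,l,\epsilon,\delta$ and every program $q$ that enumerates the set $L_m$ of all strings of complexity at most $m$, if $S^q_{m,l}$ is defined, $x\in S^q_{m,l}$, $CT(S^q_{m,l}\mid x)<\epsilon$, $C(S^q_{m,l})+\log_2|S^q_{m,l}|-C(x)\le\epsilon$ and $C(S^q_{m,l})\le k+\delta$, then $c(\epsilon+\delta+C(q)+1)\ge k-c\log k$.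
   Context: Strings are binary; $C$ is plain Kolmogorov complexity w.r.t. a fixed universal decompressor $D$; complexity of finite sets (and of programs $q$) is defined via fixed computable encodings. $CT(y\mid x)$ is the minimal length of a program $p$ with $D(p,z)$ defined for all $z$ and $D(p,x)=y$. Profile $P_x=\{(a,b):\exists A\ni x,\ C(A)\le a,\ \log_2|A|\le b\}$; $\epsilon$-strong profile $P_x^{\epsilon}$ is the same with the additional requirement $CT(A\mid x)\le\epsilon$. $x$ is $(\epsilon,\delta)$-normal if $(a,b)\in P_x$ implies $(a+\delta,b+\delta)\in P_x^\epsilon$. Subsets of $\mathbb{N}^2$ are $\varepsilon$-close if each lies in the $\varepsilon$-neighbourhood of the other. Universal models: let $L_m$ be the set of strings of complexity at most $m$, $\Omega_m=|L_m|$, with binary expansion $\Omega_m=2^{s_1}+\dots+2^{s_t}$, $s_1>\dots>s_t$. For an algorithm $q$ enumerating $L_m$, split the enumeration order into consecutive groups: the first $2^{s_1}$ enumerated elements, the next $2^{s_2}$, etc.; $S^q_{m,s}$ denotes the group of size $2^s$ (defined only when $s$ is one of the $s_i$). *)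

theory Defs
  imports Complex_Main "HOL-Library.Nat_Bijection"
begin

datatype recf = Z | Sc | Proj nat | Comp recf "recf list" | Prim recf recf | Mn recf

inductive eval :: "recf \<Rightarrow> nat list \<Rightarrow> nat \<Rightarrow> bool" where
  ev_Z: "eval Z xs 0"
| ev_Sc: "eval Sc (x # xs) (Suc x)"
| ev_Proj: "i < length xs \<Longrightarrow> eval (Proj i) xs (xs ! i)"
| ev_Comp: "length ys = length gs \<Longrightarrow> (\<forall>i<length gs. eval (gs ! i) xs (ys ! i))
             \<Longrightarrow> eval f ys z \<Longrightarrow> eval (Comp f gs) xs z"
| ev_Prim0: "eval f xs y \<Longrightarrow> eval (Prim f g) (0 # xs) y"
| ev_PrimS: "eval (Prim f g) (n # xs) y \<Longrightarrow> eval g (y # n # xs) z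
             \<Longrightarrow> eval (Prim f g) (Suc n # xs) z"
| ev_Mn: "eval f (n # xs) 0 \<Longrightarrow> (\<forall>i<n. \<exists>y. eval f (i # xs) y \<and> 0 < y)
             \<Longrightarrow> eval (Mn f) xs n"

definition peval :: "recf \<Rightarrow> nat list \<Rightarrow> nat option" where
  "peval f xs = (if \<exists>y. eval f xs y then Some (THE y. eval f xs y) else None)"

primrec recf_code :: "recf \<Rightarrow> nat" where
  "recf_code Z = prod_encode (0, 0)"
| "recf_code Sc = prod_encode (1, 0)"
| "recf_code (Proj n) = prod_encode (2, n)"
| "recf_code (Comp f gs) = prod_encode (3, prod_encode (recf_code f, list_encode (map recf_code gs)))"
| "recf_code (Prim f g) = prod_encode (4, prod_encode (recf_code f, recf_code g))"
| "recf_code (Mn f) = prod_encode (5, recf_code f)"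

text \<open>Bijective numbering of binary strings by natural numbers.\<close>
primrec str_nat :: "bool list \<Rightarrow> nat" where
  "str_nat [] = 0"
| "str_nat (b # w) = (if b then 2 else 1) + 2 * str_nat w"

definition nat_str :: "nat \<Rightarrow> bool list" where
  "nat_str = inv str_nat"

type_synonym decompressor = "bool list \<Rightarrow> bool list \<Rightarrow> bool list option"

definition computable2 :: "decompressor \<Rightarrow> bool" where
  "computable2 D \<longleftrightarrow> (\<exists>f. \<forall>p z. peval f [str_nat p, str_nat z] = map_option str_nat (D p z))"

definition universal :: "decompressor \<Rightarrow> bool" where
  "universal D \<longleftrightarrow> computable2 D \<and>
     (\<forall>D'. computable2 D' \<longrightarrow> (\<exists>c. \<forall>p. \<exists>p'. length p' \<le> length p + c \<and> (\<forall>z. D p' z = D' p z)))"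

definition KC :: "decompressor \<Rightarrow> bool list \<Rightarrow> bool list \<Rightarrow> nat" where
  "KC D y z = (LEAST n. \<exists>p. length p = n \<and> D p z = Some y)"

definition C :: "decompressor \<Rightarrow> bool list \<Rightarrow> nat" where
  "C D y = KC D y []"

definition CT :: "decompressor \<Rightarrow> bool list \<Rightarrow> bool list \<Rightarrow> nat" where
  "CT D y x = (LEAST n. \<exists>p. length p = n \<and> (\<forall>z. D p z \<noteq> None) \<and> D p x = Some y)"

definition set_code :: "bool list set \<Rightarrow> bool list" where
  "set_code A = nat_str (\<Sum>x\<in>A. 2 ^ str_nat x)"

definition C_set :: "decompressor \<Rightarrow> bool list set \<Rightarrow> nat" where
  "C_set D A = C D (set_code A)"

definition CT_set :: "decompressor \<Rightarrow> bool list set \<Rightarrow> bool list \<Rightarrow> nat" where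
  "CT_set D A x = CT D (set_code A) x"

definition C_prog :: "decompressor \<Rightarrow> recf \<Rightarrow> nat" where
  "C_prog D q = C D (nat_str (recf_code q))"

definition in_profile :: "decompressor \<Rightarrow> bool list \<Rightarrow> real \<Rightarrow> real \<Rightarrow> bool" where
  "in_profile D x a b \<longleftrightarrow>
     (\<exists>A. finite A \<and> x \<in> A \<and> real (C_set D A) \<le> a \<and> log 2 (real (card A)) \<le> b)"

definition in_strong_profile :: "decompressor \<Rightarrow> real \<Rightarrow> bool list \<Rightarrow> real \<Rightarrow> real \<Rightarrow> bool" where
  "in_strong_profile D eps x a b \<longleftrightarrow>
     (\<exists>A. finite A \<and> x \<in> A \<and> real (CT_set D A x) \<le> eps \<and>
          real (C_set D A) \<le> a \<and> log 2 (real (card A)) \<le> b)"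

definition profile :: "decompressor \<Rightarrow> bool list \<Rightarrow> (nat \<times> nat) set" where
  "profile D x = {(a, b). in_profile D x (real a) (real b)}"

definition strong_profile :: "decompressor \<Rightarrow> real \<Rightarrow> bool list \<Rightarrow> (nat \<times> nat) set" where
  "strong_profile D eps x = {(a, b). in_strong_profile D eps x (real a) (real b)}"

definition normal :: "decompressor \<Rightarrow> real \<Rightarrow> real \<Rightarrow> bool list \<Rightarrow> bool" where
  "normal D eps delta x \<longleftrightarrow>
     (\<forall>a b. (a, b) \<in> profile D x \<longrightarrow> in_strong_profile D eps x (real a + delta) (real b + delta))"

definition in_nbhd :: "real \<Rightarrow> (nat \<times> nat) set \<Rightarrow> nat \<times> nat \<Rightarrow> bool" where
  "in_nbhd e S p \<longleftrightarrow> (\<exists>q\<in>S. \<bar>real (fst p) - real (fst q)\<bar> \<le> e \<and> \<bar>real (snd p) - real (snd q)\<bar> \<le> e)"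

definition close :: "real \<Rightarrow> (nat \<times> nat) set \<Rightarrow> (nat \<times> nat) set \<Rightarrow> bool" where
  "close e S T \<longleftrightarrow> (\<forall>p\<in>S. in_nbhd e T p) \<and> (\<forall>p\<in>T. in_nbhd e S p)"

definition G :: "nat \<Rightarrow> (nat \<times> nat) set" where
  "G k = {(a, b). a + b \<ge> 4 * k \<or> (a \<ge> k \<and> a + b \<ge> 3 * k)}"

definition L :: "decompressor \<Rightarrow> nat \<Rightarrow> bool list set" where
  "L D m = {y. C D y \<le> m}"

definition enum_elt :: "recf \<Rightarrow> nat \<Rightarrow> bool list" where
  "enum_elt q i = nat_str (the (peval q [i]))"

definition enumerates :: "recf \<Rightarrow> bool list set \<Rightarrow> bool" where
  "enumerates q A \<longleftrightarrow> finite A \<and> (\<forall>i. peval q [i] \<noteq> None \<longleftrightarrow> i < card A) \<and>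
     bij_betw (enum_elt q) {..<card A} A"

text \<open>S^q_{m,s} is defined iff bit s of Omega_m is 1.\<close>
definition S_defined :: "decompressor \<Rightarrow> nat \<Rightarrow> nat \<Rightarrow> bool" where
  "S_defined D m s \<longleftrightarrow> odd (card (L D m) div 2 ^ s)"

text \<open>The group of size 2^s: it starts after the groups of sizes 2^{s_i} with s_i > s.\<close>
definition S :: "decompressor \<Rightarrow> recf \<Rightarrow> nat \<Rightarrow> nat \<Rightarrow> bool list set" where
  "S D q m s = (let st = card (L D m) div 2 ^ (Suc s) * 2 ^ (Suc s)
                in enum_elt q ` {st..<st + 2 ^ s})"

end

theory Submission
  imports Defs
begin

text \<open>
  For the string, call \<open>n\<close> bad if it lies in a set \<open>A\<close> with \<open>C(A) < k\<close> and
  \<open>C(A) + log |A| < 4 k - O(log k)\<close>. Few strings are bad, so some block of \<open>2 ^ (2 k)\<close>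
  consecutive strings of length \<open>4 k\<close> is mostly free of them. Such a block can be computed from the
  number of halting programs shorter than \<open>k\<close>, so it has complexity \<open>k + O(log k)\<close>; it cannot be
  simpler, since it would then be bad itself. A good string \<open>x\<close> of the block with
  \<open>C(x) \<ge> 3 k - O(log k)\<close> has the required profile, and its dyadic blocks, all computable from \<open>x\<close>
  by short total programs, realise it; this gives normality and item 2.

  Item 3 holds for every string with this profile. Let \<open>p\<close> be a short total program with
  \<open>p(x) = S\<close>, where \<open>S\<close> is a universal model. The sets \<open>{y \<in> S'. p(y) = S'}\<close> are disjoint for
  different \<open>S'\<close>, and the one for \<open>S\<close> has size about \<open>2 ^ (2 k)\<close> because \<open>S\<close> is sufficient.
  So there are about \<open>2 ^ (2 k)\<close> sets of this size, and their least elements, one of which lies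
  in \<open>S\<close>, have complexity about \<open>2 k\<close>, below the complexity bound \<open>m\<close> of the enumeration. Waiting
  until \<open>q\<close> has listed all of these elements, one is past the beginning of the group \<open>S\<close>, hence
  knows \<open>\<Omega>\<^sub>m\<close> up to \<open>log |S| + 1\<close> bits. As \<open>\<Omega>\<^sub>m\<close> and \<open>q\<close> yield a string of complexity
  above \<open>m\<close>, this is too little information unless \<open>p\<close> or \<open>q\<close> has length of order \<open>k\<close>.
\<close>

section \<open>Recursive functions and recursively enumerable predicates\<close>

text \<open>All logarithmic terms are multiples of \<open>r\<close>, the number of binary digits of
  \<open>k\<close>. Auxiliary parameters are tuples of numbers of order \<open>k\<close>, so they
  have O(\<open>r\<close>) bits and may be coded wastefully, at twice their length. Only the main
  part of a description, such as a rank in an enumeration, must be coded without loss.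

  Badness can only be confirmed, never refuted, by search; so a search alone cannot certify a block.
  The number of halting programs that removes this obstacle has \<open>k\<close> bits, which is just
  the complexity the block should have. In the union bound over models all program lengths below
  \<open>k\<close> contribute about equally, and the logarithmic slack in \<open>bad\<close> pays
  for the resulting factor \<open>k\<close>.

  In item 3 totality of \<open>p\<close> cannot be tested. The arguments use its finite table on the
  strings of length \<open>4 * k\<close>, which a search finds whenever it exists. The factor 2 in
  the final bound arises because \<open>eps\<close> enters as the length of \<open>p\<close> and
  again as the deficiency of \<open>S\<close>, and because \<open>q\<close> is described twice: to
  find the waiting time and to run the enumeration to its end.\<close>

inductive_cases eval_ZE: "eval Z xs y"
inductive_cases eval_ScE: "eval Sc xs y"
inductive_cases eval_ProjE: "eval (Proj i) xs y"
inductive_cases eval_CompE: "eval (Comp f gs) xs y"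
inductive_cases eval_Prim0E: "eval (Prim f g) (0 # xs) y"
inductive_cases eval_PrimSE: "eval (Prim f g) (Suc n # xs) y"
inductive_cases eval_MnE: "eval (Mn f) xs y"

lemma eval_deterministic: "eval f xs y \<Longrightarrow> eval f xs z \<Longrightarrow> y = z"
proof (induction arbitrary: z rule: eval.induct)
  case (ev_Comp ys gs xs f y)
  from ev_Comp.prems obtain ys' where ys': "length ys' = length gs"
    "\<forall>i<length gs. eval (gs ! i) xs (ys' ! i)" "eval f ys' z"
    by (rule eval_CompE) (rule that)
  have "ys = ys'"
    using ev_Comp.hyps ev_Comp.IH ys' by (intro nth_equalityI) auto
  then show ?case using ev_Comp.IH ys'(3) by blast
next
  case (ev_Mn f n xs)
  from ev_Mn.prems have z: "eval f (z # xs) 0" "\<forall>i<z. \<exists>y. eval f (i # xs) y \<and> 0 < y"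
    by (blast elim: eval_MnE)+
  show ?case
  proof (rule linorder_cases[of n z])
    assume "n < z"
    then obtain y where "eval f (n # xs) y" "0 < y" using z by blast
    then show ?thesis using ev_Mn.IH(1) by fastforce
  next
    assume "z < n"
    then obtain y where "0 < y" "\<forall>w. eval f (z # xs) w \<longrightarrow> y = w" using ev_Mn.IH(2) by blast
    then show ?thesis using z(1) by blast
  qed
qed (blast elim: eval_ZE eval_ScE eval_ProjE eval_Prim0E eval_PrimSE)+

lemma peval_eq_Some_iff: "peval f xs = Some y \<longleftrightarrow> eval f xs y"
  unfolding peval_def using eval_deterministic theI[of "eval f xs"] by (auto intro!: the_equality)

lemma peval_eq_None_iff: "peval f xs = None \<longleftrightarrow> (\<forall>y. \<not> eval f xs y)"
  unfolding peval_def by auto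

lemma eval_Comp1: "eval g xs a \<Longrightarrow> eval f [a] z \<Longrightarrow> eval (Comp f [g]) xs z"
  by (rule ev_Comp[of "[a]"]) auto

lemma eval_Comp2: "eval g xs a \<Longrightarrow> eval h xs b \<Longrightarrow> eval f [a, b] z \<Longrightarrow> eval (Comp f [g, h]) xs z"
  by (rule ev_Comp[of "[a, b]"]) (auto simp: less_Suc_eq)

lemma eval_Proj0: "eval (Proj 0) (x # xs) x"
  and eval_Proj1: "eval (Proj 1) (y # x # xs) x"
  and eval_Proj2: "eval (Proj 2) (z # y # x # xs) x"
  using ev_Proj[of 0 "x # xs"] ev_Proj[of 1 "y # x # xs"] ev_Proj[of 2 "z # y # x # xs"] by auto

section \<open>Total recursive functions of one and two arguments\<close>

definition trec :: "(nat \<Rightarrow> nat) \<Rightarrow> bool" where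
  "trec f \<longleftrightarrow> (\<exists>r. \<forall>x. eval r [x] (f x))"

definition trec2 :: "(nat \<Rightarrow> nat \<Rightarrow> nat) \<Rightarrow> bool" where
  "trec2 f \<longleftrightarrow> (\<exists>r. \<forall>x y. eval r [x, y] (f x y))"

lemma trec_comp: "trec f \<Longrightarrow> trec g \<Longrightarrow> trec (\<lambda>x. f (g x))"
  unfolding trec_def by (meson eval_Comp1)

lemma trec_comp2: "trec2 h \<Longrightarrow> trec f \<Longrightarrow> trec g \<Longrightarrow> trec (\<lambda>x. h (f x) (g x))"
  unfolding trec_def trec2_def by (meson eval_Comp2)

lemma trec2_comp: "trec f \<Longrightarrow> trec2 g \<Longrightarrow> trec2 (\<lambda>x y. f (g x y))"
  unfolding trec_def trec2_def by (meson eval_Comp1)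

lemma trec2_comp2: "trec2 h \<Longrightarrow> trec2 f \<Longrightarrow> trec2 g \<Longrightarrow> trec2 (\<lambda>x y. h (f x y) (g x y))"
  unfolding trec2_def by (meson eval_Comp2)

lemma trec_id: "trec (\<lambda>x. x)"
  unfolding trec_def using eval_Proj0 by blast

lemma trec2_fst: "trec2 (\<lambda>x y. x)" and trec2_snd: "trec2 (\<lambda>x y. y)"
  unfolding trec2_def using eval_Proj0 eval_Proj1 by blast+

lemma trec_Suc0: "trec Suc"
  unfolding trec_def using ev_Sc by blast

lemma trec_const: "trec (\<lambda>x. c)"
proof (induction c)
  case 0
  show ?case unfolding trec_def using ev_Z by blast
next
  case (Suc c)
  show ?case by (rule trec_comp[OF trec_Suc0 Suc])
qed

lemma trec2_prim:
  assumes "trec a" and "\<exists>r. \<forall>y n x. eval r [y, n, x] (h y n x)"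
  shows "trec2 (\<lambda>n x. rec_nat (a x) (\<lambda>n y. h y n x) n)"
proof -
  from assms obtain ra r where ra: "\<And>x. eval ra [x] (a x)"
    and r: "\<And>y n x. eval r [y, n, x] (h y n x)"
    unfolding trec_def by blast
  have "eval (Prim ra r) [n, x] (rec_nat (a x) (\<lambda>n y. h y n x) n)" for n x
  proof (induction n)
    case 0
    show ?case using ra by (auto intro: ev_Prim0)
  next
    case (Suc n)
    from ev_PrimS[OF Suc r] show ?case by simp
  qed
  then show ?thesis unfolding trec2_def by blast
qed

lemma trec_prim:
  assumes "trec2 h"
  shows "trec (rec_nat a (\<lambda>n y. h y n))"
proof -
  from assms obtain r where r: "\<And>y n. eval r [y, n] (h y n)"
    unfolding trec2_def by blast
  have "\<exists>ra. \<forall>xs. eval ra xs a"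
    by (induction a) (meson ev_Z ev_Sc eval_Comp1)+
  then obtain ra where ra: "\<And>xs. eval ra xs a" by blast
  have "eval (Prim ra r) [n] (rec_nat a (\<lambda>n y. h y n) n)" for n
  proof (induction n)
    case 0
    show ?case using ra by (auto intro: ev_Prim0)
  next
    case (Suc n)
    from ev_PrimS[OF Suc r] show ?case by simp
  qed
  then show ?thesis unfolding trec_def by blast
qed

lemma trec2_add: "trec2 (+)"
proof -
  have *: "\<exists>r. \<forall>y n x. eval r [y, n, x] (Suc y)"
    by (meson eval_Comp1 ev_Sc eval_Proj0)
  have "rec_nat x (\<lambda>n y. Suc y) n = n + x" for n x :: nat by (induction n) auto
  with trec2_prim[OF trec_id *] show ?thesis by simp
qed

lemma trec2_mult: "trec2 (*)"
proof -
  have *: "\<exists>r. \<forall>y n x. eval r [y, n, x] (y + x)"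
    using trec2_add unfolding trec2_def by (meson eval_Comp2 eval_Proj0 eval_Proj2)
  have "rec_nat 0 (\<lambda>n y. y + x) n = n * x" for n x :: nat by (induction n) auto
  with trec2_prim[OF trec_const[of 0] *] show ?thesis by simp
qed

lemma trec_pred: "trec (\<lambda>x. x - 1)"
proof -
  have "rec_nat 0 (\<lambda>n y. n) n = n - 1" for n :: nat by (cases n) auto
  then have "rec_nat 0 (\<lambda>n y. n) = (\<lambda>n. n - 1)" by (rule ext)
  with trec_prim[OF trec2_snd, of 0] show ?thesis by (simp only:)
qed

lemma trec2_diff: "trec2 (-)"
proof -
  have *: "\<exists>r. \<forall>y n x. eval r [y, n, x] (y - 1)"
    using trec_pred unfolding trec_def by (meson eval_Comp1 eval_Proj0)
  have "rec_nat x (\<lambda>n y. y - 1) n = x - n" for n x :: nat by (induction n) auto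
  with trec2_prim[OF trec_id *] have "trec2 (\<lambda>n x. x - n)" by simp
  from trec2_comp2[OF this trec2_snd trec2_fst] show ?thesis by simp
qed

lemma trec_triangle: "trec triangle"
proof -
  have "rec_nat 0 (\<lambda>n y. y + Suc n) n = triangle n" for n :: nat by (induction n) auto
  then have "rec_nat 0 (\<lambda>n y. y + Suc n) = triangle" by (rule ext)
  with trec_prim[OF trec2_comp2[OF trec2_add trec2_fst trec2_comp[OF trec_Suc0 trec2_snd]], of 0]
  show ?thesis by (simp only:)
qed

lemma trec2_prod_encode: "trec2 (\<lambda>a b. prod_encode (a, b))"
  unfolding prod_encode_def prod.case
  by (intro trec2_comp2[OF trec2_add] trec2_comp[OF trec_triangle] trec2_add trec2_fst)

abbreviation pair :: "nat \<Rightarrow> nat \<Rightarrow> nat" where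
  "pair a b \<equiv> prod_encode (a, b)"

definition pfst :: "nat \<Rightarrow> nat" where "pfst n = fst (prod_decode n)"
definition psnd :: "nat \<Rightarrow> nat" where "psnd n = snd (prod_decode n)"

lemma pfst_pair [simp]: "pfst (pair a b) = a" and psnd_pair [simp]: "psnd (pair a b) = b"
  by (auto simp: pfst_def psnd_def)

lemma pair_pfst_psnd [simp]: "pair (pfst n) (psnd n) = n"
  by (simp add: pfst_def psnd_def)

lemma pair_0_0: "pair 0 0 = 0"
  by (simp add: prod_encode_def)

lemma trec_Mn:
  assumes "trec2 g" and ex: "\<And>x. \<exists>n. g n x = 0"
  shows "trec (\<lambda>x. LEAST n. g n x = 0)"
proof -
  from assms obtain r where r: "\<And>n x. eval r [n, x] (g n x)"
    unfolding trec2_def by blast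
  have "eval (Mn r) [x] (LEAST n. g n x = 0)" for x
  proof (rule ev_Mn)
    show "eval r [LEAST n. g n x = 0, x] 0"
      using r[of "LEAST n. g n x = 0" x] LeastI_ex[OF ex[of x]] by simp
    show "\<forall>i<LEAST n. g n x = 0. \<exists>y. eval r [i, x] y \<and> 0 < y"
    proof (intro allI impI)
      fix i assume "i < (LEAST n. g n x = 0)"
      then have "g i x \<noteq> 0" by (rule not_less_Least)
      then show "\<exists>y. eval r [i, x] y \<and> 0 < y" using r[of i x] by (intro exI[of _ "g i x"]) simp
    qed
  qed
  then show ?thesis unfolding trec_def by blast
qed

text \<open>Inverts the Cantor pairing: the diagonal of \<open>x\<close> is the least
  \<open>n\<close> with \<open>x < triangle (Suc n)\<close>, and the distance of \<open>x\<close>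
  from \<open>triangle n\<close> is the first component.\<close>

lemma trec_pfst0: "trec pfst" and trec_psnd0: "trec psnd"
proof -
  define s where "s x = (LEAST n. Suc x - triangle (Suc n) = 0)" for x
  have tri: "n \<le> triangle n" for n by (induction n) auto
  have mono: "m \<le> n \<Longrightarrow> triangle m \<le> triangle n" for m n by (induction n) (auto simp: le_Suc_eq)
  have "trec s" unfolding s_def
  proof (rule trec_Mn)
    show "trec2 (\<lambda>n x. Suc x - triangle (Suc n))"
      by (intro trec2_comp2[OF trec2_diff] trec2_comp[OF trec_Suc0] trec2_comp[OF trec_triangle]
          trec2_fst trec2_snd)
    show "\<exists>n. Suc x - triangle (Suc n) = 0" for x using tri[of "Suc x"] by (intro exI[of _ x]) simp
  qed
  have sp: "s (pair a b) = a + b" for a b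
    unfolding s_def
  proof (rule Least_equality)
    show "Suc (pair a b) - triangle (Suc (a + b)) = 0" by (simp add: prod_encode_def)
    fix y assume y: "Suc (pair a b) - triangle (Suc y) = 0"
    show "a + b \<le> y"
    proof (rule ccontr)
      assume "\<not> ?thesis"
      then have "triangle (Suc y) \<le> triangle (a + b)" by (intro mono) simp
      with y show False by (simp add: prod_encode_def)
    qed
  qed
  have "trec (\<lambda>x. x - triangle (s x))"
    by (intro trec_comp2[OF trec2_diff] trec_id trec_comp[OF trec_triangle] \<open>trec s\<close>)
  moreover have "(\<lambda>x. x - triangle (s x)) = pfst"
  proof
    fix x show "x - triangle (s x) = pfst x"
      using sp[of "pfst x" "psnd x"] pair_pfst_psnd[of x] unfolding prod_encode_def prod.case
      by simp
  qed
  ultimately show f: "trec pfst" by simp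
  have "trec (\<lambda>x. s x - pfst x)"
    by (intro trec_comp2[OF trec2_diff] f \<open>trec s\<close>)
  moreover have "(\<lambda>x. s x - pfst x) = psnd"
  proof
    fix x show "s x - pfst x = psnd x" using sp[of "pfst x" "psnd x"] by simp
  qed
  ultimately show "trec psnd" by simp
qed

section \<open>Decidable predicates and bounded search\<close>

definition dec :: "(nat \<Rightarrow> bool) \<Rightarrow> bool" where
  "dec P \<longleftrightarrow> trec (\<lambda>x. of_bool (P x))"

named_theorems rec_intros

lemmas [rec_intros] = trec_id trec_const
lemmas [rec_intros] = trec_comp[OF trec_Suc0] trec_comp[OF trec_pfst0] trec_comp[OF trec_psnd0]
  trec_comp2[OF trec2_add] trec_comp2[OF trec2_mult] trec_comp2[OF trec2_diff]
  trec_comp2[OF trec2_prod_encode]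

lemma trec2_unpair: "trec (\<lambda>z. f (pfst z) (psnd z)) \<Longrightarrow> trec2 f"
  using trec2_comp[OF _ trec2_prod_encode, of "\<lambda>z. f (pfst z) (psnd z)"] by simp

text \<open>The premises stay unary: a function of several variables is presented as a function of
  one nested pair. A single set of introduction rules can then follow the shape of a term.\<close>

lemma trec_rec_nat [rec_intros]:
  assumes "trec a" "trec (\<lambda>z. h (pfst z) (pfst (psnd z)) (psnd (psnd z)))" "trec b"
  shows "trec (\<lambda>x. rec_nat (a x) (\<lambda>n y. h n y x) (b x))"
proof -
  from assms(2) obtain r where r: "\<And>z. eval r [z] (h (pfst z) (pfst (psnd z)) (psnd (psnd z)))"
    unfolding trec_def by blast
  from trec2_prod_encode obtain q where q: "\<And>x y. eval q [x, y] (pair x y)"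
    unfolding trec2_def by blast
  have "eval (Comp r [Comp q [Proj 1, Comp q [Proj 0, Proj 2]]]) [y, n, x] (h n y x)" for y n x
    by (rule eval_Comp1[OF eval_Comp2[OF eval_Proj1 eval_Comp2[OF eval_Proj0 eval_Proj2 q] q]])
       (use r[of "pair n (pair y x)"] in simp)
  then have "trec2 (\<lambda>n x. rec_nat (a x) (\<lambda>n y. h n y x) n)"
    by (intro trec2_prim assms(1)) blast
  from trec_comp2[OF this assms(3) trec_id] show ?thesis .
qed

lemma trec_of_bool [rec_intros]: "dec P \<Longrightarrow> trec (\<lambda>x. of_bool (P x))"
  by (simp add: dec_def)

lemma dec_comp: "dec P \<Longrightarrow> trec f \<Longrightarrow> dec (\<lambda>x. P (f x))"
  unfolding dec_def by (rule trec_comp)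

lemma dec_not [rec_intros]:
  assumes "dec P" shows "dec (\<lambda>x. \<not> P x)"
proof -
  have "trec (\<lambda>x. 1 - of_bool (P x))" using assms by (intro rec_intros)
  moreover have "1 - of_bool (P x) = (of_bool (\<not> P x) :: nat)" for x by simp
  ultimately show ?thesis unfolding dec_def by simp
qed

lemma dec_conj [rec_intros]:
  assumes "dec P" "dec Q" shows "dec (\<lambda>x. P x \<and> Q x)"
proof -
  have "trec (\<lambda>x. of_bool (P x) * of_bool (Q x))" using assms by (intro rec_intros)
  then show ?thesis unfolding dec_def by (simp add: of_bool_conj)
qed

lemma dec_disj [rec_intros]:
  assumes "dec P" "dec Q" shows "dec (\<lambda>x. P x \<or> Q x)"
proof -
  have "dec (\<lambda>x. \<not> (\<not> P x \<and> \<not> Q x))" using assms by (intro dec_not dec_conj)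
  then show ?thesis by simp
qed

lemma dec_less [rec_intros]: "trec f \<Longrightarrow> trec g \<Longrightarrow> dec (\<lambda>x. f x < g x)"
proof -
  assume "trec f" "trec g"
  then have "trec (\<lambda>x. 1 - (1 - (g x - f x)))" by (intro rec_intros)
  moreover have "1 - (1 - (g x - f x)) = of_bool (f x < g x)" for x by auto
  ultimately show ?thesis unfolding dec_def by simp
qed

lemma dec_le [rec_intros]:
  assumes "trec f" "trec g" shows "dec (\<lambda>x. f x \<le> g x)"
proof -
  have "dec (\<lambda>x. \<not> (g x < f x))" using assms by (intro dec_not dec_less)
  then show ?thesis by (simp add: not_less)
qed

lemma dec_eq [rec_intros]:
  assumes "trec f" "trec g" shows "dec (\<lambda>x. f x = g x)"
proof -
  have "dec (\<lambda>x. f x \<le> g x \<and> g x \<le> f x)" using assms by (intro dec_conj dec_le)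
  then show ?thesis by (simp add: order_eq_iff)
qed

lemma trec_sum [rec_intros]:
  assumes "trec (\<lambda>z. f (pfst z) (psnd z))" "trec b"
  shows "trec (\<lambda>x. \<Sum>i<b x. f i x)"
proof -
  have "trec (\<lambda>z. f (pfst z) (psnd (psnd z)))"
    by (rule trec_comp2[OF trec2_unpair[OF assms(1)]]) (intro rec_intros)+
  then have "trec (\<lambda>x. rec_nat 0 (\<lambda>n y. y + f n x) (b x))"
    by (intro rec_intros assms(2))
  moreover have "rec_nat 0 (\<lambda>n y. y + f n x) m = (\<Sum>i<m. f i x)" for m x
    by (induction m) auto
  ultimately show ?thesis by simp
qed

lemma dec_ball [rec_intros]:
  assumes "dec (\<lambda>z. P (pfst z) (psnd z))" "trec b"
  shows "dec (\<lambda>x. \<forall>i<b x. P i x)"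
proof -
  have "dec (\<lambda>x. (\<Sum>i<b x. of_bool (\<not> P i x)) = (0::nat))"
    using assms by (intro rec_intros)
  moreover have "(\<Sum>i<b x. of_bool (\<not> P i x)) = (0::nat) \<longleftrightarrow> (\<forall>i<b x. P i x)" for x
    by (auto simp: sum_eq_0_iff)
  ultimately show ?thesis by simp
qed

lemma dec_bex [rec_intros]:
  assumes "dec (\<lambda>z. P (pfst z) (psnd z))" "trec b"
  shows "dec (\<lambda>x. \<exists>i<b x. P i x)"
proof -
  have "dec (\<lambda>x. \<not> (\<forall>i<b x. \<not> P i x))"
    using assms by (intro rec_intros)
  then show ?thesis by simp
qed

lemma trec_card [rec_intros]:
  assumes "dec (\<lambda>z. P (pfst z) (psnd z))" "trec b"
  shows "trec (\<lambda>x. card {i. i < b x \<and> P i x})"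
proof -
  have "trec (\<lambda>x. \<Sum>i<b x. of_bool (P i x))"
    using assms by (intro rec_intros)
  moreover have "(\<Sum>i<b x. of_bool (P i x)) = card {i. i < b x \<and> P i x}" for x
    by (simp add: of_bool_def sum.If_cases Int_def)
  ultimately show ?thesis by simp
qed

lemma trec_Least:
  assumes "dec (\<lambda>z. P (pfst z) (psnd z))" "\<And>x. \<exists>n. P n x"
  shows "trec (\<lambda>x. LEAST n. P n x)"
proof -
  have "trec (\<lambda>x. LEAST n. (1::nat) - of_bool (P n x) = 0)"
  proof (rule trec_Mn)
    show "trec2 (\<lambda>n x. 1 - of_bool (P n x))"
      by (rule trec2_unpair) (intro rec_intros assms(1))
    show "\<exists>n. (1::nat) - of_bool (P n x) = 0" for x
      using assms(2)[of x] by auto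
  qed
  moreover have "(1::nat) - of_bool b = 0 \<longleftrightarrow> b" for b by simp
  ultimately show ?thesis by simp
qed

lemma trec_power [rec_intros]:
  assumes "trec f" "trec g" shows "trec (\<lambda>x. f x ^ g x)"
proof -
  have "trec (\<lambda>x. rec_nat 1 (\<lambda>n y. y * f x) (g x))"
    by (intro rec_intros trec_comp[OF assms(1)] assms(2))
  moreover have "rec_nat 1 (\<lambda>n y. y * f x) m = f x ^ m" for x m by (induction m) auto
  ultimately show ?thesis by simp
qed

lemma trec_div [rec_intros]:
  assumes "trec f" "trec g" shows "trec (\<lambda>x. f x div g x)"
proof -
  have "trec (\<lambda>x. LEAST q. g x = 0 \<or> f x < g x * Suc q)"
  proof (rule trec_Least)
    show "dec (\<lambda>z. g (psnd z) = 0 \<or> f (psnd z) < g (psnd z) * Suc (pfst z))"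
      by (intro rec_intros trec_comp[OF assms(1)] trec_comp[OF assms(2)])
    show "\<exists>q. g x = 0 \<or> f x < g x * Suc q" for x
      by (intro exI[of _ "f x"]) (cases "g x", auto)
  qed
  moreover have "(LEAST q. g x = 0 \<or> f x < g x * Suc q) = f x div g x" for x
  proof (rule Least_equality)
    show "g x = 0 \<or> f x < g x * Suc (f x div g x)"
      using dividend_less_times_div[of "g x" "f x"] by auto
    fix q assume "g x = 0 \<or> f x < g x * Suc q"
    then show "f x div g x \<le> q"
    proof
      assume "f x < g x * Suc q"
      then show ?thesis using less_mult_imp_div_less[of "f x" "Suc q" "g x"] by (simp add: mult.commute)
    qed simp
  qed
  ultimately show ?thesis by simp
qed

lemma trec_mod [rec_intros]:
  assumes "trec f" "trec g" shows "trec (\<lambda>x. f x mod g x)"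
proof -
  have "trec (\<lambda>x. f x - g x * (f x div g x))" using assms by (intro rec_intros)
  then show ?thesis by (simp add: minus_mult_div_eq_mod)
qed

lemma dec_dvd [rec_intros]:
  assumes "trec f" "trec g" shows "dec (\<lambda>x. f x dvd g x)"
proof -
  have "dec (\<lambda>x. g x mod f x = 0)" using assms by (intro rec_intros)
  then show ?thesis by (simp add: dvd_eq_mod_eq_0)
qed

lemma dec_set_decode [rec_intros]:
  assumes "trec f" "trec g" shows "dec (\<lambda>x. f x \<in> set_decode (g x))"
  unfolding set_decode_def mem_Collect_eq using assms by (intro rec_intros)

lemma trec_funpow:
  assumes "trec h" "trec f" "trec g" shows "trec (\<lambda>x. (h ^^ g x) (f x))"
proof -
  have "trec (\<lambda>x. rec_nat (f x) (\<lambda>n y. h y) (g x))"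
    by (intro rec_intros assms trec_comp[OF assms(1)])
  moreover have "rec_nat a (\<lambda>n y. h y) m = (h ^^ m) a" for a m by (induction m) auto
  ultimately show ?thesis by simp
qed

section \<open>Semidecidable predicates as projections of decidable ones\<close>

definition semidec :: "(nat \<Rightarrow> bool) \<Rightarrow> bool" where
  "semidec P \<longleftrightarrow> (\<exists>Q. dec (\<lambda>z. Q (pfst z) (psnd z)) \<and> (\<forall>x. P x \<longleftrightarrow> (\<exists>w. Q w x)))"

lemma semidecE:
  assumes "semidec P"
  obtains Q where "dec (\<lambda>z. Q (pfst z) (psnd z))" "\<And>x. P x \<longleftrightarrow> (\<exists>w. Q w x)"
  using assms unfolding semidec_def by blast

lemma semidecI:
  "dec (\<lambda>z. Q (pfst z) (psnd z)) \<Longrightarrow> (\<And>x. P x \<longleftrightarrow> (\<exists>w. Q w x)) \<Longrightarrow> semidec P"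
  unfolding semidec_def by blast

lemma semidec_dec: "dec P \<Longrightarrow> semidec P"
  by (rule semidecI[of "\<lambda>w. P"]) (auto intro: dec_comp[OF _ trec_comp[OF trec_psnd0 trec_id]])

lemma dec_comp2:
  assumes "dec (\<lambda>z. Q (pfst z) (psnd z))" "trec f" "trec g"
  shows "dec (\<lambda>x. Q (f x) (g x))"
  using dec_comp[OF assms(1), of "\<lambda>x. pair (f x) (g x)"] assms(2,3) by (simp add: rec_intros)

named_theorems semidec_intros

lemma semidec_ex [semidec_intros]:
  assumes "semidec (\<lambda>z. P (pfst z) (psnd z))" shows "semidec (\<lambda>x. \<exists>i. P i x)"
proof -
  from assms obtain Q where Q: "dec (\<lambda>z. Q (pfst z) (psnd z))"
    "\<And>z. P (pfst z) (psnd z) \<longleftrightarrow> (\<exists>w. Q w z)"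
    by (rule semidecE) (rule that)
  have *: "P i x \<longleftrightarrow> (\<exists>w. Q w (pair i x))" for i x using Q(2)[of "pair i x"] by simp
  show ?thesis
  proof (rule semidecI[of "\<lambda>w x. Q (pfst w) (pair (psnd w) x)"])
    show "(\<exists>i. P i x) \<longleftrightarrow> (\<exists>w. Q (pfst w) (pair (psnd w) x))" for x
      unfolding * by (metis pfst_pair psnd_pair)
  qed (intro dec_comp2[OF Q(1)] rec_intros)
qed

lemma semidec_conj [semidec_intros]:
  assumes "semidec P" "semidec R" shows "semidec (\<lambda>x. P x \<and> R x)"
proof -
  from assms(1) obtain Q where Q: "dec (\<lambda>z. Q (pfst z) (psnd z))" "\<And>x. P x \<longleftrightarrow> (\<exists>w. Q w x)"
    by (rule semidecE) (rule that)
  from assms(2) obtain Q' where Q': "dec (\<lambda>z. Q' (pfst z) (psnd z))" "\<And>x. R x \<longleftrightarrow> (\<exists>w. Q' w x)"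
    by (rule semidecE) (rule that)
  show ?thesis
  proof (rule semidecI[of "\<lambda>w x. Q (pfst w) x \<and> Q' (psnd w) x"])
    show "P x \<and> R x \<longleftrightarrow> (\<exists>w. Q (pfst w) x \<and> Q' (psnd w) x)" for x
      unfolding Q(2) Q'(2) by (metis pfst_pair psnd_pair)
  qed (intro dec_comp2[OF Q(1)] dec_comp2[OF Q'(1)] rec_intros)
qed

lemma semidec_disj [semidec_intros]:
  assumes "semidec P" "semidec R" shows "semidec (\<lambda>x. P x \<or> R x)"
proof -
  from assms(1) obtain Q where Q: "dec (\<lambda>z. Q (pfst z) (psnd z))" "\<And>x. P x \<longleftrightarrow> (\<exists>w. Q w x)"
    by (rule semidecE) (rule that)
  from assms(2) obtain Q' where Q': "dec (\<lambda>z. Q' (pfst z) (psnd z))" "\<And>x. R x \<longleftrightarrow> (\<exists>w. Q' w x)"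
    by (rule semidecE) (rule that)
  show ?thesis
    by (rule semidecI[of "\<lambda>w x. Q w x \<or> Q' w x"])
       (auto simp: Q(2) Q'(2) intro!: dec_comp2[OF Q(1)] dec_comp2[OF Q'(1)] rec_intros)
qed

text \<open>The witness for a bounded conjunction is one number above all individual witnesses, here
  their sum plus one; no sequence of witnesses has to be coded.\<close>

lemma semidec_ball [semidec_intros]:
  assumes "semidec (\<lambda>z. P (pfst z) (psnd z))" "trec b" shows "semidec (\<lambda>x. \<forall>i<b x. P i x)"
proof -
  from assms(1) obtain Q where Q: "dec (\<lambda>z. Q (pfst z) (psnd z))"
    "\<And>z. P (pfst z) (psnd z) \<longleftrightarrow> (\<exists>w. Q w z)"
    by (rule semidecE) (rule that)
  have *: "P i x \<longleftrightarrow> (\<exists>w. Q w (pair i x))" for i x using Q(2)[of "pair i x"] by simp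
  show ?thesis
  proof (rule semidecI[of "\<lambda>w x. \<forall>i<b x. \<exists>v<w. Q v (pair i x)"])
    show "dec (\<lambda>z. \<forall>i<b (psnd z). \<exists>v<pfst z. Q v (pair i (psnd z)))"
      by (intro dec_ball dec_bex dec_comp2[OF Q(1)] rec_intros trec_comp[OF assms(2)])
    show "(\<forall>i<b x. P i x) \<longleftrightarrow> (\<exists>w. \<forall>i<b x. \<exists>v<w. Q v (pair i x))" for x
    proof
      assume "\<forall>i<b x. P i x"
      then obtain f where f: "\<And>i. i < b x \<Longrightarrow> Q (f i) (pair i x)" unfolding * by metis
      have "f i < Suc (\<Sum>i<b x. f i)" if "i < b x" for i
        using that member_le_sum[of i "{..<b x}" f] by (simp add: less_Suc_eq_le)
      with f show "\<exists>w. \<forall>i<b x. \<exists>v<w. Q v (pair i x)" by blast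
    qed (auto simp: *)
  qed
qed

text \<open>Replaces the witness by a stage: a witness below \<open>t\<close> exists. Monotonicity
  in \<open>t\<close> allows finitely many facts to be observed at one common stage.\<close>

lemma semidec_stages:
  assumes "semidec P"
  obtains Q where "dec (\<lambda>z. Q (pfst z) (psnd z))" "\<And>x. P x \<longleftrightarrow> (\<exists>t. Q t x)"
    "\<And>s t x. s \<le> t \<Longrightarrow> Q s x \<Longrightarrow> Q t x"
proof -
  from assms obtain Q where Q: "dec (\<lambda>z. Q (pfst z) (psnd z))" "\<And>x. P x \<longleftrightarrow> (\<exists>w. Q w x)"
    by (rule semidecE) (rule that)
  show thesis
  proof (rule that[of "\<lambda>t x. \<exists>w<t. Q w x"])
    show "dec (\<lambda>z. \<exists>w<pfst z. Q w (psnd z))" by (intro rec_intros dec_comp2[OF Q(1)])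
    show "P x \<longleftrightarrow> (\<exists>t. \<exists>w<t. Q w x)" for x using Q(2) lessI by blast
    show "\<exists>w<s. Q w x \<Longrightarrow> \<exists>w<t. Q w x" if "s \<le> t" for s t x using that by (meson less_le_trans)
  qed
qed

section \<open>A universal evaluation predicate\<close>

definition lhd :: "nat \<Rightarrow> nat" where "lhd c = pfst (c - 1)"
definition ltl :: "nat \<Rightarrow> nat" where "ltl c = psnd (c - 1)"
definition lcons :: "nat \<Rightarrow> nat \<Rightarrow> nat" where "lcons x c = Suc (pair x c)"
definition lnth :: "nat \<Rightarrow> nat \<Rightarrow> nat" where "lnth c i = lhd ((ltl ^^ i) c)"
text \<open>The code of \<open>[]\<close> is 0, and \<open>ltl 0 = 0\<close> by truncated
  subtraction and \<open>pair 0 0 = 0\<close>. Iterated tails therefore stay at 0, and the first 0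
  marks the length.\<close>

definition llen :: "nat \<Rightarrow> nat" where "llen c = (LEAST i. (ltl ^^ i) c = 0)"

lemma lcons_list_encode: "lcons x (list_encode xs) = list_encode (x # xs)"
  by (simp add: lcons_def)

lemma funpow_ltl: "(ltl ^^ i) (list_encode xs) = list_encode (drop i xs)"
proof (induction i)
  case (Suc i)
  have "ltl (list_encode ys) = list_encode (drop 1 ys)" for ys
    using pfst_pair[of 0 0] psnd_pair[of 0 0] by (cases ys) (auto simp: ltl_def pair_0_0)
  with Suc show ?case by simp
qed simp

lemma list_encode_eq_0_iff: "list_encode xs = 0 \<longleftrightarrow> xs = []"
  by (cases xs) auto

lemma lnth_list_encode: "i < length xs \<Longrightarrow> lnth (list_encode xs) i = xs ! i"
  unfolding lnth_def funpow_ltl by (simp add: lhd_def flip: Cons_nth_drop_Suc)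

lemma llen_list_encode: "llen (list_encode xs) = length xs"
  unfolding llen_def funpow_ltl list_encode_eq_0_iff
  by (rule Least_equality) auto

lemma trec_lhd [rec_intros]: "trec f \<Longrightarrow> trec (\<lambda>x. lhd (f x))"
  and trec_ltl [rec_intros]: "trec f \<Longrightarrow> trec (\<lambda>x. ltl (f x))"
  and trec_lcons [rec_intros]: "trec f \<Longrightarrow> trec g \<Longrightarrow> trec (\<lambda>x. lcons (f x) (g x))"
  unfolding lhd_def ltl_def lcons_def by (intro rec_intros; assumption)+

lemma trec_lnth [rec_intros]: "trec f \<Longrightarrow> trec g \<Longrightarrow> trec (\<lambda>x. lnth (f x) (g x))"
  unfolding lnth_def by (intro rec_intros trec_funpow)

lemma trec_llen [rec_intros]: "trec f \<Longrightarrow> trec (\<lambda>x. llen (f x))"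
proof -
  have "trec llen" unfolding llen_def
  proof (rule trec_Least)
    show "dec (\<lambda>z. (ltl ^^ pfst z) (psnd z) = 0)" by (intro rec_intros trec_funpow)
    show "\<exists>i. (ltl ^^ i) c = 0" for c
      using funpow_ltl[of "length (list_decode c)" "list_decode c"] by auto
  qed
  then show "trec f \<Longrightarrow> trec (\<lambda>x. llen (f x))" by (rule trec_comp)
qed

text \<open>\<open>claim e a y\<close> asserts that the function coded by \<open>e\<close> maps the argument list coded by \<open>a\<close>
  to \<open>y\<close>; \<open>justified I e a y\<close> says that it follows by one rule of \<^const>\<open>eval\<close> from claims in \<open>I\<close>.\<close>

definition claim :: "nat \<Rightarrow> nat \<Rightarrow> nat \<Rightarrow> nat" where
  "claim e a y = pair e (pair a y)"

definition justified :: "(nat \<Rightarrow> bool) \<Rightarrow> nat \<Rightarrow> nat \<Rightarrow> nat \<Rightarrow> bool" where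
  "justified I e a y \<longleftrightarrow>
    (pfst e = 0 \<and> y = 0) \<or>
    (pfst e = 1 \<and> (\<exists>x b. a = lcons x b \<and> y = Suc x)) \<or>
    (pfst e = 2 \<and> psnd e < llen a \<and> y = lnth a (psnd e)) \<or>
    (pfst e = 3 \<and> (\<exists>b. llen b = llen (psnd (psnd e)) \<and> I (claim (pfst (psnd e)) b y) \<and>
      (\<forall>i<llen b. I (claim (lnth (psnd (psnd e)) i) a (lnth b i))))) \<or>
    (pfst e = 4 \<and> (\<exists>b. a = lcons 0 b \<and> I (claim (pfst (psnd e)) b y))) \<or>
    (pfst e = 4 \<and> (\<exists>n b v. a = lcons (Suc n) b \<and> I (claim e (lcons n b) v) \<and>
      I (claim (psnd (psnd e)) (lcons v (lcons n b)) y))) \<or>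
    (pfst e = 5 \<and> I (claim (psnd e) (lcons y a) 0) \<and>
      (\<forall>i<y. \<exists>v. 0 < v \<and> I (claim (psnd e) (lcons i a) v)))"

lemma justified_mono: "(\<And>c. I c \<Longrightarrow> J c) \<Longrightarrow> justified I e a y \<Longrightarrow> justified J e a y"
  unfolding justified_def by (elim disj_forward) blast+

text \<open>The induction step for soundness, with the first premise as induction hypothesis. The
  numbers \<open>b\<close> occurring in the rules may be arbitrary because every number is the code
  of a list.\<close>

lemma justified_sound:
  assumes I: "\<And>q xs y. I (claim (recf_code q) (list_encode xs) y) \<Longrightarrow> eval q xs y"
    and "justified I (recf_code q) (list_encode xs) y"
  shows "eval q xs y"
proof -
  have cons: "list_encode xs = lcons x b \<Longrightarrow> xs = x # list_decode b" for xs x b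
    by (metis lcons_list_encode list_decode_inverse list_encode_eq)
  have I': "eval q xs y" if "I (claim (recf_code q) a y)" "a = list_encode xs" for q xs a y
    using I that by simp
  have lc: "lcons x b = list_encode (x # list_decode b)" for x b
    by (simp add: lcons_def)
  show ?thesis
  proof (cases q)
    case Z
    then show ?thesis using assms(2) by (auto simp: justified_def intro: ev_Z)
  next
    case Sc
    then show ?thesis using assms(2) by (auto simp: justified_def dest!: cons intro: ev_Sc)
  next
    case (Proj n)
    then show ?thesis using assms(2)
      by (auto simp: justified_def llen_list_encode lnth_list_encode intro: ev_Proj)
  next
    case (Comp f gs)
    then obtain b where b: "llen b = length gs" "I (claim (recf_code f) b y)"
      "\<And>i. i < llen b \<Longrightarrow> I (claim (lnth (list_encode (map recf_code gs)) i) (list_encode xs) (lnth b i))"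
      using assms(2) by (auto simp: justified_def llen_list_encode)
    define ys where "ys = list_decode b"
    have b': "b = list_encode ys" by (simp add: ys_def)
    have "length ys = length gs" using b(1) by (simp add: b' llen_list_encode)
    moreover have "eval (gs ! i) xs (ys ! i)" if "i < length gs" for i
      using b(3)[of i] that calculation
      by (intro I) (simp add: b' llen_list_encode lnth_list_encode)
    ultimately show ?thesis unfolding Comp
      using I'[OF b(2) b'] by (intro ev_Comp) auto
  next
    case (Prim f g)
    then consider b where "list_encode xs = lcons 0 b" "I (claim (recf_code f) b y)"
      | n b v where "list_encode xs = lcons (Suc n) b" "I (claim (recf_code q) (lcons n b) v)"
        "I (claim (recf_code g) (lcons v (lcons n b)) y)"
      using assms(2) by (auto simp: justified_def)
    then show ?thesis
    proof cases
      case 1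
      then show ?thesis unfolding Prim
        using I'[of f b y] by (auto dest!: cons intro!: ev_Prim0)
    next
      case 2
      have "eval q (n # list_decode b) v" by (rule I'[OF 2(2) lc])
      moreover have "eval g (v # n # list_decode b) y"
        by (rule I'[OF 2(3)]) (simp add: lcons_def)
      ultimately show ?thesis using cons[OF 2(1)] unfolding Prim by (auto intro: ev_PrimS)
    qed
  next
    case (Mn f)
    then have "I (claim (recf_code f) (lcons y (list_encode xs)) 0)"
      "\<And>i. i < y \<Longrightarrow> \<exists>v>0. I (claim (recf_code f) (lcons i (list_encode xs)) v)"
      using assms(2) by (auto simp: justified_def)
    then have "eval f (y # xs) 0" "\<forall>i<y. \<exists>v. eval f (i # xs) v \<and> 0 < v"
      unfolding lcons_list_encode using I by blast+
    then show ?thesis unfolding Mn by (rule ev_Mn)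
  qed
qed

text \<open>A rule has finitely many premises: those of \<open>Comp\<close> are indexed below
  \<open>llen b\<close>, those of \<open>Mn\<close> below \<open>y\<close>, with one value chosen
  per index. Finitely many premises fit into one certificate.\<close>

lemma justified_compact:
  assumes "justified I e a y"
  obtains F where "finite F" "\<And>c. c \<in> F \<Longrightarrow> I c" "justified (\<lambda>c. c \<in> F) e a y"
proof -
  have "\<exists>F. finite F \<and> (\<forall>c\<in>F. I c) \<and> justified (\<lambda>c. c \<in> F) e a y"
    using assms[unfolded justified_def]
  proof (elim disjE conjE exE)
    fix b assume *: "pfst e = 3" "llen b = llen (psnd (psnd e))" "I (claim (pfst (psnd e)) b y)"
      "\<forall>i<llen b. I (claim (lnth (psnd (psnd e)) i) a (lnth b i))"
    show ?thesis
      by (rule exI[of _ "insert (claim (pfst (psnd e)) b y)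
           ((\<lambda>i. claim (lnth (psnd (psnd e)) i) a (lnth b i)) ` {..<llen b})"])
         (use * in \<open>auto simp: justified_def\<close>)
  next
    fix b assume "pfst e = 4" "a = lcons 0 b" "I (claim (pfst (psnd e)) b y)"
    then show ?thesis
      by (intro exI[of _ "{claim (pfst (psnd e)) b y}"]) (auto simp: justified_def)
  next
    fix n b v assume "pfst e = 4" "a = lcons (Suc n) b" "I (claim e (lcons n b) v)"
      "I (claim (psnd (psnd e)) (lcons v (lcons n b)) y)"
    then show ?thesis
      by (intro exI[of _ "{claim e (lcons n b) v, claim (psnd (psnd e)) (lcons v (lcons n b)) y}"])
         (auto simp: justified_def)
  next
    assume *: "pfst e = 5" "I (claim (psnd e) (lcons y a) 0)"
      "\<forall>i<y. \<exists>v. 0 < v \<and> I (claim (psnd e) (lcons i a) v)"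
    then obtain f where "\<And>i. i < y \<Longrightarrow> 0 < f i \<and> I (claim (psnd e) (lcons i a) (f i))"
      by metis
    with * show ?thesis
      by (intro exI[of _ "insert (claim (psnd e) (lcons y a) 0)
           ((\<lambda>i. claim (psnd e) (lcons i a) (f i)) ` {..<y})"])
         (auto simp: justified_def)
  qed (intro exI[of _ "{}"], auto simp: justified_def)+
  with that show thesis by blast
qed

text \<open>A derivation flattened to a sequence, each entry following from earlier ones. In this
  form it is coded by a single number, and earlier entries are reached by bounded search.\<close>

definition certificate :: "nat list \<Rightarrow> bool" where
  "certificate W \<longleftrightarrow> (\<forall>i<length W. justified (\<lambda>c. c \<in> set (take i W))
     (pfst (W ! i)) (pfst (psnd (W ! i))) (psnd (psnd (W ! i))))"

definition derivable :: "nat \<Rightarrow> bool" where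
  "derivable c \<longleftrightarrow> (\<exists>W. certificate W \<and> c \<in> set W)"

lemma certificate_append:
  assumes "certificate V" "certificate W" shows "certificate (V @ W)"
  unfolding certificate_def
proof (intro allI impI)
  fix i assume i: "i < length (V @ W)"
  show "justified (\<lambda>c. c \<in> set (take i (V @ W))) (pfst ((V @ W) ! i))
    (pfst (psnd ((V @ W) ! i))) (psnd (psnd ((V @ W) ! i)))"
  proof (cases "i < length V")
    case True
    then show ?thesis using assms(1) by (simp add: certificate_def nth_append)
  next
    case False
    with i have "justified (\<lambda>c. c \<in> set (take (i - length V) W)) (pfst ((V @ W) ! i))
      (pfst (psnd ((V @ W) ! i))) (psnd (psnd ((V @ W) ! i)))"
      using assms(2) by (simp add: certificate_def nth_append)
    then show ?thesis by (rule justified_mono[rotated]) (use False in auto)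
  qed
qed

lemma derivable_finite:
  assumes "finite F" "\<And>c. c \<in> F \<Longrightarrow> derivable c"
  obtains W where "certificate W" "F \<subseteq> set W"
proof -
  from assms have "\<exists>W. certificate W \<and> F \<subseteq> set W"
  proof (induction F rule: finite_induct)
    case empty
    show ?case by (rule exI[of _ "[]"]) (simp add: certificate_def)
  next
    case (insert c F)
    then obtain V W where "certificate V" "F \<subseteq> set V" "certificate W" "c \<in> set W"
      by (metis derivable_def insertCI)
    then show ?case by (intro exI[of _ "V @ W"]) (auto intro: certificate_append)
  qed
  with that show thesis by blast
qed

lemma derivable_closed:
  assumes "justified derivable e a y" shows "derivable (claim e a y)"
proof -
  from assms obtain F where F: "finite F" "\<And>c. c \<in> F \<Longrightarrow> derivable c"
    "justified (\<lambda>c. c \<in> F) e a y"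
    by (rule justified_compact) (rule that)
  from F(1,2) obtain W where W: "certificate W" "F \<subseteq> set W" by (rule derivable_finite)
  have "certificate (W @ [claim e a y])"
    unfolding certificate_def
  proof (intro allI impI)
    fix i assume i: "i < length (W @ [claim e a y])"
    have "justified (\<lambda>c. c \<in> set W) e a y" by (rule justified_mono[OF _ F(3)]) (use W in auto)
    then show "justified (\<lambda>c. c \<in> set (take i (W @ [claim e a y])))
      (pfst ((W @ [claim e a y]) ! i)) (pfst (psnd ((W @ [claim e a y]) ! i)))
      (psnd (psnd ((W @ [claim e a y]) ! i)))"
      using i W(1) by (cases "i = length W") (auto simp: certificate_def nth_append claim_def)
  qed
  then show ?thesis unfolding derivable_def by (intro exI conjI) auto
qed

lemma eval_derivable: "eval q xs y \<Longrightarrow> derivable (claim (recf_code q) (list_encode xs) y)"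
proof (induction rule: eval.induct)
  case (ev_Comp ys gs xs f z)
  then show ?case
    by (intro derivable_closed)
       (auto simp: justified_def llen_list_encode lnth_list_encode intro!: exI[of _ "list_encode ys"])
next
  case (ev_PrimS f g n xs y z)
  let ?e = "recf_code (Prim f g)"
  have "list_encode (Suc n # xs) = lcons (Suc n) (list_encode xs) \<and>
    derivable (claim ?e (lcons n (list_encode xs)) y) \<and>
    derivable (claim (psnd (psnd ?e)) (lcons y (lcons n (list_encode xs))) z)"
    using ev_PrimS.IH by (simp add: lcons_def)
  moreover have "pfst ?e = 4" by simp
  ultimately have "justified derivable ?e (list_encode (Suc n # xs)) z"
    unfolding justified_def by blast
  then show ?case by (rule derivable_closed)
next
  case (ev_Mn f n xs)
  then show ?case
    by (intro derivable_closed) (auto simp: justified_def lcons_list_encode)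
qed (intro derivable_closed; force simp: justified_def llen_list_encode lnth_list_encode lcons_def)+

text \<open>Strong induction on the position in the certificate. Entries whose function code is not
  of the form \<open>recf_code q\<close> may occur, but a claim about a genuine code rests only on
  claims about genuine codes.\<close>

lemma derivable_eval: "derivable (claim (recf_code q) (list_encode xs) y) \<Longrightarrow> eval q xs y"
proof -
  assume "derivable (claim (recf_code q) (list_encode xs) y)"
  then obtain W where W: "certificate W" "claim (recf_code q) (list_encode xs) y \<in> set W"
    unfolding derivable_def by blast
  have "eval q xs y" if "i < length W" "W ! i = claim (recf_code q) (list_encode xs) y" for i q xs y
    using that
  proof (induction i arbitrary: q xs y rule: less_induct)
    case (less i)
    show ?case
    proof (rule justified_sound)
      show "justified (\<lambda>c. c \<in> set (take i W)) (recf_code q) (list_encode xs) y"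
        using W(1) less.prems by (auto simp: certificate_def claim_def)
      fix q xs y assume "claim (recf_code q) (list_encode xs) y \<in> set (take i W)"
      then obtain j where "j < i" "j < length W" "W ! j = claim (recf_code q) (list_encode xs) y"
        by (auto simp: in_set_conv_nth)
      then show "eval q xs y" by (intro less.IH)
    qed
  qed
  with W(2) show ?thesis by (metis in_set_conv_nth)
qed

definition univ_eval :: "nat \<Rightarrow> nat \<Rightarrow> nat \<Rightarrow> bool" where
  "univ_eval e a y \<longleftrightarrow> derivable (claim e a y)"

lemma univ_eval_recf_code: "univ_eval (recf_code q) (list_encode xs) y \<longleftrightarrow> eval q xs y"
  unfolding univ_eval_def using derivable_eval eval_derivable by blast

lemma semidec_univ_eval [semidec_intros]:
  assumes "trec f" "trec g" "trec h" shows "semidec (\<lambda>x. univ_eval (f x) (g x) (h x))"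
proof -
  \<comment> \<open>Every number is a list code, so quantifying over certificates is quantifying
    over numbers; membership in a prefix becomes a bounded quantifier over positions.\<close>
  have *: "univ_eval e a y \<longleftrightarrow> (\<exists>W. (\<exists>i. i < llen W \<and> lnth W i = claim e a y) \<and>
    (\<forall>i<llen W. justified (\<lambda>c. \<exists>j<i. lnth W j = c)
      (pfst (lnth W i)) (pfst (psnd (lnth W i))) (psnd (psnd (lnth W i)))))" (is "_ \<longleftrightarrow> (\<exists>W. ?P W)") for e a y
  proof -
    have set_take: "(\<exists>j<i. lnth (list_encode W) j = c) \<longleftrightarrow> c \<in> set (take i W)" if "i < length W" for W i c
      using that by (auto simp: in_set_conv_nth lnth_list_encode)
    have "justified (\<lambda>c. \<exists>j<i. lnth (list_encode W) j = c) = justified (\<lambda>c. c \<in> set (take i W))"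
      if "i < length W" for W i
      by (simp only: set_take[OF that])
    then have cert: "(\<forall>i<llen (list_encode W). justified (\<lambda>c. \<exists>j<i. lnth (list_encode W) j = c)
      (pfst (lnth (list_encode W) i)) (pfst (psnd (lnth (list_encode W) i)))
      (psnd (psnd (lnth (list_encode W) i)))) \<longleftrightarrow> certificate W" for W
      by (simp add: certificate_def llen_list_encode lnth_list_encode)
    have mem: "(\<exists>i. i < llen (list_encode W) \<and> lnth (list_encode W) i = c) \<longleftrightarrow> c \<in> set W" for W c
      by (auto simp: llen_list_encode lnth_list_encode in_set_conv_nth)
    have "?P (list_encode W) \<longleftrightarrow> claim e a y \<in> set W \<and> certificate W" for W
      by (simp only: cert mem)
    moreover have "(\<exists>W. P W) \<longleftrightarrow> (\<exists>W. P (list_encode W))" for P :: "nat \<Rightarrow> bool"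
      by (metis list_decode_inverse)
    ultimately show ?thesis unfolding univ_eval_def derivable_def by (simp only: conj_commute)
  qed
  show ?thesis
    unfolding * justified_def claim_def
    by (rule semidec_intros rec_intros trec_comp[OF assms(1)] trec_comp[OF assms(2)]
        trec_comp[OF assms(3)] | (rule semidec_dec, rule rec_intros))+
qed

section \<open>Complexity bounds from enumerations\<close>

lemma str_nat_bounds: "2 ^ length w \<le> Suc (str_nat w)" "Suc (str_nat w) < 2 ^ Suc (length w)"
  by (induction w) auto

lemma inj_str_nat: "inj str_nat"
proof (rule injI)
  show "str_nat v = str_nat w \<Longrightarrow> v = w" for v w
  proof (induction v arbitrary: w)
    case Nil
    then show ?case by (cases w) (auto split: if_splits)
  next
    case (Cons b v)
    then obtain b' w' where w: "w = b' # w'" by (cases w) (auto split: if_splits)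
    have "b = b' \<and> str_nat v = str_nat w'"
      using Cons.prems unfolding w by (auto split: if_splits) presburger+
    then show ?case using Cons.IH w by simp
  qed
qed

lemma surj_str_nat: "surj str_nat"
proof -
  have "\<exists>w. str_nat w = n" for n
  proof (induction n rule: less_induct)
    case (less n)
    show ?case
    proof (cases "n = 0")
      case True
      then show ?thesis by (intro exI[of _ "[]"]) simp
    next
      case False
      then have "(n - 1) div 2 < n" using div_le_dividend[of "n - 1" 2] by linarith
      then obtain w where "str_nat w = (n - 1) div 2" using less by blast
      \<comment> \<open>The digits are 1 and 2, so the lowest digit of a positive \<open>n\<close>,
        which is the head of the string, is 2 exactly when \<open>n\<close> is even.\<close>
      then show ?thesis
        using False by (intro exI[of _ "even n # w"]) (auto elim!: evenE oddE)
    qed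
  qed
  then show ?thesis by (metis surjI)
qed

lemma nat_str_str_nat [simp]: "nat_str (str_nat w) = w"
  unfolding nat_str_def by (simp add: inj_str_nat)

lemma str_nat_nat_str [simp]: "str_nat (nat_str n) = n"
  unfolding nat_str_def by (simp add: surj_str_nat surj_f_inv_f)

lemma nat_str_eq_iff [simp]: "nat_str m = nat_str n \<longleftrightarrow> m = n"
  by (metis str_nat_nat_str)

lemma nat_str_0 [simp]: "nat_str 0 = []"
  by (metis nat_str_str_nat str_nat.simps(1))

text \<open>Source of a recurring offset by one: programs of length at most \<open>l\<close> appear
  as \<open>Suc p < 2 ^ Suc l\<close>, programs shorter than \<open>k\<close> as
  \<open>p < 2 ^ k - 1\<close>.\<close>

lemma length_nat_str_le_iff: "length (nat_str n) \<le> l \<longleftrightarrow> Suc n < 2 ^ Suc l"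
proof
  assume "length (nat_str n) \<le> l"
  then have "(2::nat) ^ Suc (length (nat_str n)) \<le> 2 ^ Suc l" by (intro power_increasing) auto
  with str_nat_bounds(2)[of "nat_str n", unfolded str_nat_nat_str]
  show "Suc n < 2 ^ Suc l" by (rule less_le_trans)
next
  assume "Suc n < 2 ^ Suc l"
  then have "(2::nat) ^ length (nat_str n) < 2 ^ Suc l"
    using str_nat_bounds(1)[of "nat_str n"] by simp
  then show "length (nat_str n) \<le> l" by (simp only: power_strict_increasing_iff)
qed

lemma length_nat_str_eq_iff: "length (nat_str n) = l \<longleftrightarrow> 2 ^ l \<le> Suc n \<and> Suc n < 2 ^ Suc l"
proof (cases l)
  case 0
  then show ?thesis using length_nat_str_le_iff[of n 0] by auto
next
  case (Suc M)
  then show ?thesis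
    using length_nat_str_le_iff[of n l] length_nat_str_le_iff[of n M] by auto
qed

lemma length_nat_str_le: "n < 2 ^ l \<Longrightarrow> length (nat_str n) \<le> l"
  unfolding length_nat_str_le_iff by simp

section \<open>Decompressors from total functions and from searches\<close>

lemma computable2_total:
  assumes "trec2 g"
  shows "computable2 (\<lambda>p z. Some (nat_str (g (str_nat p) (str_nat z))))"
  using assms unfolding computable2_def trec2_def by (auto simp: peval_eq_Some_iff)

text \<open>The number \<open>n\<close> is meant to pack an output \<open>pfst n\<close> with a
  witness for it, so that a semidecidable relation is solved by a single minimisation.\<close>

lemma computable2_search:
  assumes "dec (\<lambda>z. P (pfst z) (psnd z))"
  shows "computable2 (\<lambda>p z. if \<exists>n. P n (str_nat p)
    then Some (nat_str (pfst (LEAST n. P n (str_nat p)))) else None)"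
proof -
  have "trec2 (\<lambda>n N. 1 - of_bool (P n N))"
    by (rule trec2_unpair) (intro rec_intros assms)
  then obtain r where r: "\<And>n N. eval r [n, N] (1 - of_bool (P n N))"
    unfolding trec2_def by blast
  from trec_pfst0 obtain q where q: "\<And>n. eval q [n] (pfst n)" unfolding trec_def by blast
  \<comment> \<open>Minimisation calls its function with \<open>[n, N, z]\<close>; \<open>s\<close>
    discards the side input \<open>z\<close>.\<close>
  define s where "s = Comp r [Proj 0, Proj 1]"
  have s: "eval s [n, N, z] (1 - of_bool (P n N))" for n N z
    unfolding s_def by (rule eval_Comp2[OF eval_Proj0 eval_Proj1 r])
  have "peval (Comp q [Mn s]) [N, z] =
    (if \<exists>n. P n N then Some (pfst (LEAST n. P n N)) else None)" for N z
  proof (cases "\<exists>n. P n N")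
    case True
    have "eval (Mn s) [N, z] (LEAST n. P n N)"
    proof (rule ev_Mn)
      show "eval s [LEAST n. P n N, N, z] 0"
        using s[of "LEAST n. P n N" N z] LeastI_ex[OF True] by simp
      show "\<forall>i<LEAST n. P n N. \<exists>y. eval s [i, N, z] y \<and> 0 < y"
      proof (intro allI impI)
        fix i assume "i < (LEAST n. P n N)"
        then have "\<not> P i N" by (rule not_less_Least)
        then show "\<exists>y. eval s [i, N, z] y \<and> 0 < y" using s[of i N z] by auto
      qed
    qed
    then show ?thesis using True q by (auto simp: peval_eq_Some_iff intro: eval_Comp1)
  next
    case False
    have "\<not> eval (Comp q [Mn s]) [N, z] y" for y
    proof
      assume "eval (Comp q [Mn s]) [N, z] y"
      then obtain n where "eval (Mn s) [N, z] n" by (auto elim: eval_CompE)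
      then have "eval s [n, N, z] 0" by (auto elim: eval_MnE)
      then have "(1::nat) - of_bool (P n N) = 0" using s eval_deterministic by blast
      with False show False by simp
    qed
    with False show ?thesis by (simp add: peval_eq_None_iff)
  qed
  then show ?thesis unfolding computable2_def by (intro exI[of _ "Comp q [Mn s]"]) simp
qed

lemma odd_mult_power2_unique:
  "(2 * a + 1) * 2 ^ u = (2 * b + 1) * 2 ^ v \<Longrightarrow> a = b \<and> u = v" for a b u v :: nat
proof (induction u arbitrary: v)
  case 0
  show ?case
  proof (cases v)
    case (Suc v')
    then have "even ((2 * b + 1) * 2 ^ v)" by simp
    then show ?thesis by (subst (asm) 0[symmetric]) simp
  qed (use 0 in simp)
next
  case (Suc u)
  show ?case
  proof (cases v)
    case 0
    have "even ((2 * a + 1) * 2 ^ Suc u)" by simp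
    then show ?thesis using 0 by (subst (asm) Suc.prems) simp
  next
    case (Suc v')
    then show ?thesis using Suc.prems Suc.IH[of v'] by simp
  qed
qed

text \<open>A word \<open>w\<close> together with a parameter \<open>e < 2 ^ u\<close>, at the cost of \<open>2 u + O(1)\<close> extra bits:
  the exponent of 2 is a unary copy of \<open>u\<close>, which makes the pair decodable.\<close>

definition tagged :: "nat \<Rightarrow> nat \<Rightarrow> nat \<Rightarrow> nat" where
  "tagged u e w = (2 * (w * 2 ^ u + e) + 1) * 2 ^ u"

lemma tagged_unique:
  assumes "tagged u e w = tagged u' e' w'" "e < 2 ^ u" "e' < 2 ^ u'"
  shows "e = e' \<and> w = w'"
proof -
  have *: "w * 2 ^ u + e = w' * 2 ^ u' + e'" "u = u'"
    using odd_mult_power2_unique assms(1) unfolding tagged_def by blast+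
  have "(w * 2 ^ u + e) mod 2 ^ u = e" "(w * 2 ^ u + e) div 2 ^ u = w"
    "(w' * 2 ^ u' + e') mod 2 ^ u' = e'" "(w' * 2 ^ u' + e') div 2 ^ u' = w'"
    using assms(2,3) by auto
  with * show ?thesis by metis
qed

text \<open>In binary, \<open>tagged u e w\<close> consists of \<open>w\<close>, then
  \<open>u\<close> digits for \<open>e\<close>, a separating 1 and \<open>u\<close> zeros.\<close>

lemma tagged_less:
  assumes "e < 2 ^ u" "w < 2 ^ l" shows "tagged u e w < 2 ^ (l + 2 * u + 1)"
proof -
  have "(w + 1) * 2 ^ u \<le> 2 ^ l * 2 ^ u" using assms(2) by (intro mult_right_mono) auto
  then have "2 * (w * 2 ^ u + e) + 1 < 2 ^ (l + u + 1)" using assms(1) by (simp add: power_add)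
  then have "tagged u e w < 2 ^ (l + u + 1) * 2 ^ u" unfolding tagged_def
    by (intro mult_strict_right_mono) auto
  also have "\<dots> = 2 ^ (l + 2 * u + 1)" by (simp flip: power_add add: algebra_simps)
  finally show ?thesis .
qed

section \<open>Complexity of numbers relative to a universal decompressor\<close>

locale universal_decompressor =
  fixes D :: decompressor
  assumes universal: "universal D"
begin

definition K :: "nat \<Rightarrow> nat" where "K y = C D (nat_str y)"

definition produces :: "nat \<Rightarrow> nat \<Rightarrow> nat \<Rightarrow> bool" where
  "produces p z y \<longleftrightarrow> D (nat_str p) (nat_str z) = Some (nat_str y)"

lemma produces_unique: "produces p z y \<Longrightarrow> produces p z y' \<Longrightarrow> y = y'"
  unfolding produces_def by simp

lemma semidec_produces [semidec_intros]:
  assumes "trec f" "trec g" "trec h" shows "semidec (\<lambda>x. produces (f x) (g x) (h x))"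
proof -
  obtain r where r: "\<And>p z. peval r [str_nat p, str_nat z] = map_option str_nat (D p z)"
    using universal unfolding universal_def computable2_def by blast
  have "peval r [p, z] = map_option str_nat (D (nat_str p) (nat_str z))" for p z
    using r[of "nat_str p" "nat_str z"] by simp
  then have "produces p z y \<longleftrightarrow> eval r [p, z] y" for p z y
    unfolding produces_def peval_eq_Some_iff[symmetric]
    by (auto simp: map_option_eq_Some)
  then have "produces p z y \<longleftrightarrow> univ_eval (recf_code r) (lcons p (lcons z 0)) y" for p z y
    using univ_eval_recf_code[of r "[p, z]" y] by (simp add: lcons_def)
  then show ?thesis by (simp only:) (intro semidec_univ_eval rec_intros assms)
qed

lemma universal_program:
  assumes "computable2 D'"
  obtains c where "\<And>p. \<exists>p'. length p' \<le> length p + c \<and> (\<forall>z. D p' z = D' p z)"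
  using universal assms unfolding universal_def by blast

text \<open>Constant programs are total, so the \<open>LEAST\<close> in \<open>KC\<close> and in
  \<open>CT\<close> ranges over a nonempty set and is attained.\<close>

lemma total_program: "\<exists>p. (\<forall>z. D p z \<noteq> None) \<and> D p x = Some y"
proof -
  have "computable2 (\<lambda>p z. Some p)"
    using computable2_total[OF trec2_fst] by simp
  then obtain c where "\<And>p. \<exists>p'. length p' \<le> length p + c \<and> (\<forall>z. D p' z = Some p)"
    by (rule universal_program) (rule that)
  then obtain p where "\<forall>z. D p z = Some y" by blast
  then show ?thesis by auto
qed

lemma C_program: obtains p where "length p = C D y" "D p [] = Some y"
proof -
  have "\<exists>n p. length p = n \<and> D p [] = Some y" using total_program[of "[]" y] by blast
  then have "\<exists>p. length p = C D y \<and> D p [] = Some y" unfolding C_def KC_def by (rule LeastI_ex)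
  with that show thesis by blast
qed

lemma C_le: "D p [] = Some y \<Longrightarrow> C D y \<le> length p"
  unfolding C_def KC_def by (rule Least_le) blast

lemma CT_program: obtains p where "length p = CT D y x" "\<forall>z. D p z \<noteq> None" "D p x = Some y"
proof -
  have "\<exists>n p. length p = n \<and> (\<forall>z. D p z \<noteq> None) \<and> D p x = Some y" using total_program[of x y] by blast
  then have "\<exists>p. length p = CT D y x \<and> (\<forall>z. D p z \<noteq> None) \<and> D p x = Some y"
    unfolding CT_def by (rule LeastI_ex)
  with that show thesis by blast
qed

lemma CT_le: "(\<And>z. D p z \<noteq> None) \<Longrightarrow> D p x = Some y \<Longrightarrow> CT D y x \<le> length p"
  unfolding CT_def by (rule Least_le) blast

lemma K_le_iff: "K y \<le> n \<longleftrightarrow> (\<exists>p. Suc p < 2 ^ Suc n \<and> produces p 0 y)"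
proof
  assume "K y \<le> n"
  obtain p where "length p = C D (nat_str y)" "D p [] = Some (nat_str y)" by (rule C_program)
  with \<open>K y \<le> n\<close> show "\<exists>p. Suc p < 2 ^ Suc n \<and> produces p 0 y"
    unfolding length_nat_str_le_iff[symmetric] by (intro exI[of _ "str_nat p"]) (simp add: produces_def K_def)
next
  assume "\<exists>p. Suc p < 2 ^ Suc n \<and> produces p 0 y"
  then obtain p where "length (nat_str p) \<le> n" "produces p 0 y"
    unfolding length_nat_str_le_iff by blast
  then show "K y \<le> n" using C_le[of "nat_str p" "nat_str y"] by (simp add: produces_def K_def)
qed

text \<open>The decompressor decodes \<open>tagged u e w\<close> and outputs the first solution
  \<open>y\<close> it finds. The search makes the choice, so only some solution is bounded; to bound
  a particular one, \<open>Q\<close> has to determine it. The advice \<open>w\<close> costs its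
  exact length, the parameter \<open>e\<close> twice its length.\<close>

lemma K_select:
  assumes "semidec (\<lambda>x. Q (pfst x) (pfst (psnd x)) (psnd (psnd x)))"
  obtains c where "\<And>e w u l. e < 2 ^ u \<Longrightarrow> w < 2 ^ l \<Longrightarrow> \<exists>y. Q e w y \<Longrightarrow>
    \<exists>y. Q e w y \<and> K y \<le> l + 2 * u + c"
proof -
  from assms obtain R where R: "dec (\<lambda>z. R (pfst z) (psnd z))"
    "\<And>x. Q (pfst x) (pfst (psnd x)) (psnd (psnd x)) \<longleftrightarrow> (\<exists>s. R s x)"
    by (rule semidecE) (rule that)
  have Q: "Q e w y \<longleftrightarrow> (\<exists>s. R s (pair e (pair w y)))" for e w y
    using R(2)[of "pair e (pair w y)"] by simp
  define P where "P n N \<longleftrightarrow> (\<exists>e<Suc N. \<exists>w<Suc N. \<exists>u<Suc N. N = tagged u e w \<and> e < 2 ^ u \<and>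
    R (psnd n) (pair e (pair w (pfst n))))" for n N
  have "dec (\<lambda>z. P (pfst z) (psnd z))"
    unfolding P_def tagged_def by (intro rec_intros dec_comp2[OF R(1)])
  from computable2_search[OF this] obtain c where c:
    "\<And>p. \<exists>p'. length p' \<le> length p + c \<and> (\<forall>z. D p' z = (if \<exists>n. P n (str_nat p)
      then Some (nat_str (pfst (LEAST n. P n (str_nat p)))) else None))"
    by (rule universal_program) (rule that)
  show thesis
  proof (rule that[of "c + 1"])
    fix e w u l assume *: "e < 2 ^ u" "w < 2 ^ l" "\<exists>y. Q e w y"
    let ?N = "tagged u e w"
    \<comment> \<open>\<open>P\<close> decodes its input by a search for \<open>e\<close>,
      \<open>w\<close> and \<open>u\<close> up to \<open>N\<close>; the true ones lie in this
      range.\<close>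
    have 1: "w < Suc ?N" "e < Suc ?N" "u < Suc ?N"
    proof -
      have "u \<le> 1 * 2 ^ u" using less_exp[of u] by simp
      also have "\<dots> \<le> ?N" unfolding tagged_def by (intro mult_right_mono) auto
      finally show "u < Suc ?N" by simp
      have "(w * 2 ^ u + e) * 1 \<le> ?N" unfolding tagged_def by (intro mult_mono) auto
      moreover have "w \<le> w * 2 ^ u + e" "e \<le> w * 2 ^ u + e"
        by (rule order_trans[OF _ le_add1]) simp_all
      ultimately show "w < Suc ?N" "e < Suc ?N" by auto
    qed
    have P: "P n ?N \<longleftrightarrow> R (psnd n) (pair e (pair w (pfst n)))" for n
    proof
      assume "P n ?N"
      then obtain e' w' u' where "?N = tagged u' e' w'" "e' < 2 ^ u'"
        "R (psnd n) (pair e' (pair w' (pfst n)))"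
        unfolding P_def by blast
      with tagged_unique[of u e w u' e' w'] *(1) show "R (psnd n) (pair e (pair w (pfst n)))" by simp
    qed (use * 1 in \<open>unfold P_def, blast\<close>)
    from *(3) obtain y s where "R s (pair e (pair w y))" unfolding Q by blast
    then have "P (pair y s) ?N" unfolding P by simp
    then have ex: "\<exists>n. P n ?N" by blast
    define y where "y = pfst (LEAST n. P n ?N)"
    from LeastI_ex[OF ex] have "Q e w y" unfolding P Q y_def by blast
    from c[of "nat_str ?N"] ex obtain p' where p': "length p' \<le> length (nat_str ?N) + c"
      "D p' [] = Some (nat_str y)"
      unfolding y_def by auto
    have "length (nat_str ?N) \<le> l + 2 * u + 1"
      by (rule length_nat_str_le) (rule tagged_less[OF *(1,2)])
    with C_le[OF p'(2)] p'(1) have "K y \<le> l + 2 * u + (c + 1)" unfolding K_def by simp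
    with \<open>Q e w y\<close> show "\<exists>y. Q e w y \<and> K y \<le> l + 2 * u + (c + 1)" by blast
  qed
qed

text \<open>A member of an enumerable set is given by its rank in order of appearance.
  \<open>first e n\<close> marks the first stage showing the value \<open>pfst n\<close>, so
  repetitions are not counted and the rank stays below the cardinality.\<close>

lemma K_enum:
  assumes "semidec (\<lambda>x. R (pfst x) (psnd x))"
  obtains c where "\<And>e u l y. e < 2 ^ u \<Longrightarrow> finite {y. R e y} \<Longrightarrow> card {y. R e y} \<le> 2 ^ l \<Longrightarrow>
    R e y \<Longrightarrow> K y \<le> l + 2 * u + c"
proof -
  from assms obtain T where T: "dec (\<lambda>z. T (pfst z) (psnd z))"
    "\<And>x. R (pfst x) (psnd x) \<longleftrightarrow> (\<exists>s. T s x)"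
    by (rule semidecE) (rule that)
  have R: "R e y \<longleftrightarrow> (\<exists>s. T s (pair e y))" for e y using T(2)[of "pair e y"] by simp
  define first where "first e n \<longleftrightarrow> T (psnd n) (pair e (pfst n)) \<and>
    (\<forall>m<n. \<not> (pfst m = pfst n \<and> T (psnd m) (pair e (pfst m))))" for e n
  have dec_first: "dec (\<lambda>x. first (f x) (g x))" if "trec f" "trec g" for f g
    unfolding first_def
    by (intro rec_intros dec_comp2[OF T(1)] that trec_comp[OF that(1)] trec_comp[OF that(2)])
  define Q where "Q e i y \<longleftrightarrow> (\<exists>n. pfst n = y \<and> first e n \<and> i = card {m. m < n \<and> first e m})" for e i y
  have "semidec (\<lambda>x. Q (pfst x) (pfst (psnd x)) (psnd (psnd x)))"
    unfolding Q_def by (intro semidec_intros semidec_dec rec_intros dec_first)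
  then obtain c where c: "\<And>e w u l. e < 2 ^ u \<Longrightarrow> w < 2 ^ l \<Longrightarrow> \<exists>y. Q e w y \<Longrightarrow>
    \<exists>y. Q e w y \<and> K y \<le> l + 2 * u + c"
    by (rule K_select) (rule that)
  show thesis
  proof (rule that)
    fix e u l y assume *: "e < 2 ^ u" "finite {y. R e y}" "card {y. R e y} \<le> 2 ^ l" "R e y"
    have inj: "inj_on pfst {n. first e n}"
    proof (rule inj_onI; simp; rule ccontr)
      fix m n assume "first e m" "first e n" "pfst m = pfst n" "m \<noteq> n"
      then show False unfolding first_def by (cases m n rule: linorder_cases) auto
    qed
    from *(4) have ex: "\<exists>n. pfst n = y \<and> T (psnd n) (pair e (pfst n))"
      unfolding R by (metis pfst_pair psnd_pair)
    define n where "n = (LEAST n. pfst n = y \<and> T (psnd n) (pair e (pfst n)))"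
    have n: "pfst n = y" "first e n"
      using LeastI_ex[OF ex] not_less_Least[where P = "\<lambda>n. pfst n = y \<and> T (psnd n) (pair e (pfst n))"]
      unfolding n_def[symmetric] first_def by auto
    define i where "i = card {m. m < n \<and> first e m}"
    have "i = card (pfst ` {m. m < n \<and> first e m})"
      unfolding i_def by (rule card_image[symmetric]) (rule inj_on_subset[OF inj], auto)
    also have "\<dots> < card {y. R e y}"
    proof (rule psubset_card_mono[OF *(2)], rule psubsetI)
      show "pfst ` {m. m < n \<and> first e m} \<subseteq> {y. R e y}"
        unfolding R first_def by auto
      have "y \<notin> pfst ` {m. m < n \<and> first e m}"
        using inj n by (auto dest: inj_onD[OF inj])
      with *(4) show "pfst ` {m. m < n \<and> first e m} \<noteq> {y. R e y}" by blast
    qed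
    finally have "i < 2 ^ l" using *(3) by simp
    moreover have "Q e i y" unfolding Q_def i_def using n by blast
    ultimately obtain y' where y': "Q e i y'" "K y' \<le> l + 2 * u + c" using c *(1) by blast
    from y'(1) obtain n' where n': "pfst n' = y'" "first e n'" "i = card {m. m < n' \<and> first e m}"
      unfolding Q_def by blast
    \<comment> \<open>The rank increases strictly along first appearances, so the value selected by
      rank \<open>i\<close> is \<open>y\<close> itself.\<close>
    have "card {m. m < a \<and> first e m} < card {m. m < b \<and> first e m}"
      if "a < b" "first e a" for a b
      by (rule psubset_card_mono) (use that in auto)
    from this[of n n'] this[of n' n] have "n = n'"
      using n(2) n'(2,3) unfolding i_def by (cases n n' rule: linorder_cases) auto
    with n(1) n'(1) y'(2) show "K y \<le> l + 2 * u + c" by simp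
  qed
qed

text \<open>Only \<open>e\<close> has to be hard-wired, so it costs its plain length; totality of
  \<open>g\<close> makes the program total.\<close>

lemma CT_trec:
  assumes "trec2 g"
  obtains c where "\<And>e z l. e < 2 ^ l \<Longrightarrow> CT D (nat_str (g e z)) (nat_str z) \<le> l + c"
proof -
  from computable2_total[OF assms] obtain c where
    c: "\<And>p. \<exists>p'. length p' \<le> length p + c \<and>
      (\<forall>z. D p' z = Some (nat_str (g (str_nat p) (str_nat z))))"
    by (rule universal_program) (rule that)
  show thesis
  proof (rule that)
    fix e z l :: nat assume "e < 2 ^ l"
    from c[of "nat_str e"] obtain p' where p': "length p' \<le> length (nat_str e) + c"
      "\<And>z. D p' z = Some (nat_str (g e (str_nat z)))" by auto
    have "CT D (nat_str (g e z)) (nat_str z) \<le> length p'" by (rule CT_le) (auto simp: p'(2))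
    with p'(1) length_nat_str_le[OF \<open>e < 2 ^ l\<close>]
    show "CT D (nat_str (g e z)) (nat_str z) \<le> l + c" by simp
  qed
qed

end

section \<open>Dyadic blocks of strings of length \<open>4 k\<close>\<close>

text \<open>A pair lies below the square of \<open>a + b + 1\<close>, so pairing doubles the length
  and adds 2. Later parameter bounds such as \<open>4 * r + 18\<close> iterate this.\<close>

lemma pair_less:
  assumes "a < 2 ^ u" "b < 2 ^ u" shows "pair a b < 2 ^ (2 * u + 2)"
proof -
  have "2 * pair a b = (a + b) * Suc (a + b) + 2 * a"
    unfolding prod_encode_def triangle_def prod.case
    by (metis add_mult_distrib2 dvd_mult_div_cancel even_mult_iff even_Suc)
  also have "\<dots> < 2 * (Suc (a + b) * Suc (a + b))" by simp
  finally have "pair a b < Suc (a + b) * Suc (a + b)" by simp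
  also have "\<dots> \<le> 2 ^ Suc u * 2 ^ Suc u" using assms by (intro mult_mono) auto
  also have "\<dots> = 2 ^ (2 * u + 2)" by (subst power_add[symmetric]) (rule arg_cong[where f = "(^) 2"], simp)
  finally show ?thesis .
qed

lemma set_encode_interval: "set_encode {b..<b + s} = 2 ^ (b + s) - 2 ^ b"
proof (induction s)
  case (Suc s)
  have "{b..<b + Suc s} = insert (b + s) {b..<b + s}" by auto
  then have "set_encode {b..<b + Suc s} = 2 ^ (b + s) + set_encode {b..<b + s}" by simp
  moreover have "(2::nat) ^ b \<le> 2 ^ (b + s)" by (intro power_increasing) auto
  ultimately show ?case unfolding Suc by simp
qed simp

lemma set_decode_less: "i \<in> set_decode v \<Longrightarrow> i < v"
proof -
  assume "i \<in> set_decode v"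
  then have "v div 2 ^ i \<noteq> 0" unfolding set_decode_def by (auto intro: ccontr)
  then have "2 ^ i \<le> v" by (simp add: div_eq_0_iff)
  then show ?thesis using less_exp[of i] by (rule less_le_trans[rotated])
qed

lemma trec_card_set_decode [rec_intros]:
  assumes "trec f" shows "trec (\<lambda>x. card (set_decode (f x)))"
proof -
  have "trec (\<lambda>x. card {i. i < f x \<and> i \<in> set_decode (f x)})"
    by (intro rec_intros assms trec_comp[OF assms])
  moreover have "{i. i < v \<and> i \<in> set_decode v} = set_decode v" for v
    using set_decode_less by auto
  ultimately show ?thesis by simp
qed

text \<open>The number of the first string of length \<open>4 * k\<close>. The others follow
  consecutively, so they are handled as indices below \<open>2 ^ (4 * k)\<close>.\<close>

definition first_str :: "nat \<Rightarrow> nat" where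
  "first_str k = 2 ^ (4 * k) - 1"

text \<open>A geometric sum in closed form: the set code of the \<open>i\<close>-th interval of
  \<open>2 ^ j\<close> consecutive numbers from \<open>first_str k\<close> on.\<close>

definition block :: "nat \<Rightarrow> nat \<Rightarrow> nat \<Rightarrow> nat" where
  "block k j i = 2 ^ (first_str k + i * 2 ^ j + 2 ^ j) - 2 ^ (first_str k + i * 2 ^ j)"

lemma set_decode_block:
  "set_decode (block k j i) = {first_str k + i * 2 ^ j..<first_str k + i * 2 ^ j + 2 ^ j}"
  unfolding block_def set_encode_interval[symmetric] by simp

lemma card_block [simp]: "card (set_decode (block k j i)) = 2 ^ j"
  by (simp add: set_decode_block)

lemma block_inj: "block k j i = block k j i' \<Longrightarrow> i = i'"
proof -
  assume "block k j i = block k j i'"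
  moreover have "first_str k + i * 2 ^ j \<in> set_decode (block k j i)" for i
    by (simp add: set_decode_block)
  ultimately have "first_str k + i * 2 ^ j \<in> set_decode (block k j i')"
    "first_str k + i' * 2 ^ j \<in> set_decode (block k j i)" by metis+
  then have "i * 2 ^ j = i' * 2 ^ j" by (simp add: set_decode_block)
  then show "i = i'" by simp
qed

lemma trec_first_str [rec_intros]: "trec f \<Longrightarrow> trec (\<lambda>x. first_str (f x))"
  unfolding first_str_def by (intro rec_intros)

lemma trec_block [rec_intros]:
  "trec f \<Longrightarrow> trec g \<Longrightarrow> trec h \<Longrightarrow> trec (\<lambda>x. block (f x) (g x) (h x))"
  unfolding block_def by (intro rec_intros)

text \<open>Dyadic grouping: the terms with \<open>2 ^ k \<le> Suc p < 2 ^ Suc k\<close> add up to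
  at most 1. Each group corresponds to one program length.\<close>

lemma sum_inverse_le: "(\<Sum>p<2 ^ k - 1. 1 / real (Suc p)) \<le> real k"
proof (induction k)
  case (Suc k)
  have split: "{..<2 ^ Suc k - 1} = {..<2 ^ k - 1} \<union> {2 ^ k - 1..<2 ^ Suc k - (1::nat)}" by auto
  have "(\<Sum>p\<in>{2 ^ k - 1..<2 ^ Suc k - 1}. 1 / real (Suc p)) \<le>
    of_nat (card {2 ^ k - 1..<2 ^ Suc k - (1::nat)}) * (1 / 2 ^ k)"
  proof (rule sum_bounded_above)
    fix p :: nat assume "p \<in> {2 ^ k - 1..<2 ^ Suc k - 1}"
    then have "2 ^ k \<le> Suc p" by auto
    then have "2 ^ k \<le> real (Suc p)" by (metis of_nat_le_iff of_nat_numeral of_nat_power)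
    then show "1 / real (Suc p) \<le> 1 / 2 ^ k" by (intro divide_left_mono) auto
  qed
  also have "card {2 ^ k - 1..<2 ^ Suc k - (1::nat)} = 2 ^ k" by simp
  finally have "(\<Sum>p\<in>{2 ^ k - 1..<2 ^ Suc k - 1}. 1 / real (Suc p)) \<le> 1" by simp
  then show ?case unfolding split using Suc by (subst sum.union_disjoint) auto
qed simp

lemma sum_block_card:
  fixes P :: "nat \<Rightarrow> bool"
  shows "(\<Sum>y<m. card {i. i < s \<and> P (y * s + i)}) = card {i. i < m * s \<and> P i}"
proof (induction m)
  case (Suc m)
  have "{i. i < Suc m * s \<and> P i} = {i. i < m * s \<and> P i} \<union> (\<lambda>i. m * s + i) ` {i. i < s \<and> P (m * s + i)}"
    (is "?A = ?B \<union> ?C")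
  proof (intro equalityI subsetI)
    fix i assume i: "i \<in> ?A"
    show "i \<in> ?B \<union> ?C"
    proof (cases "i < m * s")
      case False
      then have "i = m * s + (i - m * s)" "i - m * s < s" using i by auto
      with i show ?thesis by (auto intro!: image_eqI[of _ _ "i - m * s"])
    qed (use i in auto)
  qed auto
  moreover have "card ?C = card {i. i < s \<and> P (m * s + i)}" by (rule card_image) (auto intro: inj_onI)
  moreover have "?B \<inter> ?C = {}" by auto
  ultimately have "card ?A = card ?B + card {i. i < s \<and> P (m * s + i)}"
    by (simp add: card_Un_disjoint)
  then show ?case using Suc by simp
qed simp

section \<open>Bad strings and the choice of the block\<close>

context universal_decompressor
begin

text \<open>\<open>bad k r n\<close>: the string \<open>n\<close> has a model violating the lower boundary of the desired profile
  to the left of \<open>k\<close>. The weight \<open>Suc p\<close> stands for \<open>2 ^ length p\<close>.\<close>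

definition bad :: "nat \<Rightarrow> nat \<Rightarrow> nat \<Rightarrow> bool" where
  "bad k r n \<longleftrightarrow> (\<exists>p<2 ^ k - 1. \<exists>v. produces p 0 v \<and>
    card (set_decode v) * Suc p * 2 ^ (r + 2) \<le> 2 ^ (4 * k) \<and> n \<in> set_decode v)"

text \<open>Union bound: program \<open>p\<close> contributes at most
  \<open>2 ^ (4 * k) / (2 ^ (r + 2) * Suc p)\<close> strings, and the harmonic sum is at most
  \<open>k < 2 ^ r\<close>. The 2 in \<open>r + 2\<close> yields the density 1/4.\<close>

lemma card_bad:
  assumes "k < 2 ^ r" shows "4 * card {i. i < (M::nat) \<and> bad k r (b + i)} \<le> 2 ^ (4 * k)"
proof -
  let ?X = "\<lambda>p. {n. \<exists>v. produces p 0 v \<and>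
    card (set_decode v) * Suc p * 2 ^ (r + 2) \<le> 2 ^ (4 * k) \<and> n \<in> set_decode v}"
  have X: "finite (?X p) \<and> real (card (?X p)) \<le> 2 ^ (4 * k) / 2 ^ (r + 2) * (1 / real (Suc p))" for p
  proof (cases "\<exists>v. produces p 0 v \<and> card (set_decode v) * Suc p * 2 ^ (r + 2) \<le> 2 ^ (4 * k)")
    case True
    then obtain v where v: "produces p 0 v" "card (set_decode v) * Suc p * 2 ^ (r + 2) \<le> 2 ^ (4 * k)"
      by blast
    have "?X p = set_decode v" using v produces_unique by blast
    moreover have "real (card (set_decode v) * Suc p * 2 ^ (r + 2)) \<le> real (2 ^ (4 * k))"
      using v(2) of_nat_le_iff by blast
    then have w: "real (card (set_decode v)) * real (Suc p) * 2 ^ (r + 2) \<le> 2 ^ (4 * k)"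
      by (simp only: of_nat_mult of_nat_power of_nat_numeral)
    have "a \<le> x / y * (1 / s)" if "a * s * y \<le> x" "0 < s" "0 < y" for a s x y :: real
      using that by (simp add: field_simps)
    from this[OF w] have "real (card (set_decode v)) \<le> 2 ^ (4 * k) / 2 ^ (r + 2) * (1 / real (Suc p))"
      by simp
    ultimately show ?thesis by simp
  next
    case False
    then have X: "?X p = {}" by blast
    show ?thesis unfolding X by simp
  qed
  have "card {i. i < M \<and> bad k r (b + i)} = card ((\<lambda>i. b + i) ` {i. i < M \<and> bad k r (b + i)})"
    by (rule card_image[symmetric]) (auto intro: inj_onI)
  also have "\<dots> \<le> card (\<Union>p\<in>{..<2 ^ k - 1}. ?X p)"
  proof (rule card_mono)
    show "finite (\<Union>p\<in>{..<2 ^ k - 1}. ?X p)" by (rule finite_UN_I) (use X in blast)+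
    show "(\<lambda>i. b + i) ` {i. i < M \<and> bad k r (b + i)} \<subseteq> (\<Union>p\<in>{..<2 ^ k - 1}. ?X p)"
      unfolding bad_def by blast
  qed
  also have "\<dots> \<le> (\<Sum>p<2 ^ k - 1. card (?X p))"
    by (rule card_UN_le) simp
  finally have "real (card {i. i < M \<and> bad k r (b + i)}) \<le> real (\<Sum>p<2 ^ k - 1. card (?X p))"
    by (rule of_nat_mono)
  then have "real (card {i. i < M \<and> bad k r (b + i)}) \<le> (\<Sum>p<2 ^ k - 1. real (card (?X p)))"
    by (simp only: of_nat_sum)
  also have "\<dots> \<le> (\<Sum>p<2 ^ k - 1. 2 ^ (4 * k) / 2 ^ (r + 2) * (1 / real (Suc p)))"
    using X by (intro sum_mono) blast
  also have "\<dots> = 2 ^ (4 * k) / 2 ^ (r + 2) * (\<Sum>p<2 ^ k - 1. 1 / real (Suc p))"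
    by (rule sum_distrib_left[symmetric])
  also have "\<dots> \<le> 2 ^ (4 * k) / 2 ^ (r + 2) * real k"
    by (intro mult_left_mono sum_inverse_le) auto
  also have "\<dots> \<le> 2 ^ (4 * k) / 2 ^ (r + 2) * 2 ^ r"
    using assms by (intro mult_left_mono) (metis less_imp_le of_nat_le_iff of_nat_numeral of_nat_power, simp)
  also have "\<dots> = 2 ^ (4 * k) / 4" by (simp add: power_add)
  finally have "real (4 * card {i. i < M \<and> bad k r (b + i)}) \<le> real (2 ^ (4 * k))" by simp
  then show ?thesis by (simp only: of_nat_le_iff)
qed

text \<open>Averaging: the blocks partition the strings of length \<open>4 * k\<close>, so they
  cannot all exceed the overall density 1/4 of bad strings.\<close>

lemma good_block_exists:
  assumes "k < 2 ^ r"
  obtains y where "y < 2 ^ (2 * k)"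
    "4 * card {i. i < 2 ^ (2 * k) \<and> bad k r (first_str k + y * 2 ^ (2 * k) + i)} \<le> 2 ^ (2 * k)"
proof -
  let ?c = "\<lambda>y. card {i. i < 2 ^ (2 * k) \<and> bad k r (first_str k + (y * 2 ^ (2 * k) + i))}"
  have N: "(2::nat) ^ (2 * k) * 2 ^ (2 * k) = 2 ^ (4 * k)" by (simp flip: power_add)
  have "\<exists>y<2 ^ (2 * k). 4 * ?c y \<le> 2 ^ (2 * k)"
  proof (rule ccontr)
    assume "\<not> ?thesis"
    then have "(\<Sum>y<(2::nat) ^ (2 * k). 2 ^ (2 * k)) < (\<Sum>y<2 ^ (2 * k). 4 * ?c y)"
      by (intro sum_strict_mono) (auto simp: not_le set_eq_iff intro: exI[of _ "0::nat"])
    also have "\<dots> = 4 * card {i. i < 2 ^ (2 * k) * 2 ^ (2 * k) \<and> bad k r (first_str k + i)}"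
      by (simp only: sum_block_card[where P = "\<lambda>i. bad k r (first_str k + i)"] flip: sum_distrib_left)
    also have "\<dots> \<le> 2 ^ (4 * k)" by (rule card_bad[OF assms])
    finally show False by (simp add: N)
  qed
  with that show thesis by (auto simp: add.assoc)
qed

text \<open>The condition \<open>v < t\<close> bounds the outputs visible at stage \<open>t\<close>,
  so that it is decidable whether a program has halted by then.\<close>

lemma halting_stages:
  obtains H where "dec (\<lambda>z. H (pfst z) (pfst (psnd z)) (psnd (psnd z)))"
    "\<And>p v. produces p 0 v \<longleftrightarrow> (\<exists>t. H t p v)"
    "\<And>s t p v. s \<le> t \<Longrightarrow> H s p v \<Longrightarrow> H t p v" "\<And>t p v. H t p v \<Longrightarrow> v < t"
proof -
  have "semidec (\<lambda>x. produces (pfst x) 0 (psnd x))" by (intro semidec_intros rec_intros)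
  then obtain T where T: "dec (\<lambda>z. T (pfst z) (psnd z))"
    "\<And>x. produces (pfst x) 0 (psnd x) \<longleftrightarrow> (\<exists>t. T t x)"
    "\<And>s t x. s \<le> t \<Longrightarrow> T s x \<Longrightarrow> T t x"
    by (rule semidec_stages) (rule that)
  show thesis
  proof (rule that[of "\<lambda>t p v. v < t \<and> T t (pair p v)"])
    show "dec (\<lambda>z. psnd (psnd z) < pfst z \<and> T (pfst z) (pair (pfst (psnd z)) (psnd (psnd z))))"
      by (intro rec_intros dec_comp2[OF T(1)])
    show "produces p 0 v \<longleftrightarrow> (\<exists>t. v < t \<and> T t (pair p v))" for p v
    proof
      assume "produces p 0 v"
      then obtain t where "T t (pair p v)" using T(2)[of "pair p v"] by auto
      then show "\<exists>t. v < t \<and> T t (pair p v)"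
        by (intro exI[of _ "max t (Suc v)"]) (auto intro: T(3)[of t])
    qed (use T(2)[of "pair p v"] in auto)
  qed (auto intro: T(3))
qed

text \<open>Knowing how many programs shorter than \<open>k\<close> halt, one can wait for all of them,
  after which \<open>bad\<close> is decidable.\<close>

lemma K_good_block:
  obtains c where "\<And>k r u. k < 2 ^ r \<Longrightarrow> pair k r < 2 ^ u \<Longrightarrow>
    \<exists>y<2 ^ (2 * k). K (block k (2 * k) y) \<le> k + 2 * u + c \<and>
      4 * card {i. i < 2 ^ (2 * k) \<and> bad k r (first_str k + y * 2 ^ (2 * k) + i)} \<le> 2 ^ (2 * k)"
proof -
  obtain H where H: "dec (\<lambda>z. H (pfst z) (pfst (psnd z)) (psnd (psnd z)))"
    "\<And>p v. produces p 0 v \<longleftrightarrow> (\<exists>t. H t p v)"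
    "\<And>s t p v. s \<le> t \<Longrightarrow> H s p v \<Longrightarrow> H t p v" "\<And>t p v. H t p v \<Longrightarrow> v < t"
    by (rule halting_stages) (rule that)
  have dec_H: "dec (\<lambda>x. H (f x) (g x) (h x))" if "trec f" "trec g" "trec h" for f g h
    using dec_comp[OF H(1), of "\<lambda>x. pair (f x) (pair (g x) (h x))"] that by (simp add: rec_intros)
  define halted where "halted k t = {p. p < 2 ^ k - 1 \<and> (\<exists>v<t. H t p v)}" for k t
  define bad_at where "bad_at k r t n \<longleftrightarrow> (\<exists>p<2 ^ k - 1. \<exists>v<t. H t p v \<and>
    card (set_decode v) * Suc p * 2 ^ (r + 2) \<le> 2 ^ (4 * k) \<and> n \<in> set_decode v)" for k r t n
  define Q where "Q e w v \<longleftrightarrow> (\<exists>t y. card (halted (pfst e) t) = w \<and> y < 2 ^ (2 * pfst e) \<and>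
    v = block (pfst e) (2 * pfst e) y \<and>
    4 * card {i. i < 2 ^ (2 * pfst e) \<and> bad_at (pfst e) (psnd e) t
      (first_str (pfst e) + y * 2 ^ (2 * pfst e) + i)} \<le> 2 ^ (2 * pfst e))" for e w v
  have "semidec (\<lambda>x. Q (pfst x) (pfst (psnd x)) (psnd (psnd x)))"
    unfolding Q_def halted_def bad_at_def
    by (rule semidec_ex)+ (intro semidec_dec rec_intros dec_H)
  then obtain c where c: "\<And>e w u l. e < 2 ^ u \<Longrightarrow> w < 2 ^ l \<Longrightarrow> \<exists>y. Q e w y \<Longrightarrow>
    \<exists>y. Q e w y \<and> K y \<le> l + 2 * u + c"
    by (rule K_select) (rule that)
  show thesis
  proof (rule that)
    fix k r u :: nat assume kr: "k < 2 ^ r" "pair k r < 2 ^ u"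
    define X where "X = {p. p < 2 ^ k - 1 \<and> (\<exists>v. produces p 0 v)}"
    have fin: "finite X" unfolding X_def by simp
    have sub: "halted k t \<subseteq> X" for t unfolding X_def halted_def using H(2) by blast
    have "card X \<le> card {..<2 ^ k - (1::nat)}" unfolding X_def by (intro card_mono) auto
    moreover have "(0::nat) < 2 ^ k" by simp
    \<comment> \<open>The count is the advice of \<open>k\<close> bits.\<close>
    ultimately have w: "card X < 2 ^ k" unfolding card_lessThan by linarith
    obtain t where t: "halted k t = X"
    proof -
      have "\<exists>t v. H t p v" if "p \<in> X" for p using that H(2) unfolding X_def by blast
      then obtain f g where f: "\<And>p. p \<in> X \<Longrightarrow> H (f p) p (g p)" by metis
      have "X \<subseteq> halted k (\<Sum>p\<in>X. f p)"
      proof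
        fix p assume "p \<in> X"
        then have "H (\<Sum>p\<in>X. f p) p (g p)"
          using f H(3) member_le_sum[of p X f] fin by blast
        with \<open>p \<in> X\<close> show "p \<in> halted k (\<Sum>p\<in>X. f p)"
          unfolding halted_def X_def using H(4) by blast
      qed
      with sub that show thesis by blast
    qed
    \<comment> \<open>A stage showing \<open>card X\<close> halted programs shows all of them, as
      \<open>halted k t\<close> is a subset of the finite \<open>X\<close>. Hence every stage the
      search may accept computes \<open>bad\<close> correctly, not just the one exhibited
      above.\<close>
    have bad_at: "bad_at k r t n \<longleftrightarrow> bad k r n" if "card (halted k t) = card X" for t n
    proof -
      have "halted k t = X" using that sub fin by (meson card_subset_eq)
      then have "(\<exists>v<t. H t p v) \<longleftrightarrow> (\<exists>v. produces p 0 v)" if "p < 2 ^ k - 1" for p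
        using that unfolding halted_def X_def by blast
      then have "v < t \<and> H t p v \<longleftrightarrow> produces p 0 v" if "p < 2 ^ k - 1" for p v
        using that H(2) produces_unique by metis
      then show ?thesis unfolding bad_at_def bad_def by blast
    qed
    obtain y where "y < 2 ^ (2 * k)"
      "4 * card {i. i < 2 ^ (2 * k) \<and> bad k r (first_str k + y * 2 ^ (2 * k) + i)} \<le> 2 ^ (2 * k)"
      using good_block_exists[OF kr(1)] by blast
    then have "Q (pair k r) (card X) (block k (2 * k) y)"
      unfolding Q_def by (intro exI[of _ t] exI[of _ y]) (simp add: t bad_at)
    with c[OF kr(2) w] obtain v where "Q (pair k r) (card X) v" "K v \<le> k + 2 * u + c" by blast
    then show "\<exists>y<2 ^ (2 * k). K (block k (2 * k) y) \<le> k + 2 * u + c \<and>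
      4 * card {i. i < 2 ^ (2 * k) \<and> bad k r (first_str k + y * 2 ^ (2 * k) + i)} \<le> 2 ^ (2 * k)"
      unfolding Q_def by (auto simp: bad_at)
  qed
qed

lemma card_K_le: "finite {n. K n \<le> m}" "card {n. K n \<le> m} < 2 ^ Suc m"
proof -
  have *: "{n. K n \<le> m} \<subseteq> (\<lambda>p. THE n. produces p 0 n) ` {..<2 ^ Suc m - 1}"
  proof
    fix n assume "n \<in> {n. K n \<le> m}"
    then obtain p where p: "Suc p < 2 ^ Suc m" "produces p 0 n" using K_le_iff by blast
    then have "(THE n. produces p 0 n) = n" using produces_unique by blast
    with p(1) show "n \<in> (\<lambda>p. THE n. produces p 0 n) ` {..<2 ^ Suc m - 1}"
      by (intro image_eqI[of _ _ p]) auto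
  qed
  show "finite {n. K n \<le> m}" by (rule finite_subset[OF *]) simp
  have "card {n. K n \<le> m} \<le> 2 ^ Suc m - 1"
    using surj_card_le[OF _ *] by simp
  then show "card {n. K n \<le> m} < 2 ^ Suc m" by (rule le_less_trans) simp
qed

text \<open>There are few blocks with many simple strings, so each of them is simple.\<close>

lemma K_block_simple_strings:
  obtains c where "\<And>k m u y. 2 * k \<le> m + 3 \<Longrightarrow> pair k m < 2 ^ u \<Longrightarrow> y < 2 ^ (2 * k) \<Longrightarrow>
    2 ^ (2 * k) \<le> 4 * card {i. i < 2 ^ (2 * k) \<and> K (first_str k + y * 2 ^ (2 * k) + i) \<le> m} \<Longrightarrow>
    K (block k (2 * k) y) \<le> m + 3 - 2 * k + 2 * u + c"
proof -
  obtain H where H: "dec (\<lambda>z. H (pfst z) (pfst (psnd z)) (psnd (psnd z)))"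
    "\<And>p v. produces p 0 v \<longleftrightarrow> (\<exists>t. H t p v)"
    "\<And>s t p v. s \<le> t \<Longrightarrow> H s p v \<Longrightarrow> H t p v" "\<And>t p v. H t p v \<Longrightarrow> v < t"
    by (rule halting_stages) (rule that)
  have dec_H: "dec (\<lambda>x. H (f x) (g x) (h x))" if "trec f" "trec g" "trec h" for f g h
    using dec_comp[OF H(1), of "\<lambda>x. pair (f x) (pair (g x) (h x))"] that by (simp add: rec_intros)
  define simple where "simple t m n \<longleftrightarrow> (\<exists>p<2 ^ Suc m - 1. H t p n)" for t m n
  have simple: "simple t m n \<Longrightarrow> K n \<le> m" for t m n
    unfolding simple_def K_le_iff using H(2) by (metis Suc_less_eq2 less_diff_conv Suc_eq_plus1)
  define R where "R e v \<longleftrightarrow> (\<exists>t y. y < 2 ^ (2 * pfst e) \<and> v = block (pfst e) (2 * pfst e) y \<and>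
    2 ^ (2 * pfst e) \<le> 4 * card {i. i < 2 ^ (2 * pfst e) \<and>
      simple t (psnd e) (first_str (pfst e) + y * 2 ^ (2 * pfst e) + i)})" for e v
  have "semidec (\<lambda>x. R (pfst x) (psnd x))"
    unfolding R_def simple_def
    by (rule semidec_ex)+ (intro semidec_dec rec_intros dec_H)
  then obtain c where c: "\<And>e u l y. e < 2 ^ u \<Longrightarrow> finite {y. R e y} \<Longrightarrow> card {y. R e y} \<le> 2 ^ l \<Longrightarrow>
    R e y \<Longrightarrow> K y \<le> l + 2 * u + c"
    by (rule K_enum) (rule that)
  show thesis
  proof (rule that)
    fix k m u y0 :: nat
    assume m: "2 * k \<le> m + 3" and u: "pair k m < 2 ^ u" and y0: "y0 < 2 ^ (2 * k)"
      and large: "2 ^ (2 * k) \<le> 4 * card {i. i < 2 ^ (2 * k) \<and> K (first_str k + y0 * 2 ^ (2 * k) + i) \<le> m}"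
    let ?s = "(2::nat) ^ (2 * k)"
    define Y where "Y = {y. y < ?s \<and> ?s \<le> 4 * card {i. i < ?s \<and> K (first_str k + (y * ?s + i)) \<le> m}}"
    have "finite Y" unfolding Y_def by simp
    have "card Y * ?s = (\<Sum>y\<in>Y. ?s)" by simp
    also have "\<dots> \<le> (\<Sum>y\<in>Y. 4 * card {i. i < ?s \<and> K (first_str k + (y * ?s + i)) \<le> m})"
      by (rule sum_mono) (simp add: Y_def)
    also have "\<dots> \<le> (\<Sum>y<?s. 4 * card {i. i < ?s \<and> K (first_str k + (y * ?s + i)) \<le> m})"
      by (rule sum_mono2) (auto simp: Y_def)
    also have "\<dots> = 4 * card {i. i < ?s * ?s \<and> K (first_str k + i) \<le> m}"
      by (simp only: sum_block_card[where P = "\<lambda>i. K (first_str k + i) \<le> m"] flip: sum_distrib_left)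
    also have "card {i. i < ?s * ?s \<and> K (first_str k + i) \<le> m} =
      card ((\<lambda>i. first_str k + i) ` {i. i < ?s * ?s \<and> K (first_str k + i) \<le> m})"
      by (rule card_image[symmetric]) (auto intro: inj_onI)
    also have "\<dots> \<le> card {n. K n \<le> m}" by (rule card_mono[OF card_K_le(1)]) auto
    also have "\<dots> \<le> 2 ^ Suc m" using card_K_le(2)[of m] by simp
    \<comment> \<open>The exponent combines a factor 4 from the density with the bound
      \<open>2 ^ (m + 1)\<close> on the number of strings of complexity at most
      \<open>m\<close>.\<close>
    finally have "card Y * ?s \<le> 2 ^ (m + 3)" by (simp add: power_add)
    also have "\<dots> = 2 ^ (m + 3 - 2 * k) * ?s" using m by (simp flip: power_add)
    finally have Y: "card Y \<le> 2 ^ (m + 3 - 2 * k)" by simp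
    have sub: "{v. R (pair k m) v} \<subseteq> block k (2 * k) ` Y"
    proof
      fix v assume "v \<in> {v. R (pair k m) v}"
      then obtain t y where y: "y < ?s" "v = block k (2 * k) y"
        "?s \<le> 4 * card {i. i < ?s \<and> simple t m (first_str k + y * ?s + i)}"
        unfolding R_def by auto
      have "card {i. i < ?s \<and> simple t m (first_str k + y * ?s + i)} \<le>
        card {i. i < ?s \<and> K (first_str k + (y * ?s + i)) \<le> m}"
        by (rule card_mono) (auto simp: add.assoc dest: simple)
      with y show "v \<in> block k (2 * k) ` Y" unfolding Y_def by auto
    qed
    have "finite (block k (2 * k) ` Y)" using \<open>finite Y\<close> by simp
    with sub have "finite {v. R (pair k m) v}" by (rule finite_subset)
    moreover have "card {v. R (pair k m) v} \<le> 2 ^ (m + 3 - 2 * k)"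
      using surj_card_le[OF \<open>finite Y\<close> sub] Y by simp
    moreover have "R (pair k m) (block k (2 * k) y0)"
    proof -
      let ?A = "{i. i < ?s \<and> K (first_str k + y0 * ?s + i) \<le> m}"
      have "\<exists>t p. p < 2 ^ Suc m - 1 \<and> H t p (first_str k + y0 * ?s + i)" if "i \<in> ?A" for i
        using that H(2) unfolding K_le_iff by (auto simp: less_diff_conv)
      then have "\<forall>i\<in>?A. \<exists>t. simple t m (first_str k + y0 * ?s + i)"
        unfolding simple_def by blast
      then obtain f where f: "\<And>i. i \<in> ?A \<Longrightarrow> simple (f i) m (first_str k + y0 * ?s + i)"
        by (rule bchoice[elim_format]) blast
      \<comment> \<open>A common stage at which all simple strings of this block have
        appeared.\<close>
      define t where "t = (\<Sum>i\<in>?A. f i)"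
      have "simple t m (first_str k + y0 * ?s + i)" if "i \<in> ?A" for i
      proof -
        have "f i \<le> t" unfolding t_def by (rule member_le_sum[OF that]) auto
        with f[OF that] show ?thesis unfolding simple_def by (meson H(3))
      qed
      then have "card ?A \<le> card {i. i < ?s \<and> simple t m (first_str k + y0 * ?s + i)}"
        by (intro card_mono) auto
      with large have "?s \<le> 4 * card {i. i < ?s \<and> simple t m (first_str k + y0 * ?s + i)}" by simp
      with y0 show ?thesis unfolding R_def by auto
    qed
    ultimately show "K (block k (2 * k) y0) \<le> m + 3 - 2 * k + 2 * u + c" by (rule c[OF u])
  qed
qed

text \<open>Applies \<open>\<not> bad\<close> to a shortest program of \<open>v\<close>, where
  \<open>Suc p < 2 ^ (K v + 1)\<close>. This 1 and the \<open>r + 2\<close> of \<open>bad\<close>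
  give \<open>r + 3\<close>.\<close>

lemma not_bad_card:
  assumes "\<not> bad k r x" "x \<in> set_decode v" "K v < k" "card (set_decode v) \<le> 2 ^ b"
  shows "4 * k < b + K v + r + 3"
proof -
  obtain p where p: "Suc p < 2 ^ Suc (K v)" "produces p 0 v" using K_le_iff[of v "K v"] by auto
  have "(2::nat) ^ Suc (K v) \<le> 2 ^ k" using assms(3) by (intro power_increasing) auto
  with p(1) have "p < 2 ^ k - 1" by linarith
  with assms(1,2) p(2) have "2 ^ (4 * k) < card (set_decode v) * Suc p * 2 ^ (r + 2)"
    unfolding bad_def by (meson not_le)
  also have "\<dots> \<le> 2 ^ b * 2 ^ Suc (K v) * 2 ^ (r + 2)"
    using assms(4) p(1) by (intro mult_mono) auto
  also have "\<dots> = 2 ^ (b + K v + r + 3)" by (simp add: power_add)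
  finally show ?thesis by (simp only: power_strict_increasing_iff)
qed

text \<open>In the chosen block at most a quarter of the strings are bad. Fewer than a quarter have
  complexity at most \<open>3 * k - c * r\<close>: otherwise the block would be one of a few and
  simpler than \<open>k\<close>, which its good strings exclude. Any remaining string serves as
  \<open>x\<close>.\<close>

lemma string_exists:
  obtains c where "\<And>k r. 1 \<le> r \<Longrightarrow> k < 2 ^ r \<Longrightarrow> c * r \<le> k \<Longrightarrow>
    \<exists>y x. y < 2 ^ (2 * k) \<and> x \<in> set_decode (block k (2 * k) y) \<and> \<not> bad k r x \<and>
      3 * k \<le> K x + c * r \<and> k \<le> K (block k (2 * k) y) \<and> K (block k (2 * k) y) \<le> k + c * r"
proof -
  obtain c1 where c1: "\<And>k r u. k < 2 ^ r \<Longrightarrow> pair k r < 2 ^ u \<Longrightarrow>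
    \<exists>y<2 ^ (2 * k). K (block k (2 * k) y) \<le> k + 2 * u + c1 \<and>
      4 * card {i. i < 2 ^ (2 * k) \<and> bad k r (first_str k + y * 2 ^ (2 * k) + i)} \<le> 2 ^ (2 * k)"
    by (rule K_good_block) (rule that)
  obtain c2 where c2: "\<And>k m u y. 2 * k \<le> m + 3 \<Longrightarrow> pair k m < 2 ^ u \<Longrightarrow> y < 2 ^ (2 * k) \<Longrightarrow>
    2 ^ (2 * k) \<le> 4 * card {i. i < 2 ^ (2 * k) \<and> K (first_str k + y * 2 ^ (2 * k) + i) \<le> m} \<Longrightarrow>
    K (block k (2 * k) y) \<le> m + 3 - 2 * k + 2 * u + c2"
    by (rule K_block_simple_strings) (rule that)
  define c where "c = 30 + c1 + c2"
  show thesis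
  proof (rule that)
    fix k r :: nat assume r: "1 \<le> r" "k < 2 ^ r" "c * r \<le> k"
    have "c1 \<le> c1 * r" "c2 \<le> c2 * r" "c * r = 30 * r + c1 * r + c2 * r"
      using r(1) by (auto simp: c_def algebra_simps)
    \<comment> \<open>The products with \<open>r\<close> become atoms, which leaves only linear
      arithmetic.\<close>
    then obtain z1 z2 where cr: "c * r = 30 * r + z1 + z2" "c1 \<le> z1" "c2 \<le> z2" by blast
    have "pair k r < 2 ^ (2 * r + 2)" using r(2) less_exp[of r] by (intro pair_less) auto
    from c1[OF r(2) this] obtain y where y: "y < 2 ^ (2 * k)"
      "K (block k (2 * k) y) \<le> k + 2 * (2 * r + 2) + c1"
      "4 * card {i. i < 2 ^ (2 * k) \<and> bad k r (first_str k + y * 2 ^ (2 * k) + i)} \<le> 2 ^ (2 * k)"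
      by blast
    let ?b = "first_str k + y * 2 ^ (2 * k)" and ?s = "(2::nat) ^ (2 * k)"
    \<comment> \<open>With this choice \<open>m + 3 - 2 * k\<close> is \<open>k + 3 - c * r\<close>,
      far enough below \<open>k\<close> to absorb all terms of order \<open>r\<close>.\<close>
    define m where "m = 3 * k - c * r"
    have block: "k \<le> K (block k (2 * k) y)"
    proof (rule ccontr)
      assume *: "\<not> ?thesis"
      have "\<not> (\<forall>i<?s. bad k r (?b + i))"
      proof
        assume "\<forall>i<?s. bad k r (?b + i)"
        then have "{i. i < ?s \<and> bad k r (?b + i)} = {..<?s}" by auto
        with y(3) show False by simp
      qed
      then obtain i where "i < ?s" "\<not> bad k r (?b + i)" by blast
      then have "4 * k < 2 * k + K (block k (2 * k) y) + r + 3"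
        by (intro not_bad_card[of k r "?b + i"]) (use * in \<open>auto simp: set_decode_block\<close>)
      with * r cr show False by linarith
    qed
    have "\<not> ?s \<le> 4 * card {i. i < ?s \<and> K (?b + i) \<le> m}"
    proof
      assume *: "?s \<le> 4 * card {i. i < ?s \<and> K (?b + i) \<le> m}"
      have "m < 2 ^ (r + 2)" using r(2) unfolding m_def by simp
      moreover have "k < 2 ^ (r + 2)" using r(2) by simp
      ultimately have "pair k m < 2 ^ (2 * (r + 2) + 2)" by (intro pair_less)
      from c2[OF _ this y(1) *] have "K (block k (2 * k) y) \<le> m + 3 - 2 * k + 2 * (2 * (r + 2) + 2) + c2"
        using r unfolding m_def by linarith
      moreover obtain q where "q = m + 3 - 2 * k" "q + c * r = k + 3"
        using r(3) unfolding m_def by simp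
      ultimately have "c * r \<le> 15 + 4 * r + c2" using block by simp
      with r(1) cr show False by linarith
    qed
    then have "4 * card {i. i < ?s \<and> K (?b + i) \<le> m} < ?s" by simp
    with y(3) have "card {i. i < ?s \<and> bad k r (?b + i)} + card {i. i < ?s \<and> K (?b + i) \<le> m} < ?s"
      by linarith
    then have "card ({i. i < ?s \<and> bad k r (?b + i)} \<union> {i. i < ?s \<and> K (?b + i) \<le> m}) < card {..<?s}"
      using card_Un_le[of "{i. i < ?s \<and> bad k r (?b + i)}" "{i. i < ?s \<and> K (?b + i) \<le> m}"] by simp
    then have "\<not> {..<?s} \<subseteq> {i. i < ?s \<and> bad k r (?b + i)} \<union> {i. i < ?s \<and> K (?b + i) \<le> m}"
      by (intro notI) (drule card_mono[rotated]; simp)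
    then obtain i where i: "i < ?s" "\<not> bad k r (?b + i)" "\<not> K (?b + i) \<le> m" by blast
    have "3 * k \<le> K (?b + i) + c * r" using i(3) unfolding m_def by linarith
    moreover have "K (block k (2 * k) y) \<le> k + c * r"
    proof -
      have "2 * (2 * r + 2) + c1 \<le> c * r" using r(1) cr by simp
      with y(2) show ?thesis by linarith
    qed
    moreover have "?b + i \<in> set_decode (block k (2 * k) y)"
      using i(1) by (simp add: set_decode_block)
    ultimately show "\<exists>y x. y < 2 ^ (2 * k) \<and> x \<in> set_decode (block k (2 * k) y) \<and> \<not> bad k r x \<and>
      3 * k \<le> K x + c * r \<and> k \<le> K (block k (2 * k) y) \<and> K (block k (2 * k) y) \<le> k + c * r"
      using y(1) block i(2) by blast
  qed
qed

text \<open>Two-part description in counting form: fewer than \<open>2 ^ (a + 1)\<close> programs,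
  each giving at most \<open>2 ^ b\<close> elements. The cardinality test in \<open>R\<close> keeps
  the contribution of every program small.\<close>

lemma K_le_K_model:
  obtains c where "\<And>x v a b u. x \<in> set_decode v \<Longrightarrow> K v \<le> a \<Longrightarrow> card (set_decode v) \<le> 2 ^ b \<Longrightarrow>
    pair a b < 2 ^ u \<Longrightarrow> K x \<le> a + b + 2 * u + c"
proof -
  define R where "R e x \<longleftrightarrow> (\<exists>p<2 ^ Suc (pfst e) - 1. \<exists>v. produces p 0 v \<and>
    card (set_decode v) \<le> 2 ^ psnd e \<and> x \<in> set_decode v)" for e x
  have "semidec (\<lambda>x. R (pfst x) (psnd x))"
    unfolding R_def by (rule semidec_intros rec_intros | (rule semidec_dec, rule rec_intros))+
  then obtain c where c: "\<And>e u l y. e < 2 ^ u \<Longrightarrow> finite {y. R e y} \<Longrightarrow> card {y. R e y} \<le> 2 ^ l \<Longrightarrow>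
    R e y \<Longrightarrow> K y \<le> l + 2 * u + c"
    by (rule K_enum) (rule that)
  show thesis
  proof (rule that[of "c + 1"])
    fix x v a b u :: nat
    assume *: "x \<in> set_decode v" "K v \<le> a" "card (set_decode v) \<le> 2 ^ b" "pair a b < 2 ^ u"
    let ?X = "\<lambda>p. {x. \<exists>v. produces p 0 v \<and> card (set_decode v) \<le> 2 ^ b \<and> x \<in> set_decode v}"
    have X: "finite (?X p) \<and> card (?X p) \<le> 2 ^ b" for p
    proof (cases "\<exists>v. produces p 0 v \<and> card (set_decode v) \<le> 2 ^ b")
      case True
      then obtain v where v: "produces p 0 v" "card (set_decode v) \<le> 2 ^ b" by blast
      then have "?X p = set_decode v" using produces_unique by blast
      with v(2) show ?thesis by simp
    next
      case False
      then have X: "?X p = {}" by blast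
      show ?thesis unfolding X by simp
    qed
    have R: "{x. R (pair a b) x} = (\<Union>p\<in>{..<2 ^ Suc a - 1}. ?X p)"
      unfolding R_def by auto
    have "finite {x. R (pair a b) x}" unfolding R by (rule finite_UN_I) (use X in blast)+
    moreover have "card {x. R (pair a b) x} \<le> 2 ^ (a + b + 1)"
    proof -
      have "card {x. R (pair a b) x} \<le> (\<Sum>p<2 ^ Suc a - 1. card (?X p))"
        unfolding R by (rule card_UN_le) simp
      also have "\<dots> \<le> of_nat (card {..<2 ^ Suc a - (1::nat)}) * 2 ^ b"
        by (rule sum_bounded_above) (use X in blast)
      also have "\<dots> \<le> 2 ^ Suc a * 2 ^ b" by (intro mult_right_mono) auto
      also have "\<dots> = 2 ^ (a + b + 1)" by (simp add: power_add)
      finally show ?thesis .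
    qed
    moreover have "R (pair a b) x"
      using *(1-3) unfolding K_le_iff R_def by (auto simp: less_diff_conv)
    ultimately have "K x \<le> a + b + 1 + 2 * u + c" by (rule c[OF *(4)])
    then show "K x \<le> a + b + 2 * u + (c + 1)" by simp
  qed
qed

lemma K_block_le:
  obtains c where "\<And>k j i u. j \<le> 4 * k \<Longrightarrow> i < 2 ^ (4 * k - j) \<Longrightarrow> pair k j < 2 ^ u \<Longrightarrow>
    K (block k j i) \<le> 4 * k - j + 2 * u + c"
proof -
  define R where "R e v \<longleftrightarrow> (\<exists>i<2 ^ (4 * pfst e - psnd e). v = block (pfst e) (psnd e) i)" for e v
  have "semidec (\<lambda>x. R (pfst x) (psnd x))"
    unfolding R_def by (intro semidec_dec rec_intros)
  then obtain c where c: "\<And>e u l y. e < 2 ^ u \<Longrightarrow> finite {y. R e y} \<Longrightarrow> card {y. R e y} \<le> 2 ^ l \<Longrightarrow>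
    R e y \<Longrightarrow> K y \<le> l + 2 * u + c"
    by (rule K_enum) (rule that)
  show thesis
  proof (rule that)
    fix k j i u :: nat
    assume *: "j \<le> 4 * k" "i < 2 ^ (4 * k - j)" "pair k j < 2 ^ u"
    have R: "{v. R (pair k j) v} = block k j ` {..<2 ^ (4 * k - j)}" unfolding R_def by auto
    show "K (block k j i) \<le> 4 * k - j + 2 * u + c"
    proof (rule c[OF *(3)])
      show "card {v. R (pair k j) v} \<le> 2 ^ (4 * k - j)"
        unfolding R using card_image_le[of "{..<(2::nat) ^ (4 * k - j)}" "block k j"] by simp
      show "R (pair k j) (block k j i)" using *(2) unfolding R_def by auto
    qed (simp add: R)
  qed
qed

text \<open>The large block is given by its program, the small one by its position inside. This
  beats the trivial bound \<open>4 * k - j\<close> when the large block is simpler than its index of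
  \<open>2 * k\<close> bits.\<close>

lemma K_subblock_le:
  obtains c where "\<And>k a j y i u. K (block k (2 * k) y) \<le> a \<Longrightarrow> j \<le> 2 * k \<Longrightarrow> i < 2 ^ (2 * k - j) \<Longrightarrow>
    pair a (pair k j) < 2 ^ u \<Longrightarrow>
    K (block k j (y * 2 ^ (2 * k - j) + i)) \<le> a + (2 * k - j) + 2 * u + c"
proof -
  define R where "R e v \<longleftrightarrow> (\<exists>p<2 ^ Suc (pfst e) - 1. \<exists>y.
    produces p 0 (block (pfst (psnd e)) (2 * pfst (psnd e)) y) \<and>
    (\<exists>i. i < 2 ^ (2 * pfst (psnd e) - psnd (psnd e)) \<and>
      v = block (pfst (psnd e)) (psnd (psnd e)) (y * 2 ^ (2 * pfst (psnd e) - psnd (psnd e)) + i)))" for e v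
  have "semidec (\<lambda>x. R (pfst x) (psnd x))"
    unfolding R_def by (rule semidec_intros rec_intros | (rule semidec_dec, rule rec_intros))+
  then obtain c where c: "\<And>e u l y. e < 2 ^ u \<Longrightarrow> finite {y. R e y} \<Longrightarrow> card {y. R e y} \<le> 2 ^ l \<Longrightarrow>
    R e y \<Longrightarrow> K y \<le> l + 2 * u + c"
    by (rule K_enum) (rule that)
  show thesis
  proof (rule that[of "c + 1"])
    fix k a j y i u :: nat
    assume *: "K (block k (2 * k) y) \<le> a" "j \<le> 2 * k" "i < 2 ^ (2 * k - j)" "pair a (pair k j) < 2 ^ u"
    let ?e = "pair a (pair k j)" and ?s = "(2::nat) ^ (2 * k - j)"
    have sub: "{v. R ?e v} \<subseteq> (\<lambda>(p, i). block k j ((THE y. produces p 0 (block k (2 * k) y)) * ?s + i)) `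
      ({..<2 ^ Suc a - 1} \<times> {..<?s})"
    proof
      fix v assume "v \<in> {v. R ?e v}"
      then obtain p y i where v: "p < 2 ^ Suc a - 1" "produces p 0 (block k (2 * k) y)"
        "i < ?s" "v = block k j (y * ?s + i)"
        unfolding R_def by auto
      \<comment> \<open>A program has at most one output, and \<open>block_inj\<close> recovers the
        index from it, so each \<open>p\<close> accounts for at most \<open>?s\<close>
        values.\<close>
      have "(THE y. produces p 0 (block k (2 * k) y)) = y"
        using v(2) by (rule the_equality) (use v(2) produces_unique block_inj in blast)
      with v show "v \<in> (\<lambda>(p, i). block k j ((THE y. produces p 0 (block k (2 * k) y)) * ?s + i)) `
        ({..<2 ^ Suc a - 1} \<times> {..<?s})"
        by (intro image_eqI[of _ _ "(p, i)"]) auto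
    qed
    have "K (block k j (y * ?s + i)) \<le> (a + 1 + (2 * k - j)) + 2 * u + c"
    proof (rule c[OF *(4)])
      show "finite {v. R ?e v}" by (rule finite_subset[OF sub]) simp
      have "card {v. R ?e v} \<le> (2 ^ Suc a - 1) * ?s"
        using surj_card_le[OF _ sub] by simp
      also have "\<dots> \<le> 2 ^ Suc a * ?s" by (intro mult_right_mono) auto
      also have "\<dots> = 2 ^ (a + 1 + (2 * k - j))" by (simp add: power_add)
      finally show "card {v. R ?e v} \<le> 2 ^ (a + 1 + (2 * k - j))" .
      obtain p where "Suc p < 2 ^ Suc a" "produces p 0 (block k (2 * k) y)"
        using *(1) unfolding K_le_iff by blast
      then show "R ?e (block k j (y * ?s + i))"
        unfolding R_def using *(3) by (intro exI[of _ p]) auto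
    qed
    then show "K (block k j (y * ?s + i)) \<le> a + (2 * k - j) + 2 * u + (c + 1)" by simp
  qed
qed

text \<open>Finding the dyadic block around \<open>x\<close> is one division, a total operation that
  needs only \<open>k\<close> and \<open>j\<close>. This is what makes the dyadic models
  strong.\<close>

lemma CT_block_le:
  obtains c where "\<And>k j x u. pair k j < 2 ^ u \<Longrightarrow>
    CT D (nat_str (block k j ((x - first_str k) div 2 ^ j))) (nat_str x) \<le> u + c"
proof -
  have "trec2 (\<lambda>e x. block (pfst e) (psnd e) ((x - first_str (pfst e)) div 2 ^ psnd e))"
    by (rule trec2_unpair) (intro rec_intros)
  then obtain c where c: "\<And>e z l. e < 2 ^ l \<Longrightarrow>
    CT D (nat_str (block (pfst e) (psnd e) ((z - first_str (pfst e)) div 2 ^ psnd e))) (nat_str z) \<le> l + c"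
    by (rule CT_trec) (rule that)
  show thesis
    by (rule that[of c], drule c, simp)
qed

end

section \<open>Representatives of large fibres of a total function\<close>

text \<open>\<open>f i\<close> stands for the output of a program on the string
  \<open>first_str k + i\<close>, and \<open>v\<close> for a candidate model. Membership in
  \<open>v\<close> is demanded so that representatives lie inside their own model.\<close>

definition fiber :: "nat \<Rightarrow> (nat \<Rightarrow> nat) \<Rightarrow> nat \<Rightarrow> nat set" where
  "fiber k f v = {i. i < 2 ^ (4 * k) \<and> f i = v \<and> first_str k + i \<in> set_decode v}"

text \<open>The fibre is named by \<open>f i\<close>, so no model has to be described: the program
  and \<open>b\<close> determine all representatives.\<close>

definition representative :: "nat \<Rightarrow> nat \<Rightarrow> (nat \<Rightarrow> nat) \<Rightarrow> nat \<Rightarrow> bool" where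
  "representative k b f i \<longleftrightarrow> i \<in> fiber k f (f i) \<and> 2 ^ b \<le> card (fiber k f (f i)) \<and>
    (\<forall>j<i. j \<notin> fiber k f (f i))"

lemma finite_fiber [simp]: "finite (fiber k f v)"
  unfolding fiber_def by simp

lemma representative_exists:
  assumes "2 ^ b \<le> card (fiber k f v)"
  obtains i where "i \<in> fiber k f v" "representative k b f i"
proof -
  from assms have "fiber k f v \<noteq> {}" by (metis card.empty not_le zero_less_numeral zero_less_power)
  then have ex: "\<exists>i. i \<in> fiber k f v" by blast
  define i where "i = (LEAST i. i \<in> fiber k f v)"
  have i: "i \<in> fiber k f v" unfolding i_def by (rule LeastI_ex[OF ex])
  then have "f i = v" by (simp add: fiber_def)
  moreover have "j \<notin> fiber k f v" if "j < i" for j using that not_less_Least unfolding i_def by blast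
  ultimately have "representative k b f i" using i assms unfolding representative_def by simp
  with i that show thesis by blast
qed

text \<open>Fibres of different values are disjoint, and each fibre counted takes up at least
  \<open>2 ^ b\<close> of the \<open>2 ^ (4 * k)\<close> indices.\<close>

lemma card_representatives:
  assumes "b \<le> 4 * k" shows "card {i. representative k b f i} \<le> 2 ^ (4 * k - b)"
    and "finite {i. representative k b f i}"
proof -
  let ?R = "{i. representative k b f i}"
  show fin: "finite ?R"
    by (rule finite_subset[of _ "{..<2 ^ (4 * k)}"]) (auto simp: representative_def fiber_def)
  have fibers: "fiber k f (f i) \<inter> fiber k f (f j) = {}" if "i \<in> ?R" "j \<in> ?R" "i \<noteq> j" for i j
  proof (rule ccontr)
    assume "\<not> ?thesis"
    then have "f i = f j" by (auto simp: fiber_def)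
    with that show False
      by (cases i j rule: linorder_cases) (auto simp: representative_def)
  qed
  have "card ?R * 2 ^ b = (\<Sum>i\<in>?R. 2 ^ b)" by simp
  also have "\<dots> \<le> (\<Sum>i\<in>?R. card (fiber k f (f i)))"
    by (rule sum_mono) (simp add: representative_def)
  also have "\<dots> = card (\<Union>i\<in>?R. fiber k f (f i))"
    by (rule card_UN_disjoint[symmetric]) (use fin fibers in auto)
  also have "\<dots> \<le> card {..<(2::nat) ^ (4 * k)}"
    by (rule card_mono) (auto simp: fiber_def)
  also have "\<dots> = 2 ^ (4 * k - b) * 2 ^ b" using assms by (simp flip: power_add)
  finally show "card ?R \<le> 2 ^ (4 * k - b)" by simp
qed

lemma trec_card_fiber:
  assumes "trec e" "trec t" "trec g"
  shows "trec (\<lambda>x. card (fiber (e x) (lnth (t x)) (g x)))"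
  unfolding fiber_def
  by (intro rec_intros trec_comp[OF assms(1)] trec_comp[OF assms(2)] trec_comp[OF assms(3)] assms)

lemma dec_fiber:
  assumes "trec e" "trec t" "trec g" "trec h"
  shows "dec (\<lambda>x. h x \<in> fiber (e x) (lnth (t x)) (g x))"
  unfolding fiber_def mem_Collect_eq by (intro rec_intros assms)

lemma dec_representative:
  assumes "trec e" "trec t" "trec g" "trec h"
  shows "dec (\<lambda>x. representative (e x) (g x) (lnth (t x)) (h x))"
  unfolding representative_def
  by (intro rec_intros dec_fiber trec_card_fiber assms trec_comp[OF assms(1)] trec_comp[OF assms(2)]
      trec_comp[OF assms(4)])

lemma card_subset_image:
  "X \<subseteq> f ` A \<Longrightarrow> finite A \<Longrightarrow> card A \<le> n \<Longrightarrow> finite X \<and> card X \<le> n"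
  using surj_card_le[of A X f] finite_subset[of X "f ` A"] by simp

section \<open>Descriptions through finite tables of programs\<close>

context universal_decompressor
begin

text \<open>A finite witness that \<open>p\<close> converges on all strings of length
  \<open>4 * k\<close>. Programs without a table contribute nothing to the enumerations
  below.\<close>

definition tabulates :: "nat \<Rightarrow> nat \<Rightarrow> nat \<Rightarrow> bool" where
  "tabulates p k T \<longleftrightarrow> (\<forall>i<2 ^ (4 * k). produces p (first_str k + i) (lnth T i))"

lemma semidec_tabulates [semidec_intros]:
  assumes "trec f" "trec g" "trec h" shows "semidec (\<lambda>x. tabulates (f x) (g x) (h x))"
  unfolding tabulates_def
  by (intro semidec_intros rec_intros trec_comp[OF assms(1)] trec_comp[OF assms(2)]
      trec_comp[OF assms(3)] assms)

text \<open>Codes of tables may differ beyond the relevant entries, so \<open>p\<close> does not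
  determine \<open>T\<close>; it does determine fibres and representatives.\<close>

lemma fiber_tabulates:
  assumes "tabulates p k T" "tabulates p k T'"
  shows "fiber k (lnth T) = fiber k (lnth T')"
    and "representative k b (lnth T) = representative k b (lnth T')"
proof -
  have eq: "lnth T i = lnth T' i" if "i < 2 ^ (4 * k)" for i
    using assms that produces_unique unfolding tabulates_def by blast
  then show "fiber k (lnth T) = fiber k (lnth T')"
    by (auto simp: fiber_def fun_eq_iff)
  with eq show "representative k b (lnth T) = representative k b (lnth T')"
    by (auto simp: representative_def fun_eq_iff fiber_def)
qed

lemma tabulates_exists:
  assumes "\<And>z. \<exists>v. produces p z v" obtains T where "tabulates p k T"
proof -
  from assms obtain f where f: "\<And>z. produces p z (f z)" by metis
  have "tabulates p k (list_encode (map (\<lambda>i. f (first_str k + i)) [0..<2 ^ (4 * k)]))"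
    unfolding tabulates_def by (auto simp: lnth_list_encode f)
  with that show thesis by blast
qed

text \<open>A member of the fibre is given by \<open>p\<close>, a program for \<open>v\<close> and a
  rank in the fibre. Read backwards, a complex member forces a large fibre.\<close>

lemma K_fiber_le:
  obtains c where "\<And>k a n b p T v i u. tabulates p k T \<Longrightarrow> p < 2 ^ n - 1 \<Longrightarrow> K v \<le> a \<Longrightarrow>
    i \<in> fiber k (lnth T) v \<Longrightarrow> card (fiber k (lnth T) v) \<le> 2 ^ b \<Longrightarrow>
    pair k (pair a (pair n b)) < 2 ^ u \<Longrightarrow> K (first_str k + i) \<le> n + a + b + 2 * u + c"
proof -
  define R where "R e y \<longleftrightarrow> (\<exists>p<2 ^ pfst (psnd (psnd e)) - 1. \<exists>p'<2 ^ Suc (pfst (psnd e)) - 1. \<exists>T v i.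
    tabulates p (pfst e) T \<and> produces p' 0 v \<and> y = first_str (pfst e) + i \<and>
    i \<in> fiber (pfst e) (lnth T) v \<and>
    card (fiber (pfst e) (lnth T) v) \<le> 2 ^ psnd (psnd (psnd e)))" for e y
  have "semidec (\<lambda>x. R (pfst x) (psnd x))"
    unfolding R_def
    by (rule semidec_intros rec_intros trec_card_fiber dec_fiber
        | (rule semidec_dec, rule rec_intros dec_fiber))+
  then obtain c where c: "\<And>e u l y. e < 2 ^ u \<Longrightarrow> finite {y. R e y} \<Longrightarrow> card {y. R e y} \<le> 2 ^ l \<Longrightarrow>
    R e y \<Longrightarrow> K y \<le> l + 2 * u + c"
    by (rule K_enum) (rule that)
  show thesis
  proof (rule that[of "c + 1"])
    fix k a n b p T v i u :: nat
    assume *: "tabulates p k T" "p < 2 ^ n - 1" "K v \<le> a" "i \<in> fiber k (lnth T) v"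
      "card (fiber k (lnth T) v) \<le> 2 ^ b" "pair k (pair a (pair n b)) < 2 ^ u"
    let ?e = "pair k (pair a (pair n b))"
    let ?X = "\<lambda>(p, p'). {y. \<exists>T v i. tabulates p k T \<and> produces p' 0 v \<and> y = first_str k + i \<and>
      i \<in> fiber k (lnth T) v \<and> card (fiber k (lnth T) v) \<le> 2 ^ b}"
    have X: "finite (?X pp) \<and> card (?X pp) \<le> 2 ^ b" for pp
    proof (cases "\<exists>T v. tabulates (fst pp) k T \<and> produces (snd pp) 0 v \<and> card (fiber k (lnth T) v) \<le> 2 ^ b")
      case True
      then obtain T v where Tv: "tabulates (fst pp) k T" "produces (snd pp) 0 v"
        "card (fiber k (lnth T) v) \<le> 2 ^ b" by blast
      have "?X pp \<subseteq> (\<lambda>i. first_str k + i) ` fiber k (lnth T) v"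
      proof
        fix y assume "y \<in> ?X pp"
        then obtain T' v' i where y: "tabulates (fst pp) k T'" "produces (snd pp) 0 v'"
          "y = first_str k + i" "i \<in> fiber k (lnth T') v'"
          by (auto simp: case_prod_unfold)
        moreover have "v' = v" using y(2) Tv(2) by (rule produces_unique)
        moreover have "fiber k (lnth T') = fiber k (lnth T)" by (rule fiber_tabulates(1)[OF y(1) Tv(1)])
        ultimately show "y \<in> (\<lambda>i. first_str k + i) ` fiber k (lnth T) v" by simp
      qed
      then show ?thesis using Tv(3) by (rule card_subset_image[OF _ finite_fiber])
    next
      case False
      then have X: "?X pp = {}" by (auto split: prod.splits)
      show ?thesis unfolding X by simp
    qed
    have R: "{y. R ?e y} \<subseteq> (\<Union>pp\<in>{..<2 ^ n - 1} \<times> {..<2 ^ Suc a - 1}. ?X pp)"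
      unfolding R_def by fastforce
    have fin: "finite (\<Union>pp\<in>{..<2 ^ n - 1} \<times> {..<2 ^ Suc a - 1}. ?X pp)"
      by (rule finite_UN_I) (use X in blast)+
    have "card {y. R ?e y} \<le> card (\<Union>pp\<in>{..<2 ^ n - 1} \<times> {..<2 ^ Suc a - 1}. ?X pp)"
      by (rule card_mono[OF fin R])
    also have "\<dots> \<le> (\<Sum>pp\<in>{..<2 ^ n - 1} \<times> {..<2 ^ Suc a - 1}. card (?X pp))"
      by (rule card_UN_le) simp
    also have "\<dots> \<le> of_nat (card ({..<2 ^ n - (1::nat)} \<times> {..<2 ^ Suc a - (1::nat)})) * 2 ^ b"
      by (rule sum_bounded_above) (use X in blast)
    also have "\<dots> = (2 ^ n - 1) * (2 ^ Suc a - 1) * 2 ^ b" by simp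
    also have "\<dots> \<le> 2 ^ n * 2 ^ Suc a * 2 ^ b" by (intro mult_mono) auto
    also have "\<dots> = 2 ^ (n + a + b + 1)" by (simp add: power_add)
    finally have card: "card {y. R ?e y} \<le> 2 ^ (n + a + b + 1)" .
    from *(3) obtain p' where p': "Suc p' < 2 ^ Suc a" "produces p' 0 v" unfolding K_le_iff by blast
    have "R ?e (first_str k + i)"
      unfolding R_def using *(1,2,4,5) p'
      by (intro exI[of _ p] conjI exI[of _ p'] exI[of _ T] exI[of _ v] exI[of _ i]) auto
    from c[OF *(6) finite_subset[OF R fin] card this]
    show "K (first_str k + i) \<le> n + a + b + 2 * u + (c + 1)" by simp
  qed
qed

text \<open>The description is \<open>p\<close> and a rank among the representatives; the model
  \<open>v\<close> does not occur in it. So the larger the fibres, the simpler their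
  representatives.\<close>

lemma K_representative_le:
  obtains c where "\<And>k n b p T i u. tabulates p k T \<Longrightarrow> p < 2 ^ n - 1 \<Longrightarrow> b \<le> 4 * k \<Longrightarrow>
    representative k b (lnth T) i \<Longrightarrow> pair k (pair n b) < 2 ^ u \<Longrightarrow>
    K (first_str k + i) \<le> n + (4 * k - b) + 2 * u + c"
proof -
  define R where "R e y \<longleftrightarrow> (\<exists>p<2 ^ pfst (psnd e) - 1. \<exists>T i.
    tabulates p (pfst e) T \<and> y = first_str (pfst e) + i \<and>
    representative (pfst e) (psnd (psnd e)) (lnth T) i)" for e y
  have "semidec (\<lambda>x. R (pfst x) (psnd x))"
    unfolding R_def
    by (rule semidec_intros rec_intros dec_representative
        | (rule semidec_dec, rule rec_intros dec_representative))+
  then obtain c where c: "\<And>e u l y. e < 2 ^ u \<Longrightarrow> finite {y. R e y} \<Longrightarrow> card {y. R e y} \<le> 2 ^ l \<Longrightarrow>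
    R e y \<Longrightarrow> K y \<le> l + 2 * u + c"
    by (rule K_enum) (rule that)
  show thesis
  proof (rule that)
    fix k n b p T i u :: nat
    assume *: "tabulates p k T" "p < 2 ^ n - 1" "b \<le> 4 * k"
      "representative k b (lnth T) i" "pair k (pair n b) < 2 ^ u"
    let ?e = "pair k (pair n b)"
    let ?X = "\<lambda>p. {y. \<exists>T i. tabulates p k T \<and> y = first_str k + i \<and> representative k b (lnth T) i}"
    have X: "finite (?X p) \<and> card (?X p) \<le> 2 ^ (4 * k - b)" for p
    proof (cases "\<exists>T. tabulates p k T")
      case True
      then obtain T where T: "tabulates p k T" by blast
      have "?X p \<subseteq> (\<lambda>i. first_str k + i) ` {i. representative k b (lnth T) i}"
        using fiber_tabulates(2)[OF T] by fastforce
      then show ?thesis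
        by (rule card_subset_image) (rule card_representatives[OF *(3)])+
    next
      case False
      then have X: "?X p = {}" by blast
      show ?thesis unfolding X by simp
    qed
    have R: "{y. R ?e y} = (\<Union>p\<in>{..<2 ^ n - 1}. ?X p)" unfolding R_def by auto
    have fin: "finite {y. R ?e y}" unfolding R by (rule finite_UN_I) (use X in blast)+
    have "card {y. R ?e y} \<le> (\<Sum>p<2 ^ n - 1. card (?X p))" unfolding R by (rule card_UN_le) simp
    also have "\<dots> \<le> of_nat (card {..<2 ^ n - (1::nat)}) * 2 ^ (4 * k - b)"
      by (rule sum_bounded_above) (use X in blast)
    also have "\<dots> \<le> 2 ^ n * 2 ^ (4 * k - b)" by (intro mult_right_mono) auto
    also have "\<dots> = 2 ^ (n + (4 * k - b))" by (simp add: power_add)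
    finally have card: "card {y. R ?e y} \<le> 2 ^ (n + (4 * k - b))" .
    have "R ?e (first_str k + i)" unfolding R_def using *(1,2,4) by auto
    from c[OF *(5) fin card this] show "K (first_str k + i) \<le> n + (4 * k - b) + 2 * u + c" .
  qed
qed

text \<open>\<open>N\<close> is a waiting time by which \<open>q\<close> has listed all
  representatives, found by search from \<open>p\<close> and a program for \<open>q\<close>;
  \<open>M\<close> guarantees that the search succeeds. Convergence of \<open>q\<close> below
  \<open>N\<close> keeps \<open>N\<close> from exceeding the number of enumerated strings.\<close>

lemma K_enumeration_bound:
  obtains c where "\<And>k n b p T q u M. tabulates p k T \<Longrightarrow> p < 2 ^ n - 1 \<Longrightarrow>
    (\<forall>i. representative k b (lnth T) i \<longrightarrow> (\<exists>j<M. eval q [j] (first_str k + i))) \<Longrightarrow>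
    (\<forall>j<M. \<exists>z. eval q [j] z) \<Longrightarrow>
    pair k (pair b (K (recf_code q))) < 2 ^ u \<Longrightarrow>
    \<exists>N. (\<forall>i. representative k b (lnth T) i \<longrightarrow> (\<exists>j<N. eval q [j] (first_str k + i))) \<and>
      (\<forall>j<N. \<exists>z. eval q [j] z) \<and> K N \<le> n + K (recf_code q) + 2 * u + c"
proof -
  define Q where "Q e w N \<longleftrightarrow> (\<exists>T g. tabulates (w div 2 ^ Suc (psnd (psnd e))) (pfst e) T \<and>
    produces (w mod 2 ^ Suc (psnd (psnd e))) 0 g \<and>
    (\<forall>i<2 ^ (4 * pfst e). \<not> representative (pfst e) (pfst (psnd e)) (lnth T) i \<or>
      (\<exists>j. j < N \<and> univ_eval g (lcons j 0) (first_str (pfst e) + i))) \<and>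
    (\<forall>j<N. \<exists>z. univ_eval g (lcons j 0) z))" for e w N
  have "semidec (\<lambda>x. Q (pfst x) (pfst (psnd x)) (psnd (psnd x)))"
    unfolding Q_def
    by (rule semidec_intros rec_intros dec_representative
        | (rule semidec_dec, rule rec_intros dec_representative))+
  then obtain c where c: "\<And>e w u l. e < 2 ^ u \<Longrightarrow> w < 2 ^ l \<Longrightarrow> \<exists>y. Q e w y \<Longrightarrow>
    \<exists>y. Q e w y \<and> K y \<le> l + 2 * u + c"
    by (rule K_select) (rule that)
  have univ: "univ_eval (recf_code q) (lcons j 0) z \<longleftrightarrow> eval q [j] z" for q j z
    using univ_eval_recf_code[of q "[j]" z] by (simp add: lcons_def)
  show thesis
  proof (rule that[of "c + 1"])
    fix k n b p T q u M
    assume *: "tabulates p k T" "p < 2 ^ n - 1"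
      "\<forall>i. representative k b (lnth T) i \<longrightarrow> (\<exists>j<M. eval q [j] (first_str k + i))"
      "\<forall>j<M. \<exists>z. eval q [j] z"
      "pair k (pair b (K (recf_code q))) < 2 ^ u"
    let ?e = "pair k (pair b (K (recf_code q)))" and ?s = "(2::nat) ^ Suc (K (recf_code q))"
    obtain p' where p': "Suc p' < ?s" "produces p' 0 (recf_code q)"
      using K_le_iff[of "recf_code q" "K (recf_code q)"] by auto
    define w where "w = p * ?s + p'"
    have w_div: "w div ?s = p" and w_mod: "w mod ?s = p'" unfolding w_def using p'(1) by simp_all
    have "Suc p * ?s \<le> 2 ^ n * ?s" using *(2) by (intro mult_right_mono) auto
    then have "w < 2 ^ n * ?s" unfolding w_def using p'(1) by simp
    also have "\<dots> = 2 ^ (n + K (recf_code q) + 1)" by (simp add: power_add)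
    finally have w: "w < 2 ^ (n + K (recf_code q) + 1)" .
    have Q: "Q ?e w N \<longleftrightarrow>
      (\<forall>i. representative k b (lnth T) i \<longrightarrow> (\<exists>j<N. eval q [j] (first_str k + i))) \<and>
      (\<forall>j<N. \<exists>z. eval q [j] z)" (is "_ \<longleftrightarrow> ?R N") for N
    proof
      assume "Q ?e w N"
      then obtain T' g where T': "tabulates p k T'" and g: "produces p' 0 g"
        and N: "\<forall>i<2 ^ (4 * k). \<not> representative k b (lnth T') i \<or>
          (\<exists>j<N. univ_eval g (lcons j 0) (first_str k + i))"
        "\<forall>j<N. \<exists>z. univ_eval g (lcons j 0) z"
        unfolding Q_def pfst_pair psnd_pair w_div w_mod by blast
      have "g = recf_code q" using g p'(2) by (rule produces_unique)
      note N = N[unfolded this univ fiber_tabulates(2)[OF T' *(1)]]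
      have "representative k b (lnth T) i \<Longrightarrow> i < 2 ^ (4 * k)" for i
        by (simp add: representative_def fiber_def)
      with N show "?R N" by blast
    next
      assume "?R N"
      then have "\<forall>i<2 ^ (4 * k). \<not> representative k b (lnth T) i \<or>
          (\<exists>j. j < N \<and> univ_eval (recf_code q) (lcons j 0) (first_str k + i))"
        "\<forall>j<N. \<exists>z. univ_eval (recf_code q) (lcons j 0) z"
        unfolding univ by blast+
      with *(1) p'(2) show "Q ?e w N"
        unfolding Q_def pfst_pair psnd_pair w_div w_mod by blast
    qed
    have "\<exists>N. Q ?e w N" unfolding Q using *(3,4) by blast
    from c[OF *(5) w this] show "\<exists>N. (\<forall>i. representative k b (lnth T) i \<longrightarrow>
      (\<exists>j<N. eval q [j] (first_str k + i))) \<and> (\<forall>j<N. \<exists>z. eval q [j] z) \<and>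
      K N \<le> n + K (recf_code q) + 2 * u + (c + 1)"
      unfolding Q by auto
  qed
qed

text \<open>If \<open>N + s\<close> is the full length of an enumeration of \<open>L D m\<close>,
  the string found lies outside \<open>L D m\<close>. So \<open>N\<close>, \<open>q\<close> and the
  remainder \<open>s\<close> cannot all be cheap.\<close>

lemma K_outside_le:
  obtains c where "\<And>q N s l a u. \<forall>j<N + s. \<exists>z. eval q [j] z \<Longrightarrow> s < 2 ^ l \<Longrightarrow> K N \<le> a \<Longrightarrow>
    pair l (pair a (K (recf_code q))) < 2 ^ u \<Longrightarrow>
    \<exists>y. (\<forall>j<N + s. \<not> eval q [j] y) \<and> K y \<le> a + K (recf_code q) + l + 2 * u + c"
proof -
  define Q where "Q e w y \<longleftrightarrow> (\<exists>N g. produces (w div 2 ^ pfst e div 2 ^ Suc (psnd (psnd e))) 0 N \<and>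
    produces (w div 2 ^ pfst e mod 2 ^ Suc (psnd (psnd e))) 0 g \<and>
    (\<forall>j<N + w mod 2 ^ pfst e. \<exists>z. univ_eval g (lcons j 0) z \<and> \<not> z = y))" for e w y
  have "semidec (\<lambda>x. Q (pfst x) (pfst (psnd x)) (psnd (psnd x)))"
    unfolding Q_def
    by (rule semidec_intros rec_intros | (rule semidec_dec, rule rec_intros))+
  then obtain c where c: "\<And>e w u l. e < 2 ^ u \<Longrightarrow> w < 2 ^ l \<Longrightarrow> \<exists>y. Q e w y \<Longrightarrow>
    \<exists>y. Q e w y \<and> K y \<le> l + 2 * u + c"
    by (rule K_select) (rule that)
  have univ: "univ_eval (recf_code q) (lcons j 0) z \<longleftrightarrow> eval q [j] z" for q j z
    using univ_eval_recf_code[of q "[j]" z] by (simp add: lcons_def)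
  show thesis
  proof (rule that[of "c + 2"])
    fix q N s l a u
    assume *: "\<forall>j<N + s. \<exists>z. eval q [j] z" "s < 2 ^ l" "K N \<le> a"
      "pair l (pair a (K (recf_code q))) < 2 ^ u"
    let ?e = "pair l (pair a (K (recf_code q)))" and ?t = "(2::nat) ^ Suc (K (recf_code q))"
    obtain p' where p': "Suc p' < ?t" "produces p' 0 (recf_code q)"
      using K_le_iff[of "recf_code q" "K (recf_code q)"] by auto
    obtain p where p: "Suc p < 2 ^ Suc a" "produces p 0 N" using *(3) K_le_iff by blast
    define w where "w = (p * ?t + p') * 2 ^ l + s"
    have "w div 2 ^ l = p * ?t + p'" and w_mod: "w mod 2 ^ l = s" unfolding w_def using *(2) by simp_all
    then have w_div: "w div 2 ^ l div ?t = p" "w div 2 ^ l mod ?t = p'" using p'(1) by simp_all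
    have "Suc p * ?t \<le> 2 ^ Suc a * ?t" using p(1) by (intro mult_right_mono) auto
    then have "Suc (p * ?t + p') \<le> 2 ^ Suc a * ?t" using p'(1) by simp
    then have "Suc (p * ?t + p') * 2 ^ l \<le> 2 ^ Suc a * ?t * 2 ^ l" by (intro mult_right_mono) auto
    then have "w < 2 ^ Suc a * ?t * 2 ^ l" unfolding w_def using *(2) by simp
    also have "\<dots> = 2 ^ (a + K (recf_code q) + l + 2)" by (simp add: power_add)
    finally have w: "w < 2 ^ (a + K (recf_code q) + l + 2)" .
    have Q: "Q ?e w y \<Longrightarrow> \<forall>j<N + s. \<not> eval q [j] y" for y
      unfolding Q_def pfst_pair psnd_pair w_div w_mod
      using p(2) p'(2) produces_unique univ eval_deterministic by metis
    have "\<exists>y. Q ?e w y"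
    proof -
      from *(1) obtain f where f: "\<And>j. j < N + s \<Longrightarrow> eval q [j] (f j)" by metis
      have "\<exists>y. y \<notin> f ` {..<N + s}" by (rule ex_new_if_finite) auto
      then obtain y where "y \<notin> f ` {..<N + s}" ..
      then have "f j \<noteq> y" if "j < N + s" for j using that by blast
      with f have "\<forall>j<N + s. \<exists>z. univ_eval (recf_code q) (lcons j 0) z \<and> \<not> z = y"
        unfolding univ by blast
      with p(2) p'(2) have "Q ?e w y"
        unfolding Q_def pfst_pair psnd_pair w_div w_mod by blast
      then show ?thesis by blast
    qed
    from c[OF *(4) w this] Q
    show "\<exists>y. (\<forall>j<N + s. \<not> eval q [j] y) \<and> K y \<le> a + K (recf_code q) + l + 2 * u + (c + 2)"
      by fastforce
  qed
qed

end

section \<open>Universal models are not strong\<close>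

lemma set_code_eq: "set_code A = nat_str (set_encode (str_nat ` A))"
  unfolding set_code_def set_encode_def
  by (subst sum.reindex) (auto intro: inj_on_subset[OF inj_str_nat])

lemma eval_enumerates:
  assumes "enumerates q A"
  shows "eval q [j] z \<longleftrightarrow> j < card A \<and> nat_str z = enum_elt q j"
proof -
  have "peval q [j] \<noteq> None \<longleftrightarrow> j < card A" using assms unfolding enumerates_def by blast
  then show ?thesis
    unfolding peval_eq_Some_iff[symmetric] enum_elt_def by (cases "peval q [j]") auto
qed

context universal_decompressor
begin

lemma C_set_eq: "C_set D A = K (set_encode (str_nat ` A))"
  unfolding C_set_def set_code_eq K_def ..

lemma CT_set_eq: "CT_set D A x = CT D (nat_str (set_encode (str_nat ` A))) x"
  unfolding CT_set_def set_code_eq ..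

lemma C_prog_eq: "C_prog D q = K (recf_code q)"
  unfolding C_prog_def K_def ..

lemma nat_str_in_L_iff: "nat_str n \<in> L D m \<longleftrightarrow> K n \<le> m"
  by (simp add: L_def K_def)

text \<open>\<open>st\<close> keeps the binary digits of the cardinality above position
  \<open>l\<close>. Digit \<open>l\<close> is 1, so the group fits; what follows \<open>st\<close>
  is below \<open>2 ^ (l + 1)\<close>, so a position past \<open>st\<close> leaves at most
  \<open>l + 1\<close> bits of the cardinality unknown.\<close>

lemma S_bounds:
  fixes q :: recf
  assumes "S_defined D m l"
  defines "st \<equiv> card (L D m) div 2 ^ Suc l * 2 ^ Suc l"
  shows "S D q m l = enum_elt q ` {st..<st + 2 ^ l}" "st + 2 ^ l \<le> card (L D m)"
    "card (L D m) < st + 2 ^ Suc l"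
proof -
  let ?M = "card (L D m)"
  show "S D q m l = enum_elt q ` {st..<st + 2 ^ l}" by (simp add: S_def st_def Let_def)
  have "?M div 2 ^ l = 2 * (?M div 2 ^ l div 2) + 1"
    using assms(1) odd_two_times_div_two_succ[of "?M div 2 ^ l"] unfolding S_defined_def by simp
  also have "?M div 2 ^ l div 2 = ?M div 2 ^ Suc l" by (simp only: div_mult2_eq power_Suc2)
  finally have "st + 2 ^ l = ?M div 2 ^ l * 2 ^ l" unfolding st_def by (simp add: algebra_simps)
  also have "\<dots> \<le> ?M" by (simp add: div_times_less_eq_dividend)
  finally show "st + 2 ^ l \<le> ?M" .
  show "?M < st + 2 ^ Suc l"
    unfolding st_def using dividend_less_div_times[of "2 ^ Suc l" ?M] by simp
qed

text \<open>Stated for any string of length \<open>4 * k\<close> that is not bad and has complexity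
  near \<open>3 * k\<close>; the block from which \<open>x\<close> was taken does not enter.\<close>

lemma universal_models_not_strong:
  fixes c0 :: nat
  obtains c where "\<And>k r x m l eps delta q. 1 \<le> r \<Longrightarrow> k < 2 ^ r \<Longrightarrow> c * r \<le> k \<Longrightarrow>
    first_str k \<le> x \<Longrightarrow> x < first_str k + 2 ^ (4 * k) \<Longrightarrow> \<not> bad k r x \<Longrightarrow>
    3 * k \<le> K x + c0 * r \<Longrightarrow> K x \<le> 3 * k + c0 * r \<Longrightarrow>
    enumerates q (L D m) \<Longrightarrow> S_defined D m l \<Longrightarrow> nat_str x \<in> S D q m l \<Longrightarrow>
    CT_set D (S D q m l) (nat_str x) < eps \<Longrightarrow> C_set D (S D q m l) + l \<le> K x + eps \<Longrightarrow>
    C_set D (S D q m l) \<le> k + delta \<Longrightarrow> k \<le> 2 * (eps + delta + C_prog D q) + c * r"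
proof -
  obtain c1 where c1: "\<And>k a n b p T v i u. tabulates p k T \<Longrightarrow> p < 2 ^ n - 1 \<Longrightarrow> K v \<le> a \<Longrightarrow>
    i \<in> fiber k (lnth T) v \<Longrightarrow> card (fiber k (lnth T) v) \<le> 2 ^ b \<Longrightarrow>
    pair k (pair a (pair n b)) < 2 ^ u \<Longrightarrow> K (first_str k + i) \<le> n + a + b + 2 * u + c1"
    by (rule K_fiber_le) (rule that)
  obtain c2 where c2: "\<And>k n b p T i u. tabulates p k T \<Longrightarrow> p < 2 ^ n - 1 \<Longrightarrow> b \<le> 4 * k \<Longrightarrow>
    representative k b (lnth T) i \<Longrightarrow> pair k (pair n b) < 2 ^ u \<Longrightarrow>
    K (first_str k + i) \<le> n + (4 * k - b) + 2 * u + c2"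
    by (rule K_representative_le) (rule that)
  obtain c3 where c3: "\<And>k n b p T q u M. tabulates p k T \<Longrightarrow> p < 2 ^ n - 1 \<Longrightarrow>
    (\<forall>i. representative k b (lnth T) i \<longrightarrow> (\<exists>j<M. eval q [j] (first_str k + i))) \<Longrightarrow>
    (\<forall>j<M. \<exists>z. eval q [j] z) \<Longrightarrow>
    pair k (pair b (K (recf_code q))) < 2 ^ u \<Longrightarrow>
    \<exists>N. (\<forall>i. representative k b (lnth T) i \<longrightarrow> (\<exists>j<N. eval q [j] (first_str k + i))) \<and>
      (\<forall>j<N. \<exists>z. eval q [j] z) \<and> K N \<le> n + K (recf_code q) + 2 * u + c3"
    by (rule K_enumeration_bound) (rule that)
  obtain c4 where c4: "\<And>q N s l a u. \<forall>j<N + s. \<exists>z. eval q [j] z \<Longrightarrow> s < 2 ^ l \<Longrightarrow> K N \<le> a \<Longrightarrow>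
    pair l (pair a (K (recf_code q))) < 2 ^ u \<Longrightarrow>
    \<exists>y. (\<forall>j<N + s. \<not> eval q [j] y) \<and> K y \<le> a + K (recf_code q) + l + 2 * u + c4"
    by (rule K_outside_le) (rule that)
  define c where "c = 200 + 2 * c0 + c1 + c2 + c3 + c4"
  show thesis
  proof (rule that)
    fix k r x m l eps delta q
    assume r: "1 \<le> r" "k < 2 ^ r" and cr: "c * r \<le> k"
      and x: "first_str k \<le> x" "x < first_str k + 2 ^ (4 * k)" "\<not> bad k r x"
      and Kx: "3 * k \<le> K x + c0 * r" "K x \<le> 3 * k + c0 * r"
      and q: "enumerates q (L D m)" and S_def: "S_defined D m l" and xS: "nat_str x \<in> S D q m l"
      and CT: "CT_set D (S D q m l) (nat_str x) < eps"
      and suff: "C_set D (S D q m l) + l \<le> K x + eps" and le: "C_set D (S D q m l) \<le> k + delta"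
    define d where "d = K (recf_code q)"
    define z where "z = c * r"
    have "c1 \<le> c1 * r" "c2 \<le> c2 * r" "c3 \<le> c3 * r" "c4 \<le> c4 * r"
      "z = 200 * r + 2 * (c0 * r) + c1 * r + c2 * r + c3 * r + c4 * r"
      using r(1) by (auto simp: c_def z_def algebra_simps)
    then obtain z0 z1 z2 z3 z4 where z: "z = 200 * r + 2 * z0 + z1 + z2 + z3 + z4"
      "c0 * r = z0" "c1 \<le> z1" "c2 \<le> z2" "c3 \<le> z3" "c4 \<le> z4" by blast
    note cr = cr[folded z_def] and Kx = Kx[unfolded z(2)]
    have "k \<le> 2 * (eps + delta + d) + z"
    proof (rule ccontr)
      assume "\<not> ?thesis"
      then have neg: "2 * eps + 2 * delta + 2 * d + z < k" by simp
      define st where "st = card (L D m) div 2 ^ Suc l * 2 ^ Suc l"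
      note S = S_bounds[OF S_def, folded st_def]
      define v where "v = set_encode (str_nat ` S D q m l)"
      have inj: "inj_on (enum_elt q) {..<card (L D m)}" and
        ran: "enum_elt q ` {..<card (L D m)} = L D m"
        using q unfolding enumerates_def bij_betw_def by auto
      have in_L_iff: "nat_str n \<in> L D m \<longleftrightarrow> (\<exists>j<card (L D m). eval q [j] n)" for n
        unfolding eval_enumerates[OF q] by (subst ran[symmetric]) auto
      have "nat_str x \<in> enum_elt q ` {..<card (L D m)}" using xS S(2) unfolding S(1) by auto
      then have "K x \<le> m" unfolding ran nat_str_in_L_iff .
      have dec_v: "set_decode v = str_nat ` S D q m l" unfolding v_def S(1) by simp
      have "card (set_decode v) = card {st..<st + 2 ^ l}"
        unfolding dec_v S(1) image_image
      proof (rule card_image, rule inj_onI)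
        fix j j' assume j: "j \<in> {st..<st + 2 ^ l}" "j' \<in> {st..<st + 2 ^ l}"
          "str_nat (enum_elt q j) = str_nat (enum_elt q j')"
        from injD[OF inj_str_nat j(3)] show "j = j'"
          by (rule inj_onD[OF inj]) (use j(1,2) S(2) in auto)
      qed
      then have card_v: "card (set_decode v) = 2 ^ l" by simp
      have xv: "x \<in> set_decode v" unfolding dec_v using xS by (metis imageI str_nat_nat_str)
      have Kv: "K v + l \<le> K x + eps" "K v \<le> k + delta"
        using suff le unfolding C_set_eq v_def by auto
      \<comment> \<open>The assumptions bound the complexity of the model only from above. A nearly
        sufficient model simpler than \<open>k\<close> would make \<open>x\<close> bad. This lower
        bound is what limits \<open>l\<close> to about \<open>2 * k\<close>.\<close>
      have "k \<le> K v"
      proof (rule ccontr)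
        assume "\<not> ?thesis"
        with not_bad_card[OF x(3) xv, of l] card_v have "4 * k < l + K v + r + 3" by simp
        with Kv Kx neg z r(1) show False by linarith
      qed
      with Kv Kx have l: "l \<le> 2 * k + z0 + eps" by linarith
      obtain P where P: "length P = CT D (nat_str v) (nat_str x)" "\<forall>z. D P z \<noteq> None"
        "D P (nat_str x) = Some (nat_str v)"
        by (rule CT_program[of "nat_str v" "nat_str x"]) (rule that)
      define p where "p = str_nat P"
      have "length P < eps" using CT unfolding CT_set_eq P(1) v_def .
      then have "(2::nat) ^ Suc (length P) \<le> 2 ^ eps" by (intro power_increasing) auto
      with str_nat_bounds(2)[of P] have p: "p < 2 ^ eps - 1" unfolding p_def by linarith
      have "\<exists>w. produces p y w" for y
        using P(2) unfolding produces_def p_def by (metis nat_str_str_nat not_None_eq)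
      then obtain T where T: "tabulates p k T" by (rule tabulates_exists)
      define i where "i = x - first_str k"
      have i: "first_str k + i = x" "i < 2 ^ (4 * k)" unfolding i_def using x by auto
      have "produces p x v" using P(3) unfolding produces_def p_def by simp
      then have "lnth T i = v" using T i produces_unique unfolding tabulates_def by metis
      then have i_fiber: "i \<in> fiber k (lnth T) v" unfolding fiber_def using i xv by simp
      let ?F = "fiber k (lnth T) v"
      have F: "0 < card ?F" using i_fiber by (auto simp: card_gt_0_iff)
      have "card ?F \<le> card {..<(2::nat) ^ (4 * k)}" by (rule card_mono) (auto simp: fiber_def)
      then have F': "card ?F \<le> 2 ^ (4 * k)" by simp
      \<comment> \<open>\<open>b\<close> is the binary logarithm of the size of the fibre, rounded
        down.\<close>
      obtain b where b: "2 ^ b \<le> card ?F" "card ?F < 2 ^ Suc b"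
        using ex_power_ivl1[of 2 "card ?F"] F by auto
      from b(1) F' have "(2::nat) ^ b \<le> 2 ^ (4 * k)" by (rule order_trans)
      then have b4: "b \<le> 4 * k" by (simp only: power_increasing_iff)
      \<comment> \<open>Under the contrary assumption all parameters are of order \<open>k\<close>
        and fit into \<open>r + 3\<close> bits.\<close>
      have small: "eps < 2 ^ (r + 3)" "delta < 2 ^ (r + 3)" "d < 2 ^ (r + 3)" "k < 2 ^ (r + 3)"
        "k + delta < 2 ^ (r + 3)" "b < 2 ^ (r + 3)" "Suc b < 2 ^ (r + 3)"
        using neg r(2) b4 by (auto simp: power_add)
      have pair2: "pair a a' < 2 ^ (2 * r + 8)" if "a < 2 ^ (r + 3)" "a' < 2 ^ (r + 3)" for a a'
        using pair_less[OF that] by (simp add: add.commute)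
      have pair3: "pair a w < 2 ^ (4 * r + 18)" if "a < 2 ^ (r + 3)" "w < 2 ^ (2 * r + 8)" for a w
      proof -
        have "(2::nat) ^ (r + 3) \<le> 2 ^ (2 * r + 8)" by (intro power_increasing) auto
        with that pair_less[of a "2 * r + 8" w] show ?thesis by (simp add: add.commute)
      qed
      have pair4: "pair a w < 2 ^ (8 * r + 38)" if "a < 2 ^ (r + 3)" "w < 2 ^ (4 * r + 18)" for a w
      proof -
        have "(2::nat) ^ (r + 3) \<le> 2 ^ (4 * r + 18)" by (intro power_increasing) auto
        with that pair_less[of a "4 * r + 18" w] show ?thesis by (simp add: add.commute)
      qed
      have "pair k (pair (k + delta) (pair eps (Suc b))) < 2 ^ (8 * r + 38)"
        by (intro pair4 pair3 pair2 small)
      from c1[OF T p Kv(2) i_fiber less_imp_le[OF b(2)] this]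
      have "K x \<le> eps + k + delta + b + 16 * r + 77 + c1" unfolding i(1) by simp
      \<comment> \<open>\<open>x\<close> has complexity about \<open>3 * k\<close>, of which
        \<open>p\<close> and the model supply at most about \<open>eps + k + delta\<close>; the rank
        in the fibre must carry the rest, nearly \<open>2 * k\<close> bits.\<close>
      then have b_ge: "2 * k \<le> b + eps + delta + (16 * r + 77 + z1 + z0)"
        using Kx(1) z(3) by linarith
      \<comment> \<open>Up to errors, representatives have complexity
        \<open>4 * k - b \<le> 2 * k\<close>, while \<open>m\<close> is at least the complexity
        \<open>3 * k\<close> of \<open>x\<close>.\<close>
      have in_L: "nat_str (first_str k + h) \<in> L D m" if h: "representative k b (lnth T) h" for h
      proof -
        have "pair k (pair eps b) < 2 ^ (4 * r + 18)" by (intro pair3 pair2 small)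
        from c2[OF T p b4 h this] have "K (first_str k + h) + b \<le> eps + 4 * k + (8 * r + 36 + c2)"
          using b4 by simp
        with \<open>K x \<le> m\<close> show ?thesis
          unfolding nat_str_in_L_iff using b_ge Kx(1) neg z r(1) by linarith
      qed
      have reps: "\<forall>h. representative k b (lnth T) h \<longrightarrow>
          (\<exists>j<card (L D m). eval q [j] (first_str k + h))"
        using in_L unfolding in_L_iff by blast
      have defd: "\<forall>j<card (L D m). \<exists>z. eval q [j] z"
        unfolding eval_enumerates[OF q] by (metis nat_str_str_nat)
      have "pair k (pair b (K (recf_code q))) < 2 ^ (4 * r + 18)"
        unfolding d_def[symmetric] by (intro pair3 pair2 small)
      from c3[OF T p reps defd this]
      obtain N where N: "\<And>h. representative k b (lnth T) h \<Longrightarrow> \<exists>j<N. eval q [j] (first_str k + h)"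
        "\<And>j. j < N \<Longrightarrow> \<exists>z. eval q [j] z" "K N \<le> eps + d + (8 * r + 36) + c3"
        unfolding d_def by auto
      \<comment> \<open>\<open>q\<close> diverges at \<open>card (L D m)\<close>, but converges
        everywhere below \<open>N\<close>.\<close>
      have "N \<le> card (L D m)"
        using N(2)[of "card (L D m)"] unfolding eval_enumerates[OF q] by (auto intro: leI)
      obtain h where h: "h \<in> ?F" "representative k b (lnth T) h"
        using representative_exists[OF b(1)] by blast
      from N(1)[OF h(2)] obtain j where j: "j < N" "nat_str (first_str k + h) = enum_elt q j"
        "j < card (L D m)"
        unfolding eval_enumerates[OF q] by blast
      have "first_str k + h \<in> set_decode v" using h(1) by (simp add: fiber_def)
      then obtain j' where j': "st \<le> j'" "j' < st + 2 ^ l" "first_str k + h = str_nat (enum_elt q j')"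
        unfolding dec_v S(1) by auto
      with j have "enum_elt q j = enum_elt q j'" by simp
      then have "j = j'" using inj j(3) j'(2) S(2) by (auto dest: inj_onD)
      \<comment> \<open>The representative of the fibre of \<open>v\<close> is in the group, so its
        position is at least \<open>st\<close>, and \<open>N\<close> exceeds that position.\<close>
      with j(1) j'(1) S(3) \<open>N \<le> card (L D m)\<close> have rest: "card (L D m) - N < 2 ^ Suc l" by linarith
      define a where "a = eps + d + (8 * r + 36) + c3"
      have "a + 1 \<le> 4 * k" "Suc l + 1 \<le> 4 * k + 3" unfolding a_def using neg cr z l r(1) by linarith+
      then have small': "a < 2 ^ (r + 3)" "Suc l < 2 ^ (r + 3)" using r(2) by (auto simp: power_add)
      have "pair (Suc l) (pair a (K (recf_code q))) < 2 ^ (4 * r + 18)"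
        unfolding d_def[symmetric] by (intro pair3 pair2 small small')
      from c4[of N "card (L D m) - N" q "Suc l" a, OF _ rest N(3)[folded a_def] this] defd
      obtain y where y: "\<forall>j<card (L D m). \<not> eval q [j] y"
        "K y \<le> a + d + l + (8 * r + 37) + c4"
        using \<open>N \<le> card (L D m)\<close> unfolding d_def by auto
      have "nat_str y \<notin> L D m"
        using y(1) unfolding in_L_iff by blast
      \<comment> \<open>Up to terms of order \<open>r\<close>, \<open>y\<close> costs
        \<open>eps + 2 * d + l \<le> 2 * k + 2 * eps + 2 * d\<close> bits, against
        \<open>m \<ge> 3 * k\<close>.\<close>
      then have "m < K y" unfolding nat_str_in_L_iff by simp
      with \<open>K x \<le> m\<close> show False using y(2) l Kx(1) neg z r(1) unfolding a_def by linarith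
    qed
    then show "k \<le> 2 * (eps + delta + C_prog D q) + c * r"
      unfolding C_prog_eq d_def z_def .
  qed
qed

end

section \<open>The profile of the constructed string\<close>

context universal_decompressor
begin

text \<open>\<open>s\<close> collects all logarithmic errors. The two quantified conjuncts give the
  lower boundary of the profile and strong models attaining it; the bound \<open>k \<le> K v\<close>
  for \<open>j = 2 * k\<close> serves item 2.\<close>

definition has_gray_profile :: "nat \<Rightarrow> nat \<Rightarrow> nat \<Rightarrow> bool" where
  "has_gray_profile k s x \<longleftrightarrow>
    first_str k \<le> x \<and> x < first_str k + 2 ^ (4 * k) \<and> 3 * k \<le> K x + s \<and> K x \<le> 3 * k + s \<and>
    (\<forall>a b v. x \<in> set_decode v \<and> K v \<le> a \<and> card (set_decode v) \<le> 2 ^ b \<longrightarrow>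
      4 * k \<le> a + b + s \<or> k \<le> a \<and> 3 * k \<le> a + b + s) \<and>
    (\<forall>j\<le>4 * k. \<exists>v. x \<in> set_decode v \<and> card (set_decode v) = 2 ^ j \<and>
      CT D (nat_str v) (nat_str x) \<le> s \<and> K v + j \<le> 4 * k + s \<and>
      (j \<le> 2 * k \<longrightarrow> K v + j \<le> 3 * k + s) \<and> (j = 2 * k \<longrightarrow> k \<le> K v))"

lemma gray_profile_exists:
  obtains c where "\<And>k r. 1 \<le> r \<Longrightarrow> k < 2 ^ r \<Longrightarrow> c * r \<le> k \<Longrightarrow>
    \<exists>x. \<not> bad k r x \<and> has_gray_profile k (c * r) x"
proof -
  obtain c1 where c1: "\<And>k r. 1 \<le> r \<Longrightarrow> k < 2 ^ r \<Longrightarrow> c1 * r \<le> k \<Longrightarrow>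
    \<exists>y x. y < 2 ^ (2 * k) \<and> x \<in> set_decode (block k (2 * k) y) \<and> \<not> bad k r x \<and>
      3 * k \<le> K x + c1 * r \<and> k \<le> K (block k (2 * k) y) \<and> K (block k (2 * k) y) \<le> k + c1 * r"
    by (rule string_exists) (rule that)
  obtain c2 where c2: "\<And>x v a b u. x \<in> set_decode v \<Longrightarrow> K v \<le> a \<Longrightarrow> card (set_decode v) \<le> 2 ^ b \<Longrightarrow>
    pair a b < 2 ^ u \<Longrightarrow> K x \<le> a + b + 2 * u + c2"
    by (rule K_le_K_model) (rule that)
  obtain c3 where c3: "\<And>k j i u. j \<le> 4 * k \<Longrightarrow> i < 2 ^ (4 * k - j) \<Longrightarrow> pair k j < 2 ^ u \<Longrightarrow>
    K (block k j i) \<le> 4 * k - j + 2 * u + c3"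
    by (rule K_block_le) (rule that)
  obtain c4 where c4: "\<And>k a j y i u. K (block k (2 * k) y) \<le> a \<Longrightarrow> j \<le> 2 * k \<Longrightarrow> i < 2 ^ (2 * k - j) \<Longrightarrow>
    pair a (pair k j) < 2 ^ u \<Longrightarrow>
    K (block k j (y * 2 ^ (2 * k - j) + i)) \<le> a + (2 * k - j) + 2 * u + c4"
    by (rule K_subblock_le) (rule that)
  obtain c5 where c5: "\<And>k j x u. pair k j < 2 ^ u \<Longrightarrow>
    CT D (nat_str (block k j ((x - first_str k) div 2 ^ j))) (nat_str x) \<le> u + c5"
    by (rule CT_block_le) (rule that)
  define c where "c = 100 + c1 + c2 + c3 + c4 + c5"
  show thesis
  proof (rule that)
    fix k r :: nat assume r: "1 \<le> r" "k < 2 ^ r" and cr: "c * r \<le> k"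
    define s where "s = c * r"
    have "c2 \<le> c2 * r" "c3 \<le> c3 * r" "c4 \<le> c4 * r" "c5 \<le> c5 * r"
      "s = 100 * r + c1 * r + c2 * r + c3 * r + c4 * r + c5 * r"
      using r(1) by (auto simp: c_def s_def algebra_simps)
    then obtain z1 z2 z3 z4 z5 where s: "s = 100 * r + z1 + z2 + z3 + z4 + z5"
      "c1 * r = z1" "c2 \<le> z2" "c3 \<le> z3" "c4 \<le> z4" "c5 \<le> z5" by blast
    note cr = cr[folded s_def]
    have "c1 * r \<le> k" using cr s(1,2) by linarith
    from c1[OF r this] obtain y x where xy: "x \<in> set_decode (block k (2 * k) y)" "y < 2 ^ (2 * k)"
      "\<not> bad k r x" "3 * k \<le> K x + z1" "k \<le> K (block k (2 * k) y)" "K (block k (2 * k) y) \<le> k + z1"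
      unfolding s(2) by blast
    define i where "i = x - first_str k"
    have i: "x = first_str k + i" "y * 2 ^ (2 * k) \<le> i" "i < (y + 1) * 2 ^ (2 * k)"
      using xy(1) by (auto simp: set_decode_block i_def)
    have "(y + 1) * 2 ^ (2 * k) \<le> 2 ^ (2 * k) * 2 ^ (2 * k)" using xy(2) by (intro mult_right_mono) auto
    also have "\<dots> = 2 ^ (4 * k)" by (simp flip: power_add)
    finally have i4: "i < 2 ^ (4 * k)" using i(3) by linarith
    have y: "i div 2 ^ (2 * k) = y" using i(2,3) by (intro div_nat_eqI) (auto simp: algebra_simps)
    have small: "a < 2 ^ (r + 2)" if "a \<le> 4 * k" for a using that r(2) by (simp add: power_add)
    have pair2: "pair a a' < 2 ^ (2 * r + 6)" if "a < 2 ^ (r + 2)" "a' < 2 ^ (r + 2)" for a a'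
    proof -
      have "2 * (r + 2) + 2 = 2 * r + 6" by simp
      with pair_less[OF that] show ?thesis by (simp only:)
    qed
    have pair3: "pair a w < 2 ^ (4 * r + 14)" if "a < 2 ^ (r + 2)" "w < 2 ^ (2 * r + 6)" for a w
    proof -
      have "(2::nat) ^ (r + 2) \<le> 2 ^ (2 * r + 6)" by (intro power_increasing) auto
      with that pair_less[of a "2 * r + 6" w] show ?thesis by (simp add: add.commute)
    qed
    \<comment> \<open>For small blocks an explicit bound is kept in place of \<open>s\<close>: the
      case \<open>j = 0\<close> will bound \<open>K x\<close>, and passing from the singleton to
      \<open>x\<close> needs the spare room.\<close>
    have blocks: "\<exists>v. x \<in> set_decode v \<and> card (set_decode v) = 2 ^ j \<and>
      CT D (nat_str v) (nat_str x) \<le> s \<and> K v + j \<le> 4 * k + s \<and>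
      (j \<le> 2 * k \<longrightarrow> K v + j \<le> 3 * k + (z1 + 8 * r + 28 + z4)) \<and> (j = 2 * k \<longrightarrow> k \<le> K v)" if j: "j \<le> 4 * k" for j
    proof -
      let ?v = "block k j (i div 2 ^ j)"
      have kj: "pair k j < 2 ^ (2 * r + 6)" by (intro pair2 small) (use j in auto)
      have "i mod 2 ^ j < 2 ^ j" by simp
      then have "x \<in> set_decode ?v"
        unfolding set_decode_block i(1) using div_mult_mod_eq[of i "2 ^ j"]
        by (simp del: mod_less_divisor)
      moreover have "CT D (nat_str ?v) (nat_str x) \<le> s"
        using c5[OF kj, of x] s r(1) unfolding i_def[symmetric] by linarith
      moreover have "K ?v + j \<le> 4 * k + s"
      proof -
        have "i div 2 ^ j < 2 ^ (4 * k - j)"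
          using i4 j by (intro less_mult_imp_div_less) (simp flip: power_add)
        from c3[OF j this kj] have "K ?v + j \<le> 4 * k + (4 * r + 12 + c3)" using j by simp
        with s r(1) show ?thesis by linarith
      qed
      moreover have "K ?v + j \<le> 3 * k + (z1 + 8 * r + 28 + z4)" if j2: "j \<le> 2 * k"
      proof -
        have "i div 2 ^ j div 2 ^ (2 * k - j) = y"
          using j2 y by (simp flip: div_mult2_eq power_add)
        then have idx: "i div 2 ^ j = y * 2 ^ (2 * k - j) + (i div 2 ^ j) mod 2 ^ (2 * k - j)"
          using div_mult_mod_eq[of "i div 2 ^ j" "2 ^ (2 * k - j)"] by simp
        have "k + z1 \<le> 4 * k" using cr s(1) by linarith
        then have "pair (k + z1) (pair k j) < 2 ^ (4 * r + 14)"
          by (intro pair3 pair2 small) (use j in auto)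
        from c4[OF xy(6) j2 _ this, of "(i div 2 ^ j) mod 2 ^ (2 * k - j)"]
        have "K ?v + j \<le> 3 * k + (z1 + 8 * r + 28 + c4)" unfolding idx[symmetric] using j2 by simp
        with s(5) show ?thesis by linarith
      qed
      moreover have "j = 2 * k \<Longrightarrow> k \<le> K ?v" using xy(5) y by simp
      ultimately show ?thesis by (intro exI[of _ ?v]) simp
    qed
    have "3 * k \<le> K x + s" using xy(4) s(1) by linarith
    moreover have "K x \<le> 3 * k + s"
    proof -
      from blocks[of 0] obtain v where v: "x \<in> set_decode v" "card (set_decode v) \<le> 2 ^ 0"
        "K v \<le> 3 * k + (z1 + 8 * r + 28 + z4)" by auto
      have "3 * k + (z1 + 8 * r + 28 + z4) \<le> 4 * k" using cr s(1) r(1) by linarith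
      then have "pair (3 * k + (z1 + 8 * r + 28 + z4)) 0 < 2 ^ (2 * r + 6)"
        by (intro pair2 small) auto
      from c2[OF v(1,3,2) this] have "K x \<le> 3 * k + z1 + 8 * r + 28 + z4 + 4 * r + 12 + c2" by simp
      with s r(1) show ?thesis by linarith
    qed
    moreover have "4 * k \<le> a + b + s \<or> k \<le> a \<and> 3 * k \<le> a + b + s"
      if v: "x \<in> set_decode v" "K v \<le> a" "card (set_decode v) \<le> 2 ^ b" for a b v
    proof (rule disjCI)
      assume *: "\<not> (k \<le> a \<and> 3 * k \<le> a + b + s)"
      show "4 * k \<le> a + b + s"
      proof (cases "k \<le> a")
        case True
        show ?thesis
        proof (rule ccontr)
          \<comment> \<open>Supplies \<open>a, b \<le> 4 * k\<close>, so that their pair has few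
            bits; the contradiction then comes from comparing \<open>K x\<close> with
            \<open>a + b\<close>.\<close>
          assume **: "\<not> ?thesis"
          then have "pair a b < 2 ^ (2 * r + 6)" by (intro pair2 small) auto
          from c2[OF v this] have "K x \<le> a + b + (4 * r + 12 + c2)" by simp
          with True * xy(4) s r(1) show False by linarith
        qed
      next
        case False
        with not_bad_card[OF xy(3) v(1) _ v(3)] v(2) have "4 * k < b + K v + r + 3" by linarith
        with v(2) s(1) r(1) show ?thesis by linarith
      qed
    qed
    moreover have "\<exists>v. x \<in> set_decode v \<and> card (set_decode v) = 2 ^ j \<and>
      CT D (nat_str v) (nat_str x) \<le> s \<and> K v + j \<le> 4 * k + s \<and>
      (j \<le> 2 * k \<longrightarrow> K v + j \<le> 3 * k + s) \<and> (j = 2 * k \<longrightarrow> k \<le> K v)" if "j \<le> 4 * k" for j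
    proof -
      from blocks[OF that] obtain v where v: "x \<in> set_decode v" "card (set_decode v) = 2 ^ j"
        "CT D (nat_str v) (nat_str x) \<le> s" "K v + j \<le> 4 * k + s"
        "j \<le> 2 * k \<Longrightarrow> K v + j \<le> 3 * k + (z1 + 8 * r + 28 + z4)" "j = 2 * k \<Longrightarrow> k \<le> K v"
        by blast
      have "z1 + 8 * r + 28 + z4 \<le> s" using s(1) r(1) by linarith
      then have "j \<le> 2 * k \<longrightarrow> K v + j \<le> 3 * k + s" using v(5) by linarith
      with v(1-4,6) show ?thesis by blast
    qed
    ultimately have "has_gray_profile k s x"
      unfolding has_gray_profile_def using i(1) i4 by auto
    with xy(3) show "\<exists>x. \<not> bad k r x \<and> has_gray_profile k (c * r) x" unfolding s_def by blast
  qed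
qed

section \<open>From the profile conditions to normality, closeness and item 2\<close>

lemma has_gray_profile_length: "has_gray_profile k s x \<Longrightarrow> length (nat_str x) = 4 * k"
  unfolding length_nat_str_eq_iff has_gray_profile_def first_str_def by auto

lemma in_profile_code:
  assumes "in_profile D (nat_str x) (real a) (real b)"
  obtains v where "x \<in> set_decode v" "K v \<le> a" "card (set_decode v) \<le> 2 ^ b"
proof -
  from assms obtain A where A: "finite A" "nat_str x \<in> A" "C_set D A \<le> a" "log 2 (card A) \<le> b"
    unfolding in_profile_def by auto
  have "0 < card A" using A(1,2) by (auto simp: card_gt_0_iff)
  then have "real (card A) \<le> 2 powr real b" using A(4) by (subst (asm) log_le_iff) auto
  then have "real (card A) \<le> real (2 ^ b)" by (simp add: powr_realpow)
  then have "card A \<le> 2 ^ b" by (simp only: of_nat_le_iff)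
  moreover have "card (str_nat ` A) = card A" by (rule card_image) (rule inj_on_subset[OF inj_str_nat], simp)
  moreover have "x \<in> str_nat ` A" using A(2) by (metis imageI str_nat_nat_str)
  ultimately show thesis
    using that[of "set_encode (str_nat ` A)"] A(1,3) by (simp add: C_set_eq)
qed

lemma code_model:
  defines "A \<equiv> \<lambda>v. nat_str ` set_decode v"
  shows "finite (A v)" "x \<in> set_decode v \<Longrightarrow> nat_str x \<in> A v" "card (A v) = card (set_decode v)"
    "C_set D (A v) = K v" "CT_set D (A v) z = CT D (nat_str v) z"
proof -
  have "str_nat ` A v = set_decode v" unfolding A_def by (simp add: image_image)
  then show "C_set D (A v) = K v" "CT_set D (A v) z = CT D (nat_str v) z"
    by (simp_all add: C_set_eq CT_set_eq)
  show "card (A v) = card (set_decode v)"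
    unfolding A_def by (rule card_image) (simp add: inj_on_def)
qed (simp_all add: A_def)

text \<open>Sizes are capped at \<open>2 ^ (4 * k)\<close> and \<open>2 ^ (2 * k)\<close>, where the
  complexity bound is already down to \<open>s\<close> and \<open>k + s\<close>. The slack
  \<open>t\<close> will be \<open>s\<close> for pairs from the profile and 0 for pairs from
  \<open>G k\<close>.\<close>

lemma gray_profile_strong_model:
  assumes x: "has_gray_profile k s x"
    and ab: "4 * k \<le> a + b + t \<or> k \<le> a \<and> 3 * k \<le> a + b + t"
  obtains A where "finite A" "nat_str x \<in> A" "CT_set D A (nat_str x) \<le> s" "C_set D A \<le> a + t + s"
    "log 2 (card A) \<le> b"
proof -
  have "\<exists>j v. j \<le> b \<and> x \<in> set_decode v \<and> card (set_decode v) = 2 ^ j \<and>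
    CT D (nat_str v) (nat_str x) \<le> s \<and> K v \<le> a + t + s"
    using ab
  proof
    assume *: "4 * k \<le> a + b + t"
    have "min b (4 * k) \<le> 4 * k" by simp
    with x obtain v where "x \<in> set_decode v" "card (set_decode v) = 2 ^ min b (4 * k)"
      "CT D (nat_str v) (nat_str x) \<le> s" "K v + min b (4 * k) \<le> 4 * k + s"
      unfolding has_gray_profile_def by blast
    moreover from this(4) * have "K v \<le> a + t + s" by (auto simp: min_def split: if_splits)
    moreover have "min b (4 * k) \<le> b" by simp
    ultimately show ?thesis by blast
  next
    assume *: "k \<le> a \<and> 3 * k \<le> a + b + t"
    have "min b (2 * k) \<le> 4 * k" "min b (2 * k) \<le> 2 * k" by auto
    with x obtain v where "x \<in> set_decode v" "card (set_decode v) = 2 ^ min b (2 * k)"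
      "CT D (nat_str v) (nat_str x) \<le> s" "K v + min b (2 * k) \<le> 3 * k + s"
      unfolding has_gray_profile_def by blast
    moreover from this(4) * have "K v \<le> a + t + s" by (auto simp: min_def split: if_splits)
    moreover have "min b (2 * k) \<le> b" by simp
    ultimately show ?thesis by blast
  qed
  then obtain j v where v: "j \<le> b" "x \<in> set_decode v" "card (set_decode v) = 2 ^ j"
    "CT D (nat_str v) (nat_str x) \<le> s" "K v \<le> a + t + s" by blast
  have "log 2 (real (card (nat_str ` set_decode v))) = j" by (simp add: code_model(3) v(3))
  with v show thesis
    by (intro that[of "nat_str ` set_decode v"]) (simp_all add: code_model)
qed

lemma gray_profile_boundary:
  assumes x: "has_gray_profile k s x" and ab: "(a, b) \<in> profile D (nat_str x)"
  shows "4 * k \<le> a + b + s \<or> k \<le> a \<and> 3 * k \<le> a + b + s"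
proof -
  from ab obtain v where "x \<in> set_decode v" "K v \<le> a" "card (set_decode v) \<le> 2 ^ b"
    unfolding profile_def using in_profile_code by blast
  with x show ?thesis unfolding has_gray_profile_def by blast
qed

text \<open>Two errors \<open>s\<close> add up, one from the lower boundary of the profile and one
  from the strong model.\<close>

lemma gray_profile_normal:
  assumes x: "has_gray_profile k s x" and s: "2 * real s \<le> e"
  shows "normal D e e (nat_str x)"
  unfolding normal_def
proof (intro allI impI)
  fix a b assume "(a, b) \<in> profile D (nat_str x)"
  from gray_profile_strong_model[OF x gray_profile_boundary[OF x this]]
  obtain A where A: "finite A" "nat_str x \<in> A" "CT_set D A (nat_str x) \<le> s"
    "C_set D A \<le> a + s + s" "log 2 (card A) \<le> b" by blast
  have "real (CT_set D A (nat_str x)) \<le> real s" "real (C_set D A) \<le> real (a + s + s)"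
    using A(3,4) by (simp_all only: of_nat_le_iff)
  with A s show "in_strong_profile D e (nat_str x) (real a + e) (real b + e)"
    unfolding in_strong_profile_def by (intro exI[of _ A]) auto
qed

lemma gray_profile_close:
  assumes x: "has_gray_profile k s x" and s: "2 * real s \<le> e"
  shows "close e (profile D (nat_str x)) (G k)"
  unfolding close_def
proof (intro conjI ballI)
  fix p assume "p \<in> profile D (nat_str x)"
  then obtain a b where p: "p = (a, b)" "(a, b) \<in> profile D (nat_str x)" by (cases p) auto
  \<comment> \<open>A shift by \<open>s\<close> in the complexity coordinate suffices, here and in
    the converse inclusion.\<close>
  from gray_profile_boundary[OF x p(2)] have "(a + s, b) \<in> G k" unfolding G_def by auto
  with s show "in_nbhd e (G k) p" unfolding in_nbhd_def p(1) by (intro bexI[of _ "(a + s, b)"]) auto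
next
  fix p assume "p \<in> G k"
  then obtain a b where p: "p = (a, b)" "4 * k \<le> a + b + 0 \<or> k \<le> a \<and> 3 * k \<le> a + b + 0"
    unfolding G_def by auto
  obtain A where A: "finite A" "nat_str x \<in> A" "CT_set D A (nat_str x) \<le> s"
    "C_set D A \<le> a + 0 + s" "log 2 (card A) \<le> b"
    by (rule gray_profile_strong_model[OF x p(2)])
  have "real (C_set D A) \<le> real (a + s)" using A(4) by (simp only: of_nat_le_iff add_0_right)
  with A(1,2,5) have "(a + s, b) \<in> profile D (nat_str x)"
    unfolding profile_def in_profile_def mem_Collect_eq prod.case by blast
  with s show "in_nbhd e (profile D (nat_str x)) p"
    unfolding in_nbhd_def p(1) by (intro bexI[of _ "(a + s, b)"]) auto
qed

lemma gray_profile_sufficient_model: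
  assumes x: "has_gray_profile k s x" and s: "2 * real s \<le> e"
  shows "\<exists>A. finite A \<and> nat_str x \<in> A \<and> real (CT_set D A (nat_str x)) \<le> e \<and>
    \<bar>real (C_set D A) - real k\<bar> \<le> e \<and> card A = 2 ^ (2 * k)"
proof -
  have "2 * k \<le> 4 * k" "2 * k \<le> 2 * k" by auto
  with x obtain v where v: "x \<in> set_decode v" "card (set_decode v) = 2 ^ (2 * k)"
    "CT D (nat_str v) (nat_str x) \<le> s" "K v + 2 * k \<le> 3 * k + s" "k \<le> K v"
    unfolding has_gray_profile_def by blast
  have "real (K v) \<le> real k + real s" "real k \<le> real (K v)"
    using v(4,5) by linarith+
  moreover have "real (CT D (nat_str v) (nat_str x)) \<le> real s" using v(3) by simp
  ultimately show ?thesis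
    using v(1,2) s by (intro exI[of _ "nat_str ` set_decode v"]) (auto simp: code_model)
qed

end

text \<open>Provides the threshold for \<open>k\<close>: since \<open>2 ^ (r - 1) \<le> k\<close>,
  it yields \<open>c * r \<le> k\<close>. Starting at \<open>2 * c + 5\<close> reduces the base case
  to \<open>c \<le> 2 ^ c\<close> and \<open>2 * c + 5 \<le> 16 * 2 ^ c\<close>.\<close>

lemma mult_less_power2:
  obtains R :: nat where "\<And>r. R \<le> r \<Longrightarrow> c * r \<le> 2 ^ (r - 1)"
proof
  fix r :: nat assume r: "2 * c + 5 \<le> r"
  show "c * r \<le> 2 ^ (r - 1)"
    using r
  proof (induction r rule: dec_induct)
    case base
    have c: "c \<le> 2 ^ c" using less_exp[of c] by simp
    have "1 \<le> (2::nat) ^ c" by simp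
    with c have "2 * c + 5 \<le> 16 * 2 ^ c" by linarith
    with c have "c * (2 * c + 5) \<le> 2 ^ c * (16 * 2 ^ c)" by (rule mult_le_mono)
    also have "\<dots> = 2 ^ c * (2 ^ 4 * 2 ^ c)" by simp
    also have "\<dots> = 2 ^ (c + (4 + c))" by (simp only: power_add)
    also have "c + (4 + c) = 2 * c + 5 - 1" by simp
    finally show ?case .
  next
    case (step r)
    have "c \<le> 2 ^ (r - 1)" by (rule order_trans[OF _ step.IH]) (use step.hyps in simp)
    with step.IH have "c + c * r \<le> 2 ^ (r - 1) + 2 ^ (r - 1)" by (rule add_mono[rotated])
    then have "c * Suc r \<le> 2 * 2 ^ (r - 1)" by simp
    also have "\<dots> = 2 ^ (Suc r - 1)" using step.hyps by (cases r) auto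
    finally show ?case .
  qed
qed

theorem theorem7:
  assumes "universal D"
  shows "\<exists>c::real. \<exists>K::nat. \<forall>k\<ge>K. \<exists>x.
    length x = 4 * k \<and>
    \<bar>real (C D x) - 3 * real k\<bar> \<le> c * log 2 k \<and>
    normal D (c * log 2 k) (c * log 2 k) x \<and>
    close (c * log 2 k) (profile D x) (G k) \<and>
    (\<exists>A. finite A \<and> x \<in> A \<and> real (CT_set D A x) \<le> c * log 2 k \<and>
         \<bar>real (C_set D A) - real k\<bar> \<le> c * log 2 k \<and> card A = 2 ^ (2 * k)) \<and>
    (\<forall>m l eps delta q. enumerates q (L D m) \<and> S_defined D m l \<and> x \<in> S D q m l \<and>
        CT_set D (S D q m l) x < eps \<and>
        int (C_set D (S D q m l)) + int l - int (C D x) \<le> int eps \<and>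
        C_set D (S D q m l) \<le> k + delta
      \<longrightarrow> c * (real eps + real delta + real (C_prog D q) + 1) \<ge> real k - c * log 2 k)"
proof -
  interpret universal_decompressor D by unfold_locales (rule assms)
  obtain c1 where c1: "\<And>k r. 1 \<le> r \<Longrightarrow> k < 2 ^ r \<Longrightarrow> c1 * r \<le> k \<Longrightarrow>
    \<exists>x. \<not> bad k r x \<and> has_gray_profile k (c1 * r) x"
    by (rule gray_profile_exists) (rule that)
  obtain c2 where c2: "\<And>k r x m l eps delta q. 1 \<le> r \<Longrightarrow> k < 2 ^ r \<Longrightarrow> c2 * r \<le> k \<Longrightarrow>
    first_str k \<le> x \<Longrightarrow> x < first_str k + 2 ^ (4 * k) \<Longrightarrow> \<not> bad k r x \<Longrightarrow>
    3 * k \<le> K x + c1 * r \<Longrightarrow> K x \<le> 3 * k + c1 * r \<Longrightarrow>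
    enumerates q (L D m) \<Longrightarrow> S_defined D m l \<Longrightarrow> nat_str x \<in> S D q m l \<Longrightarrow>
    CT_set D (S D q m l) (nat_str x) < eps \<Longrightarrow> C_set D (S D q m l) + l \<le> K x + eps \<Longrightarrow>
    C_set D (S D q m l) \<le> k + delta \<Longrightarrow> k \<le> 2 * (eps + delta + C_prog D q) + c2 * r"
    by (rule universal_models_not_strong) (rule that)
  obtain R where R: "\<And>r. R \<le> r \<Longrightarrow> (c1 + c2) * r \<le> 2 ^ (r - 1)"
    by (rule mult_less_power2) (rule that)
  \<comment> \<open>The summand 2 is the factor of item 3. In the 4, one factor 2 pays for errors of
    \<open>2 * s\<close>, the other for \<open>r \<le> 2 * log 2 k\<close>.\<close>
  define c where "c = 2 + 4 * real (c1 + c2)"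
  show ?thesis
  \<comment> \<open>The exponent \<open>R + 2\<close> gives \<open>R \<le> r\<close> and also
    \<open>2 \<le> r'\<close>, from which \<open>r = r' + 1 \<le> 2 * log 2 k\<close>
    follows.\<close>
  proof (intro exI[of _ c] exI[of _ "2 ^ (R + 2)"] allI impI)
    fix k :: nat assume k: "2 ^ (R + 2) \<le> k"
    have "(1::nat) \<le> 2 ^ (R + 2)" by simp
    with k have "1 \<le> k" by linarith
    obtain r' where r': "2 ^ r' \<le> k" "k < 2 ^ Suc r'"
      using ex_power_ivl1[of 2 k] \<open>1 \<le> k\<close> by auto
    define r where "r = Suc r'"
    have "(2::nat) ^ (R + 2) < 2 ^ Suc r'" using k r'(2) by linarith
    then have "R + 2 < Suc r'" by (simp only: power_strict_increasing_iff)
    then have "R \<le> r" "2 \<le> r'" unfolding r_def by auto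
    have r: "1 \<le> r" "k < 2 ^ r" using r'(2) unfolding r_def by auto
    have cr: "c1 * r + c2 * r \<le> k"
      using R[OF \<open>R \<le> r\<close>] r'(1) unfolding r_def by (simp add: algebra_simps)
    have "real (2 ^ r') \<le> real k" using r'(1) by (simp only: of_nat_le_iff)
    then have "2 powr real r' \<le> real k" by (simp add: powr_realpow)
    then have "real r' \<le> log 2 k" using \<open>1 \<le> k\<close> by (subst le_log_iff) auto
    then have r_le: "real r \<le> 2 * log 2 k" using \<open>2 \<le> r'\<close> unfolding r_def by simp
    define s where "s = c1 * r"
    define e where "e = c * log 2 k"
    have log: "0 \<le> log 2 k" using r_le by linarith
    have "2 * real (c1 + c2) * real r \<le> 2 * real (c1 + c2) * (2 * log 2 k)"
      using r_le by (intro mult_left_mono) auto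
    also have "\<dots> \<le> e" unfolding e_def c_def using log by (simp add: algebra_simps)
    finally have e: "2 * real (c1 * r) + 2 * real (c2 * r) \<le> e" by (simp add: algebra_simps)
    then have es: "2 * real s \<le> e" "real (c2 * r) \<le> e" unfolding s_def by linarith+
    have "c1 * r \<le> k" "c2 * r \<le> k" using cr by auto
    from c1[OF r this(1)] obtain x where x: "\<not> bad k r x" "has_gray_profile k s x"
      unfolding s_def by blast
    have bounds: "first_str k \<le> x" "x < first_str k + 2 ^ (4 * k)" "3 * k \<le> K x + s" "K x \<le> 3 * k + s"
      using x(2) unfolding has_gray_profile_def by auto
    have "\<bar>real (C D (nat_str x)) - 3 * real k\<bar> \<le> e"
    proof -
      have "3 * real k \<le> real (K x) + real s" "real (K x) \<le> 3 * real k + real s"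
        using bounds(3,4) by linarith+
      with es show ?thesis unfolding K_def by linarith
    qed
    moreover have "c * (real eps + real delta + real (C_prog D q) + 1) \<ge> real k - e"
      if *: "enumerates q (L D m)" "S_defined D m l" "nat_str x \<in> S D q m l"
        "CT_set D (S D q m l) (nat_str x) < eps"
        "int (C_set D (S D q m l)) + int l - int (C D (nat_str x)) \<le> int eps"
        "C_set D (S D q m l) \<le> k + delta" for m l eps delta q
    proof -
      have "C_set D (S D q m l) + l \<le> K x + eps" using *(5) unfolding K_def by linarith
      from c2[OF r \<open>c2 * r \<le> k\<close> bounds(1,2) x(1) bounds(3,4)[unfolded s_def] *(1-4) this *(6)]
      have "real k \<le> real (2 * (eps + delta + C_prog D q) + c2 * r)" by (simp only: of_nat_le_iff)
      then have "real k \<le> 2 * (real eps + real delta + real (C_prog D q) + 1) + e"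
        using es(2) by simp
      also have "2 * (real eps + real delta + real (C_prog D q) + 1) \<le>
        c * (real eps + real delta + real (C_prog D q) + 1)"
        unfolding c_def by (intro mult_right_mono) auto
      finally show ?thesis by simp
    qed
    ultimately show "\<exists>x. length x = 4 * k \<and>
      \<bar>real (C D x) - 3 * real k\<bar> \<le> c * log 2 k \<and>
      normal D (c * log 2 k) (c * log 2 k) x \<and>
      close (c * log 2 k) (profile D x) (G k) \<and>
      (\<exists>A. finite A \<and> x \<in> A \<and> real (CT_set D A x) \<le> c * log 2 k \<and>
           \<bar>real (C_set D A) - real k\<bar> \<le> c * log 2 k \<and> card A = 2 ^ (2 * k)) \<and>
      (\<forall>m l eps delta q. enumerates q (L D m) \<and> S_defined D m l \<and> x \<in> S D q m l \<and>
          CT_set D (S D q m l) x < eps \<and>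
          int (C_set D (S D q m l)) + int l - int (C D x) \<le> int eps \<and>
          C_set D (S D q m l) \<le> k + delta
        \<longrightarrow> c * (real eps + real delta + real (C_prog D q) + 1) \<ge> real k - c * log 2 k)"
      unfolding e_def[symmetric]
      using has_gray_profile_length[OF x(2)] gray_profile_normal[OF x(2) es(1)]
        gray_profile_close[OF x(2) es(1)] gray_profile_sufficient_model[OF x(2) es(1)]
      by (intro exI[of _ "nat_str x"]) blast
  qed
qed

end
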